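(* Let $G=(V,E)$ be a connected, locally finite, unimodular quasi-transitive graph satisfying $(\mathrm{HK}_{\gamma,c})$ for some $c>0$ and $\gamma>1/2$. Then critical Bernoulli bond percolation on $G$ (i.e. $\omega_{p_c}$ with $p_c=p_c(G)$) has no infinite clusters almost surely.
   Context: Bernoulli bond percolation with parameter $p\in[0,1]$ on $G$: each edge is retained independently with probability $p$ and deleted otherwise; the resulting random subgraph is $\omega_p$, its connected components are clusters. $p_c(G)=\inf\{p\in[0,1]:\omega_p \text{ has an infinite cluster a.s.}\}$. $G$ is quasi-transitive if the action of its automorphism group $\mathrm{Aut}(G)$ on $V$ has finitely many orbits (transitive if one orbit). $G$ is unimodular if $|\mathrm{Stab}_u v|=|\mathrm{Stab}_v u|$ for all $u,v$ in the same $\mathrm{Aut}(G)$-orbit, where $\mathrm{Stab}_u=\{\gamma\in\mathrm{Aut}(G):\gamma u=u\}$ and $\mathrm{Stab}_u v=\{\gamma v:\gamma\in \mathrm{Stab}_u\}$. Condition $(\mathrm{HK}_{\gamma,c})$: $p_n(v,v)\le \exp[-c n^\gamma]$ for every $v\in V$ and $n\ge1$, where $p_n(v,v)$ is the probability that simple random walk started at $v$ is at $v$ at time $n$. *)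

theory Defs
  imports "HOL-Probability.Probability"
begin

definition sym_graph :: "('v \<Rightarrow> 'v \<Rightarrow> bool) \<Rightarrow> bool" where
  "sym_graph adj \<longleftrightarrow> (\<forall>u w. adj u w \<longleftrightarrow> adj w u) \<and> (\<forall>u. \<not> adj u u)"

definition nbrs :: "('v \<Rightarrow> 'v \<Rightarrow> bool) \<Rightarrow> 'v \<Rightarrow> 'v set" where
  "nbrs adj v = {w. adj v w}"

definition locally_finite :: "('v \<Rightarrow> 'v \<Rightarrow> bool) \<Rightarrow> bool" where
  "locally_finite adj \<longleftrightarrow> (\<forall>v. finite (nbrs adj v))"

definition connected_graph :: "('v \<Rightarrow> 'v \<Rightarrow> bool) \<Rightarrow> bool" where
  "connected_graph adj \<longleftrightarrow> (\<forall>u w. adj\<^sup>*\<^sup>* u w)"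

definition graph_edges :: "('v \<Rightarrow> 'v \<Rightarrow> bool) \<Rightarrow> 'v set set" where
  "graph_edges adj = {{u, w} | u w. adj u w}"

definition graph_aut :: "('v \<Rightarrow> 'v \<Rightarrow> bool) \<Rightarrow> ('v \<Rightarrow> 'v) \<Rightarrow> bool" where
  "graph_aut adj f \<longleftrightarrow> bij f \<and> (\<forall>u w. adj u w \<longleftrightarrow> adj (f u) (f w))"

definition aut_orbit :: "('v \<Rightarrow> 'v \<Rightarrow> bool) \<Rightarrow> 'v \<Rightarrow> 'v set" where
  "aut_orbit adj v = {f v | f. graph_aut adj f}"

definition quasi_transitive :: "('v \<Rightarrow> 'v \<Rightarrow> bool) \<Rightarrow> bool" where
  "quasi_transitive adj \<longleftrightarrow> finite (range (aut_orbit adj))"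

definition stab :: "('v \<Rightarrow> 'v \<Rightarrow> bool) \<Rightarrow> 'v \<Rightarrow> ('v \<Rightarrow> 'v) set" where
  "stab adj u = {f. graph_aut adj f \<and> f u = u}"

definition stab_orbit :: "('v \<Rightarrow> 'v \<Rightarrow> bool) \<Rightarrow> 'v \<Rightarrow> 'v \<Rightarrow> 'v set" where
  "stab_orbit adj u v = (\<lambda>f. f v) ` stab adj u"

definition unimodular :: "('v \<Rightarrow> 'v \<Rightarrow> bool) \<Rightarrow> bool" where
  "unimodular adj \<longleftrightarrow>
     (\<forall>u v. v \<in> aut_orbit adj u \<longrightarrow> card (stab_orbit adj u v) = card (stab_orbit adj v u))"

fun srw_prob :: "('v \<Rightarrow> 'v \<Rightarrow> bool) \<Rightarrow> nat \<Rightarrow> 'v \<Rightarrow> 'v \<Rightarrow> real" where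
  "srw_prob adj 0 v w = (if v = w then 1 else 0)"
| "srw_prob adj (Suc n) v w =
     (\<Sum>u\<in>nbrs adj v. srw_prob adj n u w) / real (card (nbrs adj v))"

definition HK :: "('v \<Rightarrow> 'v \<Rightarrow> bool) \<Rightarrow> real \<Rightarrow> real \<Rightarrow> bool" where
  "HK adj \<gamma> c \<longleftrightarrow> (\<forall>v n. n \<ge> 1 \<longrightarrow> srw_prob adj n v v \<le> exp (- c * real n powr \<gamma>))"

definition perc_measure :: "('v \<Rightarrow> 'v \<Rightarrow> bool) \<Rightarrow> real \<Rightarrow> ('v set \<Rightarrow> bool) measure" where
  "perc_measure adj p = PiM (graph_edges adj) (\<lambda>_. measure_pmf (bernoulli_pmf p))"

definition cluster :: "('v \<Rightarrow> 'v \<Rightarrow> bool) \<Rightarrow> ('v set \<Rightarrow> bool) \<Rightarrow> 'v \<Rightarrow> 'v set" where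
  "cluster adj \<omega> v = {w. (\<lambda>x y. adj x y \<and> \<omega> {x, y})\<^sup>*\<^sup>* v w}"

definition has_inf_cluster :: "('v \<Rightarrow> 'v \<Rightarrow> bool) \<Rightarrow> ('v set \<Rightarrow> bool) \<Rightarrow> bool" where
  "has_inf_cluster adj \<omega> \<longleftrightarrow> (\<exists>v. infinite (cluster adj \<omega> v))"

definition p_crit :: "('v \<Rightarrow> 'v \<Rightarrow> bool) \<Rightarrow> real" where
  "p_crit adj = Inf {p \<in> {0..1}. AE \<omega> in perc_measure adj p. has_inf_cluster adj \<omega>}"

end

theory Submission
  imports Defs "HOL-Real_Asymp.Real_Asymp"
begin

text \<open>
  Write \<open>t n\<close> for the largest probability, over all vertices \<open>v\<close>, that the cluster of \<open>v\<close> has at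
  least \<open>n\<close> vertices. The goal is a bound on \<open>t\<close> that tends to \<open>0\<close> and is uniform in \<open>p\<close> slightly
  below \<open>p_c\<close>; it passes to \<open>p_c\<close> because \<open>t n\<close> depends on finitely many edges.

  Let \<open>o\<close> and \<open>v\<close> be joined by a path of length \<open>2m\<close>. By Harris' inequality, both lie in clusters of
  size at least \<open>n\<close> with probability at least a constant times \<open>(t n)\<^sup>2\<close>. Up to the event that some
  vertex of the path has a cluster larger than \<open>N\<close>, one of two things happens. Either \<open>o\<close> and \<open>v\<close>
  share a cluster of size at most \<open>N\<close>. By mass transport and log-convexity of return probabilities,
  the heat kernel bound makes this unlikely, of order \<open>exp (- m / (log N) powr (1/\<gamma> - 1))\<close>, for some
  \<open>v\<close>. Or they lie in distinct large clusters. Opening edges along the path at a cost exponential in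
  \<open>m\<close> makes two large clusters meet at a single edge, which by the two-ghost inequality has
  probability \<open>O(n powr (-1/2))\<close>.

  Taking \<open>n = A ^ m\<close> and \<open>N\<close> about \<open>A ^ (B * m)\<close> gives
  \<open>(t n)\<^sup>2 \<le> C * (exp (- a * m powr (2 - 1/\<gamma>)) + (2 * m + 1) * t N)\<close>, where \<open>2 - 1/\<gamma> > 0\<close> is the hypothesis
  \<open>\<gamma> > 1/2\<close>. For fixed \<open>p < p_c\<close> the tail is exponential (Vanneuville's proof of sharpness), so the
  inequality can be solved downwards from arbitrarily large scales.
\<close>

section \<open>Random subsets of a finite set\<close>

text \<open>The exponent \<open>2 - 1/\<gamma>\<close> comes from one trade-off. Return
  probabilities are compared at time \<open>2 * m * k\<close>, where the heat kernel has to beat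
  \<open>N\<close>, which is exponential in \<open>m\<close>; this forces \<open>k\<close> of order
  \<open>m powr (1/\<gamma> - 1)\<close>. Taking \<open>k\<close>-th roots leaves
  \<open>exp (- m / k)\<close> for a walk of length \<open>2 * m\<close>, and \<open>m / k\<close>
  grows exactly when \<open>\<gamma> > 1/2\<close>. The base \<open>A\<close> is so large that
  \<open>n powr (-1/2)\<close> beats the price of opening \<open>2 * m\<close> edges, and
  \<open>B\<close> so large that the claimed bound at scale \<open>B * m\<close> is far smaller than
  the square of the one at \<open>m\<close>. The decay rate below \<open>p_c\<close> may degenerate
  as \<open>p\<close> approaches \<open>p_c\<close>, but it decides only where the descent through
  the scales starts, not the bound that it ends with. Clusters are always cut off at a finite size.
  Hence every event depends on finitely many edges, and its probability is the finite sum
  \<open>bexp\<close>, the mean over independent edges kept with probability \<open>p\<close> and a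
  polynomial in \<open>p\<close>. The product measure appears only at the end, to connect these sums
  with \<open>p_crit\<close>.\<close>

definition bexp :: "real \<Rightarrow> 'e set \<Rightarrow> ('e set \<Rightarrow> real) \<Rightarrow> real" where
  "bexp p F f = (\<Sum>S\<in>Pow F. p ^ card S * (1 - p) ^ card (F - S) * f S)"

lemma bexp_empty [simp]: "bexp p {} f = f {}"
  by (simp add: bexp_def)

lemma bexp_insert:
  assumes "finite F" "e \<notin> F"
  shows "bexp p (insert e F) f = p * bexp p F (\<lambda>S. f (insert e S)) + (1 - p) * bexp p F f"
proof -
  have inj: "inj_on (insert e) (Pow F)"
    using assms(2) by (auto simp: inj_on_def)
  have disj: "Pow F \<inter> insert e ` Pow F = {}"
    using assms(2) by auto
  have "bexp p (insert e F) f =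
      (\<Sum>S\<in>Pow F. p ^ card S * (1 - p) ^ card (insert e F - S) * f S)
    + (\<Sum>S\<in>Pow F. p ^ card (insert e S) * (1 - p) ^ card (insert e F - insert e S) * f (insert e S))"
    unfolding bexp_def Pow_insert
    by (subst sum.union_disjoint) (use assms disj in \<open>auto simp: sum.reindex[OF inj]\<close>)
  also have "(\<Sum>S\<in>Pow F. p ^ card S * (1 - p) ^ card (insert e F - S) * f S) = (1 - p) * bexp p F f"
    unfolding bexp_def sum_distrib_left
  proof (rule sum.cong)
    fix S assume "S \<in> Pow F"
    then have "insert e F - S = insert e (F - S)" "e \<notin> F - S" "finite (F - S)"
      using assms by auto
    then show "p ^ card S * (1 - p) ^ card (insert e F - S) * f S =
        (1 - p) * (p ^ card S * (1 - p) ^ card (F - S) * f S)" by simp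
  qed simp
  also have "(\<Sum>S\<in>Pow F. p ^ card (insert e S) * (1 - p) ^ card (insert e F - insert e S) * f (insert e S))
     = p * bexp p F (\<lambda>S. f (insert e S))"
    unfolding bexp_def sum_distrib_left
  proof (rule sum.cong)
    fix S assume S: "S \<in> Pow F"
    then have "insert e F - insert e S = F - S" "e \<notin> S" "finite S"
      using assms finite_subset by auto
    then show "p ^ card (insert e S) * (1 - p) ^ card (insert e F - insert e S) * f (insert e S) =
        p * (p ^ card S * (1 - p) ^ card (F - S) * f (insert e S))" by simp
  qed simp
  finally show ?thesis by simp
qed

lemma bexp_remove:
  assumes "finite F" "e \<in> F"
  shows "bexp p F f = p * bexp p (F - {e}) (\<lambda>S. f (insert e S)) + (1 - p) * bexp p (F - {e}) f"
  using bexp_insert[of "F - {e}" e p f] assms by (simp add: insert_absorb)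

lemma bexp_cong:
  assumes "\<And>S. S \<subseteq> F \<Longrightarrow> f S = g S"
  shows "bexp p F f = bexp p F g"
  unfolding bexp_def using assms by (intro sum.cong) auto

lemma bexp_add: "bexp p F (\<lambda>S. f S + g S) = bexp p F f + bexp p F g"
  unfolding bexp_def by (simp add: ring_distribs sum.distrib)

lemma bexp_cmult: "bexp p F (\<lambda>S. c * f S) = c * bexp p F f"
  unfolding bexp_def sum_distrib_left by (simp add: mult_ac)

lemma bexp_diff: "bexp p F (\<lambda>S. f S - g S) = bexp p F f - bexp p F g"
  unfolding bexp_def by (simp add: ring_distribs sum_subtractf)

lemma bexp_zero [simp]: "bexp p F (\<lambda>S. 0) = 0"
  by (simp add: bexp_def)

lemma bexp_sum: "bexp p F (\<lambda>S. \<Sum>i\<in>I. f i S) = (\<Sum>i\<in>I. bexp p F (f i))"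
  by (induction I rule: infinite_finite_induct) (auto simp: bexp_add)

lemma bexp_const [simp]: "finite F \<Longrightarrow> bexp p F (\<lambda>S. c) = c"
  by (induction F rule: finite_induct) (auto simp: bexp_insert algebra_simps)

lemma bexp_mono:
  assumes "0 \<le> p" "p \<le> 1" "\<And>S. S \<subseteq> F \<Longrightarrow> f S \<le> g S"
  shows "bexp p F f \<le> bexp p F g"
  unfolding bexp_def using assms by (intro sum_mono mult_left_mono) auto

lemma bexp_nonneg:
  assumes "0 \<le> p" "p \<le> 1" "\<And>S. S \<subseteq> F \<Longrightarrow> 0 \<le> f S"
  shows "0 \<le> bexp p F f"
  unfolding bexp_def using assms by (intro sum_nonneg) auto

lemma bexp_union_restrict:
  assumes "finite X" "finite F0" "X \<inter> F0 = {}" "\<forall>S. S \<subseteq> X \<union> F0 \<longrightarrow> f S = f (S \<inter> F0)"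
  shows "bexp p (X \<union> F0) f = bexp p F0 f"
  using assms
proof (induction X rule: finite_induct)
  case (insert e X)
  have eq: "f (insert e S) = f S" if "S \<subseteq> X \<union> F0" for S
  proof -
    have "insert e S \<inter> F0 = S \<inter> F0" using insert.prems(2) by auto
    moreover have "f (insert e S) = f (insert e S \<inter> F0)" "f S = f (S \<inter> F0)"
      using insert.prems(3) that by blast+
    ultimately show ?thesis by metis
  qed
  have "e \<notin> X \<union> F0" using insert by auto
  then have "bexp p (insert e (X \<union> F0)) f = p * bexp p (X \<union> F0) f + (1 - p) * bexp p (X \<union> F0) f"
    using insert.hyps(1) insert.prems(1) bexp_cong[of "X \<union> F0", OF eq, where p = p]
    by (simp add: bexp_insert)
  also have "\<dots> = bexp p (X \<union> F0) f" by (simp add: algebra_simps)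
  also have "\<dots> = bexp p F0 f"
    by (rule insert.IH) (use insert.prems in blast)+
  finally show ?case by simp
qed simp

lemma bexp_restrict:
  assumes "finite F" "F0 \<subseteq> F" "\<And>S. S \<subseteq> F \<Longrightarrow> f S = f (S \<inter> F0)"
  shows "bexp p F f = bexp p F0 f"
proof -
  have F: "F = (F - F0) \<union> F0" using assms(2) by blast
  have "\<forall>S. S \<subseteq> (F - F0) \<union> F0 \<longrightarrow> f S = f (S \<inter> F0)"
    using assms(3) unfolding F[symmetric] by blast
  then have "bexp p ((F - F0) \<union> F0) f = bexp p F0 f"
    by (intro bexp_union_restrict) (use assms(1,2) finite_subset in auto)
  then show ?thesis using F by metis
qed

text \<open>Condition on one element \<open>e\<close>. By induction the inequality holds given
  either state of \<open>e\<close>, and the covariance of the two conditional means is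
  \<open>p * (1 - p)\<close> times a product of two nonnegative increments.\<close>

lemma harris:
  assumes "finite F" "0 \<le> p" "p \<le> 1"
    and "\<And>S T. S \<subseteq> T \<Longrightarrow> T \<subseteq> F \<Longrightarrow> f S \<le> f T"
    and "\<And>S T. S \<subseteq> T \<Longrightarrow> T \<subseteq> F \<Longrightarrow> g S \<le> g T"
  shows "bexp p F f * bexp p F g \<le> bexp p F (\<lambda>S. f S * g S)"
  using assms
proof (induction F arbitrary: f g rule: finite_induct)
  case (insert e F)
  let ?f1 = "bexp p F (\<lambda>S. f (insert e S))" and ?f0 = "bexp p F f"
  let ?g1 = "bexp p F (\<lambda>S. g (insert e S))" and ?g0 = "bexp p F g"
  have 1: "?f1 * ?g1 \<le> bexp p F (\<lambda>S. f (insert e S) * g (insert e S))"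
    by (rule insert.IH) (use insert.prems in \<open>auto intro!: insert.prems(3,4)\<close>)
  have 0: "?f0 * ?g0 \<le> bexp p F (\<lambda>S. f S * g S)"
    by (rule insert.IH) (use insert.prems in \<open>auto intro!: insert.prems(3,4)\<close>)
  have "?f0 \<le> ?f1" "?g0 \<le> ?g1"
    using insert.prems by (auto intro!: bexp_mono insert.prems(3,4))
  then have "0 \<le> p * (1 - p) * ((?f1 - ?f0) * (?g1 - ?g0))"
    using insert.prems by simp
  then have "(p * ?f1 + (1 - p) * ?f0) * (p * ?g1 + (1 - p) * ?g0)
      \<le> p * (?f1 * ?g1) + (1 - p) * (?f0 * ?g0)"
    by (simp add: algebra_simps)
  also have "\<dots> \<le> p * bexp p F (\<lambda>S. f (insert e S) * g (insert e S)) + (1 - p) * bexp p F (\<lambda>S. f S * g S)"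
    using 0 1 insert.prems by (intro add_mono mult_left_mono) auto
  finally show ?case
    using insert.hyps by (simp add: bexp_insert)
qed simp

lemma harris_decreasing:
  assumes "finite F" "0 \<le> p" "p \<le> 1"
    and "\<And>S T. S \<subseteq> T \<Longrightarrow> T \<subseteq> F \<Longrightarrow> f T \<le> f S"
    and "\<And>S T. S \<subseteq> T \<Longrightarrow> T \<subseteq> F \<Longrightarrow> g T \<le> g S"
  shows "bexp p F f * bexp p F g \<le> bexp p F (\<lambda>S. f S * g S)"
proof -
  have "bexp p F (\<lambda>S. - f S) * bexp p F (\<lambda>S. - g S) \<le> bexp p F (\<lambda>S. - f S * - g S)"
    using assms by (intro harris) auto
  then show ?thesis
    using bexp_cmult[of p F "-1" f] bexp_cmult[of p F "-1" g] by simp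
qed

lemma bexp_power2:
  assumes "finite F" "0 \<le> p" "p \<le> 1"
  shows "(bexp p F f)\<^sup>2 \<le> bexp p F (\<lambda>S. (f S)\<^sup>2)"
proof -
  define m where "m = bexp p F f"
  have "0 \<le> bexp p F (\<lambda>S. (f S - m)\<^sup>2)"
    using assms by (intro bexp_nonneg) auto
  also have "(\<lambda>S. (f S - m)\<^sup>2) = (\<lambda>S. (f S)\<^sup>2 - 2 * m * f S + m\<^sup>2)"
    by (simp add: power2_eq_square algebra_simps)
  also have "bexp p F \<dots> = bexp p F (\<lambda>S. (f S)\<^sup>2) - m\<^sup>2"
    using assms by (simp only: bexp_add bexp_diff bexp_cmult bexp_const m_def[symmetric])
      (simp add: power2_eq_square)
  finally show ?thesis by (simp add: m_def)
qed

lemma bexp_image: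
  assumes "inj_on g F"
  shows "bexp p (g ` F) f = bexp p F (\<lambda>S. f (g ` S))"
proof -
  have "bij_betw ((`) g) (Pow F) (Pow (g ` F))"
    using assms by (simp add: bij_betw_Pow inj_on_imp_bij_betw)
  then have "bexp p (g ` F) f = (\<Sum>S\<in>Pow F. p ^ card (g ` S) * (1 - p) ^ card (g ` F - g ` S) * f (g ` S))"
    unfolding bexp_def by (rule sum.reindex_bij_betw[symmetric])
  also have "\<dots> = bexp p F (\<lambda>S. f (g ` S))"
    unfolding bexp_def
  proof (rule sum.cong)
    fix S assume "S \<in> Pow F"
    then have S: "S \<subseteq> F" by auto
    have "g ` F - g ` S = g ` (F - S)"
      using assms S by (simp add: inj_on_image_set_diff)
    moreover have "card (g ` S) = card S" "card (g ` (F - S)) = card (F - S)"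
      using assms S by (auto intro!: card_image intro: inj_on_subset)
    ultimately show "p ^ card (g ` S) * (1 - p) ^ card (g ` F - g ` S) * f (g ` S) =
       p ^ card S * (1 - p) ^ card (F - S) * f (g ` S)" by simp
  qed simp
  finally show ?thesis .
qed

lemma bexp_continuous: "isCont (\<lambda>p. bexp p F f) p0"
  unfolding bexp_def by (intro continuous_intros)

text \<open>The function \<open>g (insert e S)\<close> ignores the state of \<open>e\<close>, so its
  mean is the conditional mean of \<open>g\<close> given that \<open>e\<close> is open, an event of
  probability \<open>p\<close>.\<close>

lemma bexp_insert_tolerance:
  assumes "finite F" "e \<in> F" "0 < p" "p \<le> 1"
    and "\<And>S. S \<subseteq> F \<Longrightarrow> f S \<le> g (insert e S)" "\<And>S. S \<subseteq> F \<Longrightarrow> 0 \<le> g S"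
  shows "p * bexp p F f \<le> bexp p F g"
proof -
  have "bexp p F f \<le> bexp p F (\<lambda>S. g (insert e S))"
    using assms by (intro bexp_mono) auto
  also have "\<dots> = bexp p (F - {e}) (\<lambda>S. g (insert e S))"
    using bexp_remove[OF assms(1,2), of p "\<lambda>S. g (insert e S)"] by (simp add: algebra_simps)
  finally have "p * bexp p F f \<le> p * bexp p (F - {e}) (\<lambda>S. g (insert e S))"
    using assms by simp
  also have "\<dots> \<le> bexp p F g"
    unfolding bexp_remove[OF assms(1,2), of p g]
    using assms by (auto intro!: mult_nonneg_nonneg bexp_nonneg)
  finally show ?thesis .
qed

section \<open>Clusters\<close>

definition cl :: "'v set set \<Rightarrow> 'v \<Rightarrow> 'v set" where
  "cl S v = {w. (\<lambda>x y. {x, y} \<in> S)\<^sup>*\<^sup>* v w}"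

text \<open>The seed \<open>A\<close> is the explored region of an exploration process: revealing an
  edge at \<open>A\<close> deletes it from the graph and, if it is open, adds its far endpoint to
  \<open>A\<close>.\<close>

definition clA :: "'v set set \<Rightarrow> 'v set \<Rightarrow> 'v set" where
  "clA S A = (\<Union>a\<in>A. cl S a)"

lemma cl_refl [simp]: "v \<in> cl S v"
  by (simp add: cl_def)

lemma cl_trans: "w \<in> cl S v \<Longrightarrow> x \<in> cl S w \<Longrightarrow> x \<in> cl S v"
  by (auto simp: cl_def)

lemma cl_step: "w \<in> cl S v \<Longrightarrow> {w, x} \<in> S \<Longrightarrow> x \<in> cl S v"
  by (auto simp: cl_def intro: rtranclp.rtrancl_into_rtrancl)

lemma cl_induct [consumes 1, case_names base step]:
  assumes "w \<in> cl S v" "P v" "\<And>x y. x \<in> cl S v \<Longrightarrow> P x \<Longrightarrow> {x, y} \<in> S \<Longrightarrow> P y"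
  shows "P w"
proof -
  have "(\<lambda>x y. {x, y} \<in> S)\<^sup>*\<^sup>* v w" using assms(1) by (simp add: cl_def)
  then show ?thesis
  proof (induction rule: rtranclp_induct)
    case (step x y)
    then show ?case using assms(3)[of x y] by (simp add: cl_def)
  qed (rule assms(2))
qed

lemma cl_sym: "w \<in> cl S v \<Longrightarrow> v \<in> cl S w"
proof (induction rule: cl_induct)
  case (step x y)
  then have "x \<in> cl S y" using cl_step[of y S y x] by (simp add: insert_commute)
  then show ?case using step cl_trans by metis
qed simp

lemma cl_eq: "w \<in> cl S v \<Longrightarrow> cl S w = cl S v"
  by (meson cl_sym cl_trans subsetI subset_antisym)

lemma cl_subset:
  assumes "v \<in> C" "\<And>x y. x \<in> C \<Longrightarrow> {x, y} \<in> S \<Longrightarrow> y \<in> C"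
  shows "cl S v \<subseteq> C"
proof
  fix w assume "w \<in> cl S v"
  then show "w \<in> C" by (induction rule: cl_induct) (use assms in blast)+
qed

lemma cl_mono: "S \<subseteq> T \<Longrightarrow> cl S v \<subseteq> cl T v"
  by (rule cl_subset) (auto intro: cl_step)

lemma finite_cl [simp]: "finite S \<Longrightarrow> finite (cl S v)"
proof -
  assume "finite S"
  \<comment> \<open>Members of \<open>S\<close> are arbitrary sets here and may be infinite; only
    the finite ones can be of the form \<open>{x, y}\<close>.\<close>
  then have "finite (insert v (\<Union>{e \<in> S. finite e}))" by auto
  moreover have "cl S v \<subseteq> insert v (\<Union>{e \<in> S. finite e})"
    by (rule cl_subset) auto
  ultimately show ?thesis by (rule rev_finite_subset)
qed

lemma finite_clA [simp]: "finite S \<Longrightarrow> finite A \<Longrightarrow> finite (clA S A)"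
  by (auto simp: clA_def)

lemma clA_empty [simp]: "clA S {} = {}"
  by (simp add: clA_def)

lemma clA_singleton [simp]: "clA S {v} = cl S v"
  by (simp add: clA_def)

lemma clA_mono: "S \<subseteq> T \<Longrightarrow> A \<subseteq> B \<Longrightarrow> clA S A \<subseteq> clA T B"
  unfolding clA_def by (intro UN_mono cl_mono)

lemma subset_clA: "A \<subseteq> clA S A"
  by (auto simp: clA_def)

lemma clA_insert: "clA S (insert y A) = clA S A \<union> cl S y"
  by (auto simp: clA_def)

lemma clA_closed:
  assumes "\<And>x y. x \<in> A \<Longrightarrow> {x, y} \<in> S \<Longrightarrow> y \<in> A"
  shows "clA S A = A"
proof
  show "clA S A \<subseteq> A"
    unfolding clA_def by (intro UN_least cl_subset) (use assms in auto)
qed (rule subset_clA)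

text \<open>This is the open case of one exploration step; the edge itself disappears from the
  right-hand side, so an induction on the number of edges can continue.\<close>

lemma clA_insert_edge:
  assumes "x \<in> A"
  shows "clA (insert {x, y} S) A = clA S (insert y A)"
proof
  show "clA (insert {x, y} S) A \<subseteq> clA S (insert y A)"
  proof -
    have "cl (insert {x, y} S) a \<subseteq> clA S (insert y A)" if "a \<in> A" for a
    proof (rule cl_subset)
      show "a \<in> clA S (insert y A)" using that subset_clA[of "insert y A" S] by auto
      fix w w' assume w: "w \<in> clA S (insert y A)" "{w, w'} \<in> insert {x, y} S"
      show "w' \<in> clA S (insert y A)"
      proof (cases "{w, w'} \<in> S")
        case True
        then show ?thesis using w(1) cl_step[of w S _ w'] by (fastforce simp: clA_def)
      next
        case False
        then have "w' \<in> {x, y}" using w(2) by auto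
        then show ?thesis using assms subset_clA[of "insert y A" S] by blast
      qed
    qed
    then show ?thesis by (auto simp: clA_def)
  qed
  have "y \<in> cl (insert {x, y} S) x"
    using cl_step[of x _ x y] by simp
  then have "cl (insert {x, y} S) y \<subseteq> clA (insert {x, y} S) A"
    using assms cl_eq[of y "insert {x, y} S" x] by (auto simp: clA_def)
  then have "clA (insert {x, y} S) (insert y A) \<subseteq> clA (insert {x, y} S) A"
    by (auto simp: clA_insert)
  then show "clA S (insert y A) \<subseteq> clA (insert {x, y} S) A"
    using clA_mono[of S "insert {x, y} S" "insert y A" "insert y A"] by blast
qed

lemma cl_insert_edge: "cl (insert {x, y} S) x = cl S x \<union> cl S y"
  using clA_insert_edge[of x "{x}" y S] by (simp add: clA_insert Un_commute)

lemma cl_insert_edge_subset: "cl (insert {x, y} S) v \<subseteq> cl S v \<union> cl S x \<union> cl S y"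
proof (rule cl_subset)
  fix w w' assume w: "w \<in> cl S v \<union> cl S x \<union> cl S y" "{w, w'} \<in> insert {x, y} S"
  show "w' \<in> cl S v \<union> cl S x \<union> cl S y"
  proof (cases "{w, w'} \<in> S")
    case True
    then show ?thesis using w(1) cl_step[of w S _ w'] by blast
  next
    case False
    then have "w' = x \<or> w' = y" using w(2) by auto
    then show ?thesis by auto
  qed
qed simp

lemma cl_insert_edge_other:
  assumes "v \<notin> cl S x" "v \<notin> cl S y"
  shows "cl (insert {x, y} S) v = cl S v"
proof
  show "cl (insert {x, y} S) v \<subseteq> cl S v"
  proof (rule cl_subset)
    fix w w' assume w: "w \<in> cl S v" "{w, w'} \<in> insert {x, y} S"
    have "w \<noteq> x" "w \<noteq> y" using assms w cl_sym by metis+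
    then have "{w, w'} \<in> S" using w(2) by (auto simp: doubleton_eq_iff)
    then show "w' \<in> cl S v" using w cl_step by metis
  qed simp
qed (rule cl_mono, auto)

text \<open>Vanneuville's comparison: conditioned on avoiding a ghost field, the cluster explored edge by
  edge still dominates percolation at the slightly smaller parameter \<open>q\<close>.\<close>
lemma ghost_comparison:
  fixes z \<kappa> p q :: real and F0 :: "'v set set"
  assumes F0: "finite F0" and p: "0 \<le> p" "p \<le> 1" and q: "0 \<le> q" "q \<le> 1" and z: "0 < z" "z \<le> 1"
    and \<kappa>: "\<And>F y. F \<subseteq> F0 \<Longrightarrow> \<kappa> \<le> bexp p F (\<lambda>S. z ^ card (cl S y))" and pq: "q \<le> p * \<kappa>"
    and F: "F \<subseteq> F0" and A: "finite A"
  shows "bexp q F (\<lambda>S. of_bool (n \<le> card (clA S A))) * bexp p F (\<lambda>S. z ^ card (clA S A))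
     \<le> bexp p F (\<lambda>S. of_bool (n \<le> card (clA S A)) * z ^ card (clA S A))"
  using F A
proof (induction "card F" arbitrary: F A)
  case (0 F A)
  then have "F = {}" using F0 finite_subset by (metis card_0_eq)
  then show ?case by simp
next
  case (Suc k F A)
  have fF: "finite F" using F0 Suc.prems finite_subset by blast
  show ?case
  proof (cases "\<exists>x\<in>A. \<exists>y. y \<notin> A \<and> {x, y} \<in> F")
    \<comment> \<open>No edge of \<open>F\<close> leaves \<open>A\<close>, so the explored set is
      \<open>A\<close> in every configuration and the claim is an equality.\<close>
    case False
    have "clA S A = A" if "S \<subseteq> F" for S
      by (rule clA_closed) (use False that in blast)
    then have eq: "bexp r F (\<lambda>S. h (clA S A)) = h A" for h :: "'v set \<Rightarrow> real" and r
      using bexp_cong[of F "\<lambda>S. h (clA S A)" "\<lambda>S. h A" r] fF by simp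
    show ?thesis
      using eq[of q "\<lambda>C. of_bool (n \<le> card C)"] eq[of p "\<lambda>C. z ^ card C"]
        eq[of p "\<lambda>C. of_bool (n \<le> card C) * z ^ card C"] by simp
  next
    case True
    then obtain x y where xy: "x \<in> A" "y \<notin> A" "{x, y} \<in> F" by blast
    let ?F = "F - {{x, y}}" and ?B = "insert y A"
    let ?W = "\<lambda>A. bexp q ?F (\<lambda>S. of_bool (n \<le> card (clA S A)))"
    let ?Z = "\<lambda>A. bexp p ?F (\<lambda>S. z ^ card (clA S A))"
    let ?N = "\<lambda>A. bexp p ?F (\<lambda>S. of_bool (n \<le> card (clA S A)) * z ^ card (clA S A))"
    have card: "k = card ?F" using Suc.hyps(2) xy fF by simp
    have IH: "?W A * ?Z A \<le> ?N A" "?W ?B * ?Z ?B \<le> ?N ?B"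
      using Suc.hyps(1)[OF card] Suc.prems by auto
    have le: "card (clA S A) \<le> card (clA S ?B)" if "S \<subseteq> ?F" for S
    proof (intro card_mono clA_mono)
      have "finite S" using that fF finite_subset[of S ?F] by simp
      then show "finite (clA S ?B)" using Suc.prems by simp
    qed auto
    have W: "?W A \<le> ?W ?B"
      using q le by (intro bexp_mono) (auto intro: order.trans)
    have Z: "?Z ?B \<le> ?Z A"
      using p z le by (intro bexp_mono power_decreasing) auto
    have Z0: "0 \<le> ?Z A" using p z by (intro bexp_nonneg) auto
    \<comment> \<open>Adding \<open>y\<close> to the explored set costs at most a factor
      \<open>\<kappa>\<close> in the probability of avoiding the ghosts: sizes are subadditive, and
      avoidance by two sets is positively correlated.\<close>
    have "\<kappa> * ?Z A \<le> bexp p ?F (\<lambda>S. z ^ card (cl S y)) * ?Z A"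
      by (rule mult_right_mono[OF \<kappa> Z0]) (use Suc.prems in blast)
    also have "\<dots> \<le> bexp p ?F (\<lambda>S. z ^ card (cl S y) * z ^ card (clA S A))"
    proof (rule harris_decreasing)
      fix S T assume "S \<subseteq> T" "T \<subseteq> ?F"
      moreover from this have "finite T" using fF finite_subset by blast
      ultimately show "z ^ card (cl T y) \<le> z ^ card (cl S y)" "z ^ card (clA T A) \<le> z ^ card (clA S A)"
        using Suc.prems z by (intro power_decreasing card_mono cl_mono clA_mono finite_cl finite_clA; simp)+
    qed (use fF p in auto)
    also have "\<dots> \<le> ?Z ?B"
    proof (rule bexp_mono[OF p])
      fix S assume "S \<subseteq> ?F"
      have "card (clA S ?B) \<le> card (cl S y) + card (clA S A)"
        by (metis clA_insert card_Un_le add.commute)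
      then show "z ^ card (cl S y) * z ^ card (clA S A) \<le> z ^ card (clA S ?B)"
        using z by (simp flip: power_add add: power_decreasing)
    qed
    finally have Z\<kappa>: "\<kappa> * ?Z A \<le> ?Z ?B" .
    \<comment> \<open>Given avoidance of the ghosts, the edge is open with probability
      \<open>p * ?Z ?B / ?Zm\<close>. The next lines show that this is at least \<open>q\<close>;
      since \<open>?W\<close> is larger in the open case, averaging with \<open>q\<close> only
      lowers the left-hand side.\<close>
    let ?Zm = "p * ?Z ?B + (1 - p) * ?Z A"
    have "?Zm \<le> p * ?Z A + (1 - p) * ?Z A"
      using Z p by (intro add_right_mono mult_left_mono) auto
    then have "?Zm \<le> ?Z A" by (simp add: algebra_simps)
    then have "q * ?Zm \<le> q * ?Z A" using q by (intro mult_left_mono) auto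
    also have "\<dots> \<le> p * \<kappa> * ?Z A" using pq Z0 by (intro mult_right_mono) auto
    also have "\<dots> \<le> p * ?Z ?B" using Z\<kappa> p by (simp add: mult.assoc mult_left_mono)
    finally have "0 \<le> (?W ?B - ?W A) * (p * ?Z ?B - q * ?Zm)"
      using W by simp
    then have "(q * ?W ?B + (1 - q) * ?W A) * ?Zm \<le> p * (?W ?B * ?Z ?B) + (1 - p) * (?W A * ?Z A)"
      by (simp add: algebra_simps)
    also have "\<dots> \<le> p * ?N ?B + (1 - p) * ?N A"
      using IH p by (intro add_mono mult_left_mono) auto
    finally show ?thesis
      unfolding bexp_remove[OF fF xy(3)] clA_insert_edge[OF xy(1)] .
  qed
qed

text \<open>The centred indicator of a closed edge, that is \<open>p\<close> minus the indicator of
  an open edge; its mean is zero.\<close>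

definition zeta :: "real \<Rightarrow> 'e set \<Rightarrow> 'e \<Rightarrow> real" where
  "zeta p S e = (if e \<in> S then - (1 - p) else p)"

definition touching :: "'v set set \<Rightarrow> 'v set \<Rightarrow> 'v set set" where
  "touching F C = {e \<in> F. e \<inter> C \<noteq> {}}"

text \<open>Revealing the edges touching a cluster one at a time makes the sum of \<open>zeta\<close> a martingale with
  bounded increments; the weight \<open>1/(n+t)\<close> is chosen so that the squared weighted martingale has
  summable drift.\<close>
lemma exploration_fluctuation:
  fixes p :: real and F :: "'v set set"
  assumes "finite F" "\<And>e. e \<in> F \<Longrightarrow> \<exists>x y. e = {x, y}" "0 \<le> p" "p \<le> 1" "0 < n"
  shows "bexp p F (\<lambda>S. ((z + (\<Sum>e\<in>touching F (clA S A). zeta p S e)) / (n + t + card (touching F (clA S A))))\<^sup>2)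
     \<le> (z / (real n + real t))\<^sup>2 + 1 / (real n + real t)"
  using assms(1,2)
proof (induction "card F" arbitrary: F A t z)
  case 0
  then have "F = {}" by simp
  then show ?case using assms by (simp add: touching_def)
next
  case (Suc k F A t z)
  show ?case
  proof (cases "touching F A = {}")
    case True
    then have "touching F (clA S A) = {}" if "S \<subseteq> F" for S
      using clA_closed[of A S] that by (fastforce simp: touching_def)
    then have "bexp p F (\<lambda>S. ((z + (\<Sum>e\<in>touching F (clA S A). zeta p S e)) / (n + t + card (touching F (clA S A))))\<^sup>2)
       = bexp p F (\<lambda>S. (z / (real n + real t))\<^sup>2)"
      by (intro bexp_cong) simp
    then show ?thesis using Suc.prems by simp
  next
    case False
    then obtain e where e: "e \<in> F" "e \<inter> A \<noteq> {}" by (auto simp: touching_def)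
    then obtain x y where xy: "e = {x, y}" "x \<in> A" using Suc.prems(2)[OF e(1)] by (auto simp: insert_commute)
    let ?F = "F - {e}"
    let ?X = "\<lambda>z A. bexp p ?F (\<lambda>S. ((z + (\<Sum>e\<in>touching ?F (clA S A). zeta p S e)) / (n + Suc t + card (touching ?F (clA S A))))\<^sup>2)"
    have card: "k = card ?F" using Suc.hyps(2) e Suc.prems by simp
    have IH: "?X z A \<le> (z / (real n + real (Suc t)))\<^sup>2 + 1 / (real n + real (Suc t))" for z A
      using Suc.prems by (intro Suc.hyps(1)[OF card]) auto
    have touch: "touching F (clA S B) = insert e (touching ?F (clA S B))" if "A \<subseteq> B" for S B
      using e that subset_clA[of B S] by (auto simp: touching_def)
    have fin: "finite (touching ?F C)" for C using Suc.prems by (simp add: touching_def)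
    have notin: "e \<notin> touching ?F C" for C by (simp add: touching_def)
    \<comment> \<open>The number \<open>t\<close> counts the edges revealed so far and
      \<open>z\<close> is the sum of their \<open>zeta\<close>; revealing \<open>e\<close> moves it
      from the touching set into both. The denominator is unchanged.\<close>
    have op: "(z + (\<Sum>f\<in>touching F (clA (insert e S) A). zeta p (insert e S) f)) / (n + t + card (touching F (clA (insert e S) A)))
       = (z - (1 - p) + (\<Sum>e\<in>touching ?F (clA S (insert y A)). zeta p S e)) / (n + Suc t + card (touching ?F (clA S (insert y A))))"
      for S
    proof -
      have "(\<Sum>f\<in>touching ?F (clA S (insert y A)). zeta p (insert e S) f) = (\<Sum>f\<in>touching ?F (clA S (insert y A)). zeta p S f)"
        by (rule sum.cong) (auto simp: zeta_def touching_def)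
      then show ?thesis
        unfolding xy(1) clA_insert_edge[OF xy(2)] touch[of "insert y A", unfolded xy(1), OF subset_insertI]
        using fin notin by (simp add: xy(1) zeta_def algebra_simps)
    qed
    have clo: "(z + (\<Sum>f\<in>touching F (clA S A). zeta p S f)) / (n + t + card (touching F (clA S A)))
       = (z + p + (\<Sum>e\<in>touching ?F (clA S A). zeta p S e)) / (n + Suc t + card (touching ?F (clA S A)))"
      if "S \<subseteq> ?F" for S
    proof -
      have "e \<notin> S" using that by auto
      then show ?thesis
        unfolding touch[OF subset_refl] using fin notin by (simp add: zeta_def algebra_simps)
    qed
    define a where "a = real n + real t"
    have a: "a > 0" using assms(5) by (simp add: a_def)
    have a1: "real n + real (Suc t) = a + 1" by (simp add: a_def)
    have "bexp p F (\<lambda>S. ((z + (\<Sum>e\<in>touching F (clA S A). zeta p S e)) / (n + t + card (touching F (clA S A))))\<^sup>2)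
       = p * ?X (z - (1 - p)) (insert y A) + (1 - p) * ?X (z + p) A"
      unfolding bexp_remove[OF Suc.prems(1) e(1)] op using clo by (simp cong: bexp_cong)
    also have "\<dots> \<le> p * (((z - (1 - p)) / (a + 1))\<^sup>2 + 1 / (a + 1)) + (1 - p) * (((z + p) / (a + 1))\<^sup>2 + 1 / (a + 1))"
      using assms IH unfolding a1 by (intro add_mono mult_left_mono) auto
    also have "\<dots> = (z\<^sup>2 + p * (1 - p)) / (a + 1)\<^sup>2 + 1 / (a + 1)"
    proof -
      have *: "p * (X / d + r) + (1 - p) * (Y / d + r) = (p * X + (1 - p) * Y) / d + r" for X Y d r :: real
        by (simp add: ring_distribs add_divide_distrib diff_divide_distrib)
      \<comment> \<open>The increment is centred, so the cross term vanishes and only the variance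
        \<open>p * (1 - p)\<close> is added.\<close>
      have "p * (z - (1 - p))\<^sup>2 + (1 - p) * (z + p)\<^sup>2 = z\<^sup>2 + p * (1 - p)"
        by (simp add: power2_eq_square algebra_simps)
      then show ?thesis unfolding power_divide * by simp
    qed
    also have "\<dots> \<le> (z\<^sup>2 + 1) / (a + 1)\<^sup>2 + 1 / (a + 1)"
      using assms mult_le_one[of p "1 - p"] by (intro add_right_mono divide_right_mono) auto
    also have "\<dots> = z\<^sup>2 / (a + 1)\<^sup>2 + (1 / (a + 1)\<^sup>2 + 1 / (a + 1))"
      by (simp add: add_divide_distrib)
    also have "\<dots> \<le> z\<^sup>2 / a\<^sup>2 + 1 / a"
    proof (intro add_mono)
      show "z\<^sup>2 / (a + 1)\<^sup>2 \<le> z\<^sup>2 / a\<^sup>2" using a by (intro divide_left_mono) (auto intro!: power_mono)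
      \<comment> \<open>The term \<open>1 / a\<close> dominates the sum of the inverse squares of
        \<open>a + 1, a + 2, ...\<close>; peeling off one summand is what absorbs the
        variance.\<close>
      have "1 / (a + 1) = (a + 1) / (a + 1)\<^sup>2"
        using a by (simp add: power2_eq_square)
      then have "1 / (a + 1)\<^sup>2 + 1 / (a + 1) = (a + 2) / (a + 1)\<^sup>2"
        by (simp flip: add_divide_distrib)
      also have "\<dots> \<le> 1 / a"
        using a by (intro mult_imp_le_div_pos) (simp_all add: power2_eq_square algebra_simps add_pos_pos divide_le_eq_1)
      finally show "1 / (a + 1)\<^sup>2 + 1 / (a + 1) \<le> 1 / a" .
    qed
    finally show ?thesis by (simp add: a_def power_divide)
  qed
qed

section \<open>Local functions on a quasi-transitive graph\<close>

text \<open>Infinitely many vertices and connectedness exclude isolated vertices, so degrees are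
  positive. The finite case of the theorem is settled directly, as finite graphs have no infinite
  clusters.\<close>

locale perc_graph =
  fixes adj :: "'v \<Rightarrow> 'v \<Rightarrow> bool"
  assumes sym_graph: "sym_graph adj"
    and connected: "connected_graph adj"
    and locally_finite: "locally_finite adj"
    and quasi_transitive: "quasi_transitive adj"
    and unimodular: "unimodular adj"
    and infinite_UNIV: "infinite (UNIV :: 'v set)"
begin

abbreviation "E \<equiv> graph_edges adj"

lemma adj_sym: "adj u w \<longleftrightarrow> adj w u" and adj_irrefl [simp]: "\<not> adj u u"
  using sym_graph by (auto simp: sym_graph_def)

lemma finite_nbrs [simp]: "finite (nbrs adj v)"
  using locally_finite by (simp add: locally_finite_def)

lemma mem_nbrs [simp]: "w \<in> nbrs adj v \<longleftrightarrow> adj v w"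
  by (simp add: nbrs_def)

lemma edge_iff [simp]: "{u, w} \<in> E \<longleftrightarrow> adj u w"
  using adj_sym by (auto simp: graph_edges_def doubleton_eq_iff)

lemma edgeE:
  assumes "e \<in> E"
  obtains u w where "e = {u, w}" "adj u w"
  using assms by (auto simp: graph_edges_def)

section \<open>Balls, and the edges that determine a small cluster\<close>

definition ball :: "nat \<Rightarrow> 'v \<Rightarrow> 'v set" where
  "ball n v = {w. \<exists>k\<le>n. (adj ^^ k) v w}"

lemma self_in_ball [simp]: "v \<in> ball n v"
  unfolding ball_def using relpowp_0_I[of adj v] by blast

lemma ball_mono: "m \<le> n \<Longrightarrow> ball m v \<subseteq> ball n v"
  unfolding ball_def by (auto intro: order.trans)

lemma ball_step:
  assumes "w \<in> ball n v" "adj w x" shows "x \<in> ball (Suc n) v"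
proof -
  obtain k where "k \<le> n" "(adj ^^ k) v w" using assms(1) unfolding ball_def by blast
  then have "Suc k \<le> Suc n" "(adj ^^ Suc k) v x" using assms(2) by (auto simp del: relpowp.simps intro: relpowp_Suc_I)
  then show ?thesis unfolding ball_def by blast
qed

lemma ball_0 [simp]: "ball 0 v = {v}"
  by (auto simp: ball_def)

lemma ball_Suc_subset: "ball (Suc n) v \<subseteq> ball n v \<union> (\<Union>w\<in>ball n v. nbrs adj w)"
proof
  fix x assume "x \<in> ball (Suc n) v"
  then obtain k where k: "k \<le> Suc n" "(adj ^^ k) v x" by (auto simp: ball_def)
  show "x \<in> ball n v \<union> (\<Union>w\<in>ball n v. nbrs adj w)"
  proof (cases "k \<le> n")
    case True
    then show ?thesis using k by (auto simp: ball_def)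
  next
    case False
    then have "k = Suc n" using k by simp
    then obtain w where "(adj ^^ n) v w" "adj w x" using k by (auto elim: relpowp_Suc_E)
    then show ?thesis by (auto simp: ball_def)
  qed
qed

lemma finite_ball [simp]: "finite (ball n v)"
proof (induction n)
  case (Suc n)
  then have "finite (ball n v \<union> (\<Union>w\<in>ball n v. nbrs adj w))" by simp
  then show ?case by (rule finite_subset[OF ball_Suc_subset])
qed simp

lemma relpowp_adj_sym: "(adj ^^ k) v w \<Longrightarrow> (adj ^^ k) w v"
proof (induction k arbitrary: w)
  case (Suc k)
  then obtain x where "(adj ^^ k) v x" "adj x w" by (auto elim: relpowp_Suc_E)
  then show ?case using Suc.IH adj_sym relpowp_Suc_I2 by metis
qed simp

lemma ball_sym: "w \<in> ball n v \<longleftrightarrow> v \<in> ball n w"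
  unfolding ball_def using relpowp_adj_sym by blast

lemma in_some_ball: "\<exists>n. w \<in> ball n v"
proof -
  have "adj\<^sup>*\<^sup>* v w" using connected by (simp add: connected_graph_def)
  then obtain k where "(adj ^^ k) v w" by (auto dest: rtranclp_imp_relpowp)
  then show ?thesis by (auto simp: ball_def)
qed

definition bedges :: "nat \<Rightarrow> 'v \<Rightarrow> 'v set set" where
  "bedges n v = touching E (ball n v)"

lemma bedges_subset: "bedges n v \<subseteq> E"
  by (auto simp: bedges_def touching_def)

lemma touching_subset: "touching E C \<subseteq> (\<lambda>(x, y). {x, y}) ` (SIGMA x:C. nbrs adj x)"
proof
  fix e assume "e \<in> touching E C"
  then obtain x where x: "x \<in> e" "x \<in> C" "e \<in> E" by (auto simp: touching_def)
  then obtain y where "e = {x, y}" "adj x y"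
    using adj_sym by (auto elim!: edgeE simp: insert_commute)
  then show "e \<in> (\<lambda>(x, y). {x, y}) ` (SIGMA x:C. nbrs adj x)" using x by force
qed

lemma finite_touching_E: "finite C \<Longrightarrow> finite (touching E C)"
  by (rule finite_subset[OF touching_subset]) auto

lemma finite_bedges [simp]: "finite (bedges n v)"
  unfolding bedges_def by (intro finite_touching_E finite_ball)

lemma bedges_mono: "m \<le> n \<Longrightarrow> bedges m v \<subseteq> bedges n v"
  using ball_mono[of m n v] by (auto simp: bedges_def touching_def)

text \<open>A cluster that is not contained in \<open>ball k v\<close> gains a new vertex with each
  radius up to \<open>k\<close>, hence has at least \<open>k + 1\<close> vertices in that
  ball.\<close>

lemma cl_subset_ball:
  assumes S: "finite S" "S \<subseteq> E" and card: "card (cl S v) \<le> N"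
  shows "cl S v \<subseteq> ball N v"
proof -
  have "cl S v \<subseteq> ball k v \<or> Suc k \<le> card (cl S v \<inter> ball k v)" for k
  proof (induction k)
    case 0
    have "cl S v \<inter> {v} = {v}" by auto
    then show ?case by simp
  next
    case (Suc k)
    show ?case
    proof (cases "cl S v \<subseteq> ball k v")
      case True
      then show ?thesis using ball_mono[of k "Suc k" v] by auto
    next
      case False
      have "\<exists>x y. x \<in> cl S v \<inter> ball k v \<and> {x, y} \<in> S \<and> y \<notin> cl S v \<inter> ball k v"
      proof (rule ccontr)
        assume "\<not> ?thesis"
        then have "cl S v \<subseteq> cl S v \<inter> ball k v" by (intro cl_subset) auto
        then show False using False by blast
      qed
      then obtain x y where xy: "x \<in> cl S v" "x \<in> ball k v" "{x, y} \<in> S" "y \<notin> cl S v \<inter> ball k v"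
        by blast
      have "y \<in> cl S v" using xy cl_step by metis
      moreover have "y \<in> ball (Suc k) v" using xy S edge_iff ball_step by blast
      ultimately have "insert y (cl S v \<inter> ball k v) \<subseteq> cl S v \<inter> ball (Suc k) v"
        using ball_mono[of k "Suc k" v] by auto
      then have "card (insert y (cl S v \<inter> ball k v)) \<le> card (cl S v \<inter> ball (Suc k) v)"
        using S by (intro card_mono) auto
      then show ?thesis using Suc False xy(4) S by simp
    qed
  qed
  moreover have "card (cl S v \<inter> ball N v) \<le> card (cl S v)" using S by (intro card_mono) auto
  ultimately show ?thesis using card by (metis le_trans not_less_eq_eq)
qed

text \<open>If the cluster computed from \<open>B\<close> has at most \<open>N\<close> vertices,
  then it stays in \<open>ball N v\<close>, and every edge of \<open>S\<close> touching it already
  lies in \<open>B\<close>. So the remaining edges cannot enlarge it.\<close>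

lemma cl_local:
  assumes S: "finite S" "S \<subseteq> E" and B: "bedges N v \<subseteq> B"
  shows "card (cl (S \<inter> B) v) \<le> N \<longleftrightarrow> card (cl S v) \<le> N"
    and "card (cl S v) \<le> N \<Longrightarrow> cl (S \<inter> B) v = cl S v"
proof -
  have *: "cl (S \<inter> B) v = cl S v" if "card (cl (S \<inter> B) v) \<le> N"
  proof
    have sub: "cl (S \<inter> B) v \<subseteq> ball N v"
      by (rule cl_subset_ball) (use S that in auto)
    show "cl S v \<subseteq> cl (S \<inter> B) v"
    proof (rule cl_subset)
      fix x y assume x: "x \<in> cl (S \<inter> B) v" "{x, y} \<in> S"
      then have "{x, y} \<in> B" using sub B S by (auto simp: bedges_def touching_def)
      then show "y \<in> cl (S \<inter> B) v" using x cl_step[of x "S \<inter> B" v y] by simp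
    qed simp
  qed (intro cl_mono, auto)
  have "card (cl (S \<inter> B) v) \<le> card (cl S v)"
    using S by (intro card_mono cl_mono) auto
  then show "card (cl (S \<inter> B) v) \<le> N \<longleftrightarrow> card (cl S v) \<le> N"
    using * by (metis order.trans)
  then show "card (cl S v) \<le> N \<Longrightarrow> cl (S \<inter> B) v = cl S v" using * by blast
qed

text \<open>Only finite configurations are tested. In an infinite one a cluster may be infinite, and
  then its \<open>card\<close> is 0 and would pass for small.\<close>

definition supp :: "'v set set \<Rightarrow> ('v set set \<Rightarrow> 'b) \<Rightarrow> bool" where
  "supp F f \<longleftrightarrow> finite F \<and> F \<subseteq> E \<and> (\<forall>S. finite S \<longrightarrow> S \<subseteq> E \<longrightarrow> f S = f (S \<inter> F))"

text \<open>For a local function \<open>f\<close> the value does not depend on the supporting set, see \<open>EE_eq\<close>; otherwise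
  it is meaningless.\<close>
definition EE :: "real \<Rightarrow> ('v set set \<Rightarrow> real) \<Rightarrow> real" where
  "EE p f = bexp p (SOME F. supp F f) f"

lemma suppD: "supp F f \<Longrightarrow> finite S \<Longrightarrow> S \<subseteq> E \<Longrightarrow> f (S \<inter> F) = f S"
  by (simp add: supp_def)

lemma supp_finite: "supp F f \<Longrightarrow> finite F" and supp_subset: "supp F f \<Longrightarrow> F \<subseteq> E"
  by (simp_all add: supp_def)

lemma supp_mono:
  assumes "supp F f" "F \<subseteq> G" "finite G" "G \<subseteq> E"
  shows "supp G f"
proof -
  have "f S = f (S \<inter> G)" if "finite S" "S \<subseteq> E" for S
  proof -
    have "f (S \<inter> G) = f (S \<inter> G \<inter> F)" using suppD[OF assms(1), of "S \<inter> G"] that by (simp add: le_infI1)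
    also have "S \<inter> G \<inter> F = S \<inter> F" using assms(2) by auto
    also have "f \<dots> = f S" using suppD[OF assms(1)] that by auto
    finally show ?thesis by simp
  qed
  then show ?thesis using assms by (simp add: supp_def)
qed

lemma bexp_supp:
  assumes "supp F f" "F \<subseteq> G" "finite G" "G \<subseteq> E"
  shows "bexp p G f = bexp p F f"
proof (rule bexp_restrict)
  fix S assume "S \<subseteq> G"
  then have "finite S" "S \<subseteq> E" using assms finite_subset by blast+
  then show "f S = f (S \<inter> F)" using suppD[OF assms(1)] by simp
qed (use assms in auto)

lemma EE_eq:
  assumes "supp F f" shows "EE p f = bexp p F f"
proof -
  define G where "G = (SOME F. supp F f)"
  have G: "supp G f" unfolding G_def using assms by (rule someI)
  have "bexp p G f = bexp p (F \<union> G) f"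
    by (rule bexp_supp[symmetric]) (use G assms in \<open>auto simp: supp_def\<close>)
  also have "\<dots> = bexp p F f"
    by (rule bexp_supp) (use G assms in \<open>auto simp: supp_def\<close>)
  finally show ?thesis by (simp add: EE_def G_def)
qed

lemma supp_cluster:
  assumes "finite B" "B \<subseteq> E" "bedges N v \<subseteq> B"
    and "\<And>S. finite S \<Longrightarrow> S \<subseteq> E \<Longrightarrow> card (cl S v) \<le> N \<Longrightarrow> cl (S \<inter> B) v = cl S v \<Longrightarrow> g (S \<inter> B) = g S"
  shows "supp B (\<lambda>S. if card (cl S v) \<le> N then g S else c)"
  unfolding supp_def using assms cl_local[of _ N v B] by auto

section \<open>Automorphisms, orbits and orbit representatives\<close>

lemma graph_aut_comp: "graph_aut adj f \<Longrightarrow> graph_aut adj g \<Longrightarrow> graph_aut adj (f \<circ> g)"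
  unfolding graph_aut_def by (auto intro: bij_comp)

lemma graph_aut_id: "graph_aut adj id"
  by (simp add: graph_aut_def)

lemma graph_aut_bij: "graph_aut adj f \<Longrightarrow> bij f"
  by (simp add: graph_aut_def)

lemma graph_aut_inv: "graph_aut adj f \<Longrightarrow> graph_aut adj (inv f)"
  unfolding graph_aut_def by (metis bij_imp_bij_inv bij_inv_eq_iff)

lemma graph_aut_inv_app [simp]:
  assumes "graph_aut adj f" shows "inv f (f x) = x" "f (inv f x) = x"
  using graph_aut_bij[OF assms] by (auto simp: bij_is_inj bij_is_surj surj_f_inv_f)

lemma graph_aut_adj: "graph_aut adj f \<Longrightarrow> adj (f u) (f w) \<longleftrightarrow> adj u w"
  by (simp add: graph_aut_def)

lemma relpowp_aut: "graph_aut adj f \<Longrightarrow> (adj ^^ k) v w \<Longrightarrow> (adj ^^ k) (f v) (f w)"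
proof (induction k arbitrary: w)
  case (Suc k)
  then obtain x where "(adj ^^ k) v x" "adj x w" by (auto elim: relpowp_Suc_E)
  then show ?case using Suc graph_aut_adj[of f x w] by auto
qed simp

lemma ball_aut:
  assumes "graph_aut adj f" shows "f w \<in> ball n (f v) \<longleftrightarrow> w \<in> ball n v"
proof -
  have sub: "g y \<in> ball n (g x)" if "graph_aut adj g" "y \<in> ball n x" for g x y
    using that relpowp_aut[of g _ x y] unfolding ball_def by blast
  show ?thesis
    using sub[OF assms, of w v] sub[OF graph_aut_inv[OF assms], of "f w" "f v"] assms by auto
qed

lemma image_edges_aut:
  assumes "graph_aut adj f" shows "(`) f ` E = E"
proof -
  have sub: "(`) g ` E \<subseteq> E" if "graph_aut adj g" for g
    using graph_aut_adj[OF that] by (auto elim!: edgeE)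
  have "(`) f ` ((`) (inv f) ` E) = E"
    using assms by (simp add: image_image)
  then have "E \<subseteq> (`) f ` E"
    using image_mono[OF sub[OF graph_aut_inv[OF assms]], of "(`) f"] by simp
  then show ?thesis using sub[OF assms] by simp
qed

lemma cl_aut:
  fixes f :: "'v \<Rightarrow> 'v"
  assumes "bij f" shows "cl ((`) f ` S) (f v) = f ` cl S v"
proof
  have inj: "inj f" using assms by (rule bij_is_inj)
  have *: "f ` cl S v \<subseteq> cl ((`) f ` S) (f v)" for f :: "'v \<Rightarrow> 'v" and S :: "'v set set" and v
  proof
    fix y assume "y \<in> f ` cl S v"
    then obtain w where w: "w \<in> cl S v" "y = f w" by auto
    from w(1) have "f w \<in> cl ((`) f ` S) (f v)"
    proof (induction rule: cl_induct)
      case (step a b)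
      have "{f a, f b} = f ` {a, b}" by simp
      then have "{f a, f b} \<in> (`) f ` S" using step by blast
      then show ?case using step cl_step by metis
    qed simp
    then show "y \<in> cl ((`) f ` S) (f v)" using w by simp
  qed
  show "f ` cl S v \<subseteq> cl ((`) f ` S) (f v)" by (rule *)
  have "inv f ` cl ((`) f ` S) (f v) \<subseteq> cl ((`) (inv f) ` (`) f ` S) (inv f (f v))" by (rule *)
  also have "\<dots> = cl S v" using inj by (simp add: image_image)
  finally have "f ` inv f ` cl ((`) f ` S) (f v) \<subseteq> f ` cl S v" by blast
  then show "cl ((`) f ` S) (f v) \<subseteq> f ` cl S v"
    using assms by (simp add: image_f_inv_f bij_is_surj)
qed

text \<open>Invariance of percolation under automorphisms. The transported function is a separate
  \<open>h\<close> because in applications it is the same functional with its vertices moved by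
  \<open>f\<close>.\<close>

lemma EE_aut:
  assumes f: "graph_aut adj f" and g: "supp F g"
    and h: "\<And>S. finite S \<Longrightarrow> S \<subseteq> E \<Longrightarrow> h ((`) f ` S) = g S"
  shows "EE p h = EE p g"
proof -
  have inj: "inj ((`) f)"
    using graph_aut_bij[OF f] by (auto intro!: injI simp: bij_is_inj inj_image_eq_iff)
  have "supp ((`) f ` F) h"
    unfolding supp_def
  proof (intro conjI allI impI)
    show "finite ((`) f ` F)" using supp_finite[OF g] by simp
    show "(`) f ` F \<subseteq> E" using supp_subset[OF g] image_edges_aut[OF f] by blast
    fix T assume T: "finite T" "T \<subseteq> E"
    define S where "S = (`) (inv f) ` T"
    have S: "finite S" "S \<subseteq> E"
      using T image_edges_aut[OF graph_aut_inv[OF f]] by (auto simp: S_def)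
    have TS: "T = (`) f ` S"
      using f by (simp add: S_def image_image)
    have "h T = g S" using TS h S by simp
    also have "\<dots> = g (S \<inter> F)" using suppD[OF g] S by simp
    also have "\<dots> = h ((`) f ` (S \<inter> F))" using h[of "S \<inter> F"] S by (simp add: le_infI1)
    also have "(`) f ` (S \<inter> F) = T \<inter> (`) f ` F" using TS inj by (simp add: image_Int)
    finally show "h T = h (T \<inter> (`) f ` F)" .
  qed
  then have "EE p h = bexp p F (\<lambda>S. h ((`) f ` S))"
    using bexp_image[OF inj_on_subset[OF inj subset_UNIV]] by (simp add: EE_eq)
  also have "\<dots> = bexp p F g"
    by (rule bexp_cong, rule h) (use supp_subset[OF g] finite_subset[OF _ supp_finite[OF g]] in auto)
  finally show ?thesis using EE_eq[OF g] by simp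
qed

lemma orbit_self [simp]: "v \<in> aut_orbit adj v"
  unfolding aut_orbit_def using graph_aut_id by (force intro: exI[of _ id])

lemma orbit_eq:
  assumes "w \<in> aut_orbit adj v" shows "aut_orbit adj w = aut_orbit adj v"
proof -
  have sub: "aut_orbit adj w \<subseteq> aut_orbit adj v" if w: "w \<in> aut_orbit adj v" for v w
  proof
    fix x assume "x \<in> aut_orbit adj w"
    then obtain f where f: "graph_aut adj f" "x = f w" by (auto simp: aut_orbit_def)
    obtain g where "graph_aut adj g" "w = g v" using w by (auto simp: aut_orbit_def)
    then have "graph_aut adj (f \<circ> g)" "x = (f \<circ> g) v" using f graph_aut_comp by auto
    then show "x \<in> aut_orbit adj v" unfolding aut_orbit_def by blast
  qed
  obtain g where g: "graph_aut adj g" "w = g v" using assms by (auto simp: aut_orbit_def)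
  then have "v = inv g w" "graph_aut adj (inv g)" using graph_aut_inv by auto
  then have "v \<in> aut_orbit adj w" unfolding aut_orbit_def by blast
  then show ?thesis using sub assms by blast
qed

text \<open>The choice depends only on the orbit as a set, so each orbit has exactly one
  representative.\<close>

definition reps :: "'v set" where
  "reps = (\<lambda>A. SOME v. v \<in> A) ` range (aut_orbit adj)"

lemma finite_reps: "finite reps"
  using quasi_transitive by (simp add: reps_def quasi_transitive_def)

lemma reps_ex: "\<exists>u\<in>reps. v \<in> aut_orbit adj u"
proof -
  define u where "u = (SOME u. u \<in> aut_orbit adj v)"
  have "u \<in> aut_orbit adj v" unfolding u_def by (rule someI[of _ v]) simp
  then have "aut_orbit adj u = aut_orbit adj v" by (rule orbit_eq)
  then have "v \<in> aut_orbit adj u" by simp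
  moreover have "u \<in> reps" by (auto simp: reps_def u_def)
  ultimately show ?thesis by blast
qed

lemma reps_unique:
  assumes "u \<in> reps" "w \<in> reps" "v \<in> aut_orbit adj u" "v \<in> aut_orbit adj w"
  shows "u = w"
proof -
  have eq: "aut_orbit adj u = aut_orbit adj w" using orbit_eq assms(3,4) by metis
  have "u = (SOME x. x \<in> aut_orbit adj u)" if u: "u \<in> reps" for u
  proof -
    obtain y where y: "u = (SOME x. x \<in> aut_orbit adj y)" using u by (auto simp: reps_def)
    have "u \<in> aut_orbit adj y" unfolding y by (rule someI[of _ y]) simp
    then show ?thesis using y orbit_eq by metis
  qed
  then show ?thesis using assms eq by metis
qed

lemma reps_nonempty: "reps \<noteq> {}"
  using reps_ex by blast

section \<open>The mass-transport principle\<close>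

lemma stabD: "f \<in> stab adj u \<Longrightarrow> graph_aut adj f" "f \<in> stab adj u \<Longrightarrow> f u = u"
  by (simp_all add: stab_def)

lemma stab_comp: "f \<in> stab adj u \<Longrightarrow> g \<in> stab adj u \<Longrightarrow> f \<circ> g \<in> stab adj u"
  by (auto simp: stab_def graph_aut_comp)

lemma stab_inv: "f \<in> stab adj u \<Longrightarrow> inv f \<in> stab adj u"
  using graph_aut_inv_app(1)[of f u] by (auto simp: stab_def graph_aut_inv)

lemma id_stab: "id \<in> stab adj u"
  by (simp add: stab_def graph_aut_id)

lemma finite_stab_image: "finite ((\<lambda>f. f v) ` stab adj u)"
proof -
  obtain n where n: "v \<in> ball n u" using in_some_ball by blast
  have "(\<lambda>f. f v) ` stab adj u \<subseteq> ball n u"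
  proof
    fix x assume "x \<in> (\<lambda>f. f v) ` stab adj u"
    then obtain f where "graph_aut adj f" "f u = u" "x = f v" by (auto simp: stab_def)
    then show "x \<in> ball n u" using ball_aut[of f v n u] n by simp
  qed
  then show ?thesis using finite_ball finite_subset by blast
qed

lemma finite_stab_orbit: "finite (stab_orbit adj u v)"
  unfolding stab_orbit_def by (rule finite_stab_image)

text \<open>By the orbit-stabilizer theorem this is the index of
  \<open>stab u \<inter> stab v\<close> in \<open>stab u\<close>. Likewise \<open>cs2 u v w\<close>
  is the index of the triple stabilizer in \<open>stab u \<inter> stab v\<close>.\<close>

definition cs :: "'v \<Rightarrow> 'v \<Rightarrow> nat" where
  "cs u v = card (stab_orbit adj u v)"

definition cs2 :: "'v \<Rightarrow> 'v \<Rightarrow> 'v \<Rightarrow> nat" where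
  "cs2 u v w = card ((\<lambda>f. f w) ` (stab adj u \<inter> stab adj v))"

lemma cs_pos: "cs u v > 0"
  unfolding cs_def using finite_stab_orbit id_stab by (force simp: card_gt_0_iff stab_orbit_def)

lemma finite_stab2: "finite ((\<lambda>f. f w) ` (stab adj u \<inter> stab adj v))"
  by (rule finite_subset[OF _ finite_stab_image[of w u]]) auto

lemma cs2_pos: "cs2 u v w > 0"
  unfolding cs2_def using finite_stab2 id_stab by (force simp: card_gt_0_iff)

text \<open>Multiplicativity of indices: the images of \<open>w\<close> that go with a fixed image
  of \<open>v\<close> form a translate of the orbit of \<open>w\<close> under
  \<open>stab u \<inter> stab v\<close>.\<close>

lemma card_stab_pairs: "card ((\<lambda>f. (f v, f w)) ` stab adj u) = cs u v * cs2 u v w"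
proof -
  let ?fib = "\<lambda>v'. {f w | f. f \<in> stab adj u \<and> f v = v'}"
  have eq: "(\<lambda>f. (f v, f w)) ` stab adj u = Sigma (stab_orbit adj u v) ?fib"
  proof (intro set_eqI iffI)
    fix z assume "z \<in> Sigma (stab_orbit adj u v) ?fib"
    then obtain g where "g \<in> stab adj u" "z = (g v, g w)" by auto
    then show "z \<in> (\<lambda>f. (f v, f w)) ` stab adj u" by blast
  qed (auto simp: stab_orbit_def)
  have card: "card (?fib v') = cs2 u v w" if v': "v' \<in> stab_orbit adj u v" for v'
  proof -
    obtain f where f: "f \<in> stab adj u" "f v = v'" using v' by (auto simp: stab_orbit_def)
    have "?fib v' = f ` (\<lambda>h. h w) ` (stab adj u \<inter> stab adj v)"
    proof (intro set_eqI iffI)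
      fix x assume "x \<in> ?fib v'"
      then obtain g where g: "g \<in> stab adj u" "g v = v'" "x = g w" by auto
      have "inv f \<circ> g \<in> stab adj u" using f g stab_inv stab_comp by blast
      moreover have "(inv f \<circ> g) v = v" using f g stabD by auto
      ultimately have "inv f \<circ> g \<in> stab adj u \<inter> stab adj v" by (auto simp: stab_def)
      moreover have "x = f ((inv f \<circ> g) w)" using g f stabD by simp
      ultimately show "x \<in> f ` (\<lambda>h. h w) ` (stab adj u \<inter> stab adj v)" by blast
    next
      fix x assume "x \<in> f ` (\<lambda>h. h w) ` (stab adj u \<inter> stab adj v)"
      then obtain h where h: "h \<in> stab adj u" "h \<in> stab adj v" "x = (f \<circ> h) w" by auto
      then have "f \<circ> h \<in> stab adj u" "(f \<circ> h) v = v'" using f stab_comp stabD(2)[OF h(2)] by auto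
      then show "x \<in> ?fib v'" using h(3) by blast
    qed
    moreover have "inj f" using f stabD graph_aut_bij bij_is_inj by blast
    ultimately show ?thesis by (simp add: cs2_def card_image inj_on_subset)
  qed
  have fin: "finite (?fib v')" for v'
    by (rule finite_subset[OF _ finite_stab_image[of w u]]) auto
  show ?thesis
    unfolding eq using fin card finite_stab_orbit by (simp add: cs_def)
qed

lemma cs_swap: "cs u v * cs2 u v w = cs u w * cs2 u w v"
proof -
  have "(\<lambda>f. (f w, f v)) ` stab adj u = prod.swap ` ((\<lambda>f. (f v, f w)) ` stab adj u)"
    by (auto simp: image_image)
  then have "card ((\<lambda>f. (f w, f v)) ` stab adj u) = card ((\<lambda>f. (f v, f w)) ` stab adj u)"
    by (simp add: card_image)
  then show ?thesis by (simp add: card_stab_pairs)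
qed

text \<open>The index of the triple stabilizer in each single stabilizer can be computed in two
  orders. Multiplying the three resulting identities cancels all \<open>cs2\<close> factors.\<close>

lemma cs_cocycle: "cs u v * cs v w * cs w u = cs v u * cs w v * cs u w"
proof -
  have s: "cs2 u v w = cs2 v u w" for u v w by (simp add: cs2_def Int_commute)
  define a b c where abc: "a = cs2 u v w" "b = cs2 v w u" "c = cs2 u w v"
  have pos: "a * b * c > 0" using cs2_pos by (simp add: abc)
  have "cs u v * a = cs u w * c" "cs v w * b = cs v u * a" "cs w u * c = cs w v * b"
    using cs_swap[of u v w] cs_swap[of v w u] cs_swap[of w u v] by (simp_all add: abc s[of w u] s[of v u] s[of w v])
  then have "(cs u v * a) * (cs v w * b) * (cs w u * c) = (cs u w * c) * (cs v u * a) * (cs w v * b)"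
    by simp
  then have "(cs u v * cs v w * cs w u) * (a * b * c) = (cs v u * cs w v * cs u w) * (a * b * c)"
    by (simp add: mult_ac)
  then show ?thesis using pos by simp
qed

text \<open>Up to a factor, \<open>mu v\<close> is the inverse of the Haar measure of the stabilizer of \<open>v\<close>; \<open>undefined\<close> is an
  arbitrary root.\<close>
definition mu :: "'v \<Rightarrow> real" where
  "mu v = real (cs undefined v) / real (cs v undefined)"

lemma mu_pos: "mu v > 0"
  using cs_pos by (simp add: mu_def)

text \<open>The cocycle is a coboundary: applying \<open>cs_cocycle\<close> to \<open>u\<close>,
  \<open>y\<close> and the root shows that \<open>cs u y / cs y u\<close> is
  \<open>mu y / mu u\<close>.\<close>

lemma cs_mu: "real (cs u y) * mu u = real (cs y u) * mu y"
proof -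
  have "real (cs u y) * real (cs y undefined) * real (cs undefined u)
      = real (cs y u) * real (cs undefined y) * real (cs u undefined)"
    using cs_cocycle[of u y undefined] by (metis of_nat_mult)
  then show ?thesis
    using cs_pos[of y undefined] cs_pos[of u undefined] by (simp add: mu_def field_simps)
qed

text \<open>This is where unimodularity enters.\<close>

lemma mu_orbit:
  assumes "v \<in> aut_orbit adj u" shows "mu v = mu u"
proof -
  have "cs u v = cs v u" using unimodular assms unfolding unimodular_def cs_def by blast
  then show ?thesis using cs_mu[of u v] cs_pos[of u v] by simp
qed

lemma cs_aut:
  assumes "graph_aut adj g" shows "cs (g x) (g v) = cs x v"
proof -
  have sub: "g ` stab_orbit adj x v \<subseteq> stab_orbit adj (g x) (g v)" if g: "graph_aut adj g" for g x v
  proof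
    fix y assume "y \<in> g ` stab_orbit adj x v"
    then obtain f where f: "f \<in> stab adj x" "y = g (f v)" by (auto simp: stab_orbit_def)
    then have "g \<circ> f \<circ> inv g \<in> stab adj (g x)" "y = (g \<circ> f \<circ> inv g) (g v)"
      using g by (auto simp: stab_def intro!: graph_aut_comp graph_aut_inv)
    then show "y \<in> stab_orbit adj (g x) (g v)" unfolding stab_orbit_def by blast
  qed
  have le: "cs x v \<le> cs (g x) (g v)" if g: "graph_aut adj g" for g x v
  proof -
    have "cs x v = card (g ` stab_orbit adj x v)"
      unfolding cs_def using graph_aut_bij[OF g] by (intro card_image[symmetric]) (auto intro: bij_is_inj inj_on_subset)
    also have "\<dots> \<le> cs (g x) (g v)"
      unfolding cs_def using sub[OF g] finite_stab_orbit by (intro card_mono)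
    finally show ?thesis .
  qed
  show ?thesis
    using le[OF assms, of x v] le[OF graph_aut_inv[OF assms], of "g x" "g v"] assms by simp
qed

text \<open>Double counting with the relation that some automorphism carries the pair
  \<open>(x, v)\<close> to \<open>(u, y)\<close>; related pairs carry equal mass. A vertex
  \<open>v\<close> has \<open>cs y u\<close> partners, for any partner \<open>u\<close>, and
  \<open>u\<close> has \<open>cs u y\<close> partners. By \<open>cs_mu\<close> and
  \<open>mu_orbit\<close> the quotient of these counts is the constant \<open>mu y / mu x\<close>.
  Balls are preserved, so the cut-off at \<open>R\<close> is compatible on both sides.\<close>

lemma mass_transport_orbits:
  fixes f :: "'v \<Rightarrow> 'v \<Rightarrow> real"
  assumes inv: "\<And>g u v. graph_aut adj g \<Longrightarrow> f (g u) (g v) = f u v"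
  shows "mu x * (\<Sum>v\<in>aut_orbit adj y \<inter> ball R x. f x v)
       = mu y * (\<Sum>u\<in>aut_orbit adj x \<inter> ball R y. f u y)"
proof -
  let ?A = "aut_orbit adj y \<inter> ball R x" and ?B = "aut_orbit adj x \<inter> ball R y"
  define rel where "rel u v \<longleftrightarrow> (\<exists>g. graph_aut adj g \<and> g x = u \<and> g v = y)" for u v
  have cardB: "card {u\<in>?B. rel u v} = cs y u0" if v: "v \<in> ?A" and r: "rel u0 v" for v u0
  proof -
    obtain g where g: "graph_aut adj g" "g x = u0" "g v = y" using r by (auto simp: rel_def)
    have "{u\<in>?B. rel u v} = stab_orbit adj y u0"
    proof (intro set_eqI iffI)
      fix u assume "u \<in> {u\<in>?B. rel u v}"
      then obtain h where h: "graph_aut adj h" "h x = u" "h v = y" by (auto simp: rel_def)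
      have "h \<circ> inv g \<in> stab adj y" "(h \<circ> inv g) u0 = u"
        using g h graph_aut_inv_app(1)[OF g(1), of x] graph_aut_inv_app(1)[OF g(1), of v]
        by (auto simp: stab_def intro!: graph_aut_comp graph_aut_inv)
      then show "u \<in> stab_orbit adj y u0" unfolding stab_orbit_def by blast
    next
      fix u assume "u \<in> stab_orbit adj y u0"
      then obtain h where h: "graph_aut adj h" "h y = y" "h u0 = u" by (auto simp: stab_orbit_def stab_def)
      let ?k = "h \<circ> g"
      have k: "graph_aut adj ?k" "?k x = u" "?k v = y" using g h graph_aut_comp by auto
      then have "rel u v" "u \<in> aut_orbit adj x" unfolding rel_def aut_orbit_def by blast+
      moreover have "u \<in> ball R y"
        using ball_aut[OF k(1), of v R x] k v ball_sym by auto
      ultimately show "u \<in> {u\<in>?B. rel u v}" by simp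
    qed
    then show ?thesis by (simp add: cs_def)
  qed
  have cardA: "card {v\<in>?A. rel u v} = cs u y" if u: "u \<in> ?B" for u
  proof -
    obtain g where g: "graph_aut adj g" "u = g x" using u by (auto simp: aut_orbit_def)
    define v0 where "v0 = inv g y"
    have v0: "g v0 = y" using g by (simp add: v0_def)
    have "{v\<in>?A. rel u v} = stab_orbit adj x v0"
    proof (intro set_eqI iffI)
      fix v assume "v \<in> {v\<in>?A. rel u v}"
      then obtain h where h: "graph_aut adj h" "h x = u" "h v = y" by (auto simp: rel_def)
      have "inv h \<circ> g \<in> stab adj x" "(inv h \<circ> g) v0 = v"
        using g h v0 graph_aut_inv_app(1)[OF h(1), of x] graph_aut_inv_app(1)[OF h(1), of v]
        by (auto simp: stab_def intro!: graph_aut_comp graph_aut_inv)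
      then show "v \<in> stab_orbit adj x v0" unfolding stab_orbit_def by blast
    next
      fix v assume "v \<in> stab_orbit adj x v0"
      then obtain h where h: "graph_aut adj h" "h x = x" "h v0 = v" by (auto simp: stab_orbit_def stab_def)
      let ?k = "g \<circ> inv h"
      have k: "graph_aut adj ?k" "?k x = u" "?k v = y"
        using g h v0 graph_aut_inv_app(1)[OF h(1), of x] graph_aut_inv_app(1)[OF h(1), of v0]
        by (auto intro!: graph_aut_comp graph_aut_inv)
      have "inv ?k y = v" "graph_aut adj (inv ?k)"
        using graph_aut_inv_app(1)[OF k(1), of v] k graph_aut_inv by auto
      then have "rel u v" "v \<in> aut_orbit adj y"
        unfolding rel_def aut_orbit_def using k by blast+
      moreover have "v \<in> ball R x"
        using ball_aut[OF k(1), of v R x] k u ball_sym by auto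
      ultimately show "v \<in> {v\<in>?A. rel u v}" by simp
    qed
    then have "card {v\<in>?A. rel u v} = cs x v0" by (simp add: cs_def)
    also have "\<dots> = cs u y" using cs_aut[OF g(1), of x v0] g v0 by simp
    finally show ?thesis .
  qed
  have f_rel: "f x v = f u y" if "rel u v" for u v
    using that inv[of _ x v] by (auto simp: rel_def)
  have "(\<Sum>v\<in>?A. f x v) = (\<Sum>v\<in>?A. \<Sum>u\<in>{u\<in>?B. rel u v}. f x v / real (cs y u))"
  proof (rule sum.cong[OF refl])
    fix v assume v: "v \<in> ?A"
    then obtain g where g: "graph_aut adj g" "v = g y" by (auto simp: aut_orbit_def)
    have rel0: "rel (inv g x) v"
      unfolding rel_def using g graph_aut_inv by (intro exI[of _ "inv g"]) auto
    then have c: "card {u\<in>?B. rel u v} = cs y (inv g x)" using cardB v by simp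
    have "(\<Sum>u\<in>{u\<in>?B. rel u v}. f x v / real (cs y u)) = (\<Sum>u\<in>{u\<in>?B. rel u v}. f x v / real (cs y (inv g x)))"
    proof (rule sum.cong[OF refl])
      fix u assume "u \<in> {u\<in>?B. rel u v}"
      then have "cs y u = cs y (inv g x)" using cardB[OF v, of u] c by simp
      then show "f x v / real (cs y u) = f x v / real (cs y (inv g x))" by simp
    qed
    also have "\<dots> = f x v" using c cs_pos[of y "inv g x"] by simp
    finally show "f x v = (\<Sum>u\<in>{u\<in>?B. rel u v}. f x v / real (cs y u))" by simp
  qed
  also have "\<dots> = (\<Sum>u\<in>?B. \<Sum>v\<in>{v\<in>?A. rel u v}. f x v / real (cs y u))"
    by (rule sum.swap_restrict) auto
  also have "\<dots> = (\<Sum>u\<in>?B. \<Sum>v\<in>{v\<in>?A. rel u v}. f u y / real (cs y u))"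
    by (intro sum.cong refl) (simp add: f_rel)
  also have "\<dots> = (\<Sum>u\<in>?B. mu y / mu x * f u y)"
  proof (rule sum.cong[OF refl])
    fix u assume u: "u \<in> ?B"
    have "real (cs u y) / real (cs y u) = mu y / mu u"
      using cs_mu[of u y] cs_pos[of y u] mu_pos[of u] by (simp add: field_simps)
    moreover have "mu u = mu x" using u by (intro mu_orbit) auto
    ultimately have "real (cs u y) / real (cs y u) = mu y / mu x" by simp
    moreover have "(\<Sum>v\<in>{v\<in>?A. rel u v}. f u y / real (cs y u)) = real (cs u y) / real (cs y u) * f u y"
      unfolding sum_constant cardA[OF u] by simp
    ultimately show "(\<Sum>v\<in>{v\<in>?A. rel u v}. f u y / real (cs y u)) = mu y / mu x * f u y"
      by simp
  qed
  also have "\<dots> = mu y / mu x * (\<Sum>u\<in>?B. f u y)" by (simp add: sum_distrib_left)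
  finally show ?thesis using mu_pos[of x] by (simp add: field_simps)
qed

lemma sum_ball_orbits: "(\<Sum>v\<in>ball R x. h v) = (\<Sum>y\<in>reps. \<Sum>v\<in>aut_orbit adj y \<inter> ball R x. h v)"
proof -
  have "ball R x = (\<Union>y\<in>reps. aut_orbit adj y \<inter> ball R x)" using reps_ex by blast
  then have "(\<Sum>v\<in>ball R x. h v) = (\<Sum>v\<in>(\<Union>y\<in>reps. aut_orbit adj y \<inter> ball R x). h v)" by simp
  also have "\<dots> = (\<Sum>y\<in>reps. \<Sum>v\<in>aut_orbit adj y \<inter> ball R x. h v)"
    by (rule sum.UNION_disjoint) (use finite_reps reps_unique in auto)
  finally show ?thesis .
qed

lemma mass_transport:
  fixes f :: "'v \<Rightarrow> 'v \<Rightarrow> real"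
  assumes "\<And>g u v. graph_aut adj g \<Longrightarrow> f (g u) (g v) = f u v"
  shows "(\<Sum>x\<in>reps. mu x * (\<Sum>v\<in>ball R x. f x v)) = (\<Sum>x\<in>reps. mu x * (\<Sum>u\<in>ball R x. f u x))"
proof -
  have "(\<Sum>x\<in>reps. mu x * (\<Sum>v\<in>ball R x. f x v))
      = (\<Sum>x\<in>reps. \<Sum>y\<in>reps. mu x * (\<Sum>v\<in>aut_orbit adj y \<inter> ball R x. f x v))"
    by (simp add: sum_ball_orbits[of _ R] sum_distrib_left)
  also have "\<dots> = (\<Sum>x\<in>reps. \<Sum>y\<in>reps. mu y * (\<Sum>u\<in>aut_orbit adj x \<inter> ball R y. f u y))"
    using mass_transport_orbits[of f, OF assms] by simp
  also have "\<dots> = (\<Sum>y\<in>reps. \<Sum>x\<in>reps. mu y * (\<Sum>u\<in>aut_orbit adj x \<inter> ball R y. f u y))"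
    by (rule sum.swap)
  also have "\<dots> = (\<Sum>y\<in>reps. mu y * (\<Sum>u\<in>ball R y. f u y))"
    by (simp add: sum_ball_orbits[of _ R] sum_distrib_left)
  finally show ?thesis .
qed


lemma card_cl_pos: "finite S \<Longrightarrow> 0 < card (cl S v)"
  by (metis card_gt_0_iff cl_refl empty_iff finite_cl)

section \<open>The two-ghost inequality\<close>

abbreviation deg :: "'v \<Rightarrow> nat" where
  "deg v \<equiv> card (nbrs adj v)"

lemma deg_pos: "0 < deg v"
proof -
  obtain w where "w \<noteq> v" using infinite_UNIV by (metis ex_new_if_finite finite.emptyI finite.insertI insertI1)
  moreover have "adj\<^sup>*\<^sup>* v w" using connected by (simp add: connected_graph_def)
  ultimately obtain x where "adj v x" by (metis converse_rtranclpE)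
  then show ?thesis by (auto simp: card_gt_0_iff)
qed

lemma nbrs_aut: "graph_aut adj g \<Longrightarrow> nbrs adj (g v) = g ` nbrs adj v"
proof (intro set_eqI iffI)
  fix w assume g: "graph_aut adj g" and w: "w \<in> nbrs adj (g v)"
  then have "adj v (inv g w)" using graph_aut_adj[of "inv g" "g v" w] graph_aut_inv by simp
  then show "w \<in> g ` nbrs adj v" using g by (intro image_eqI[of _ _ "inv g w"]) auto
qed (auto simp: graph_aut_adj)

lemma inj_aut: "graph_aut adj g \<Longrightarrow> inj_on g A"
  using graph_aut_bij bij_is_inj inj_on_subset by blast

lemma deg_aut: "graph_aut adj g \<Longrightarrow> deg (g v) = deg v"
  by (simp add: nbrs_aut card_image inj_aut)

lemma repE:
  obtains x g where "x \<in> reps" "graph_aut adj g" "v = g x"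
  using reps_ex[of v] by (auto simp: aut_orbit_def)

definition maxdeg :: nat where
  "maxdeg = Max ((\<lambda>v. deg v) ` reps)"

lemma deg_le: "deg v \<le> maxdeg"
proof -
  obtain x g where x: "x \<in> reps" "graph_aut adj g" "v = g x" by (rule repE)
  then have "deg v = deg x" by (simp add: deg_aut)
  also have "\<dots> \<le> maxdeg" unfolding maxdeg_def using x finite_reps by (intro Max_ge) auto
  finally show ?thesis .
qed

lemma maxdeg_pos: "1 \<le> maxdeg"
  using deg_pos deg_le by (metis One_nat_def Suc_leI le_trans)

lemma card_touching_le:
  assumes "finite C" shows "card (touching E C) \<le> maxdeg * card C"
proof -
  have "card (touching E C) \<le> card (SIGMA x:C. nbrs adj x)"
    using assms by (intro surj_card_le[OF _ touching_subset]) auto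
  also have "\<dots> = (\<Sum>x\<in>C. deg x)" using assms by simp
  also have "\<dots> \<le> (\<Sum>x\<in>C. maxdeg)" by (intro sum_mono deg_le)
  finally show ?thesis by (simp add: mult.commute)
qed

text \<open>An edge inside \<open>C\<close> is met from both endpoints and an edge leaving
  \<open>C\<close> from one only, hence the factor 1/2.\<close>

lemma sum_touching:
  fixes g :: "'v set \<Rightarrow> real"
  assumes C: "finite C"
  shows "(\<Sum>v\<in>C. \<Sum>w\<in>nbrs adj v. g {v, w} * (if w \<in> C then 1/2 else 1)) = (\<Sum>e\<in>touching E C. g e)"
proof -
  let ?P = "SIGMA v:C. nbrs adj v"
  let ?h = "\<lambda>(v, w). g {v, w} * (if w \<in> C then 1/2 else 1)"
  have fin: "finite ?P" using C by auto
  have "(\<Sum>v\<in>C. \<Sum>w\<in>nbrs adj v. g {v, w} * (if w \<in> C then 1/2 else 1)) = sum ?h ?P"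
    using C by (subst sum.Sigma) auto
  also have "\<dots> = (\<Sum>e\<in>touching E C. sum ?h {z \<in> ?P. (\<lambda>(v, w). {v, w}) z = e})"
    by (rule sum.group[symmetric]) (use fin C finite_touching_E in \<open>auto simp: touching_def\<close>)
  also have "\<dots> = (\<Sum>e\<in>touching E C. g e)"
  proof (rule sum.cong[OF refl])
    fix e assume e: "e \<in> touching E C"
    then obtain x where x: "x \<in> e" "x \<in> C" "e \<in> E" by (auto simp: touching_def)
    then obtain y where y: "e = {x, y}" "adj x y"
      using adj_sym by (auto elim!: edgeE simp: insert_commute)
    have xy: "x \<noteq> y" "adj y x" using y adj_sym[of x y] by auto
    show "sum ?h {z \<in> ?P. (\<lambda>(v, w). {v, w}) z = e} = g e"
    proof (cases "y \<in> C")
      case True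
      have "{z \<in> ?P. (\<lambda>(v, w). {v, w}) z = e} = {(x, y), (y, x)}"
        using x y xy True by (auto simp: doubleton_eq_iff)
      then show ?thesis using x y xy True by (simp add: insert_commute)
    next
      case False
      have "{z \<in> ?P. (\<lambda>(v, w). {v, w}) z = e} = {(x, y)}"
        using x y xy False by (auto simp: doubleton_eq_iff)
      then show ?thesis using x y False by simp
    qed
  qed
  finally show ?thesis .
qed

lemma zeta_aut: "graph_aut adj g \<Longrightarrow> zeta p ((`) g ` S) {g v, g w} = zeta p S {v, w}"
proof -
  assume g: "graph_aut adj g"
  have "{g v, g w} = g ` {v, w}" by simp
  then have "{g v, g w} \<in> (`) g ` S \<longleftrightarrow> {v, w} \<in> S"
    using graph_aut_bij[OF g] bij_is_inj by (metis (no_types, lifting) image_iff inj_image_eq_iff)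
  then show ?thesis by (simp add: zeta_def)
qed

lemma mem_cl_aut:
  assumes g: "graph_aut adj g"
  shows "g w \<in> cl ((`) g ` S) (g v) \<longleftrightarrow> w \<in> cl S v"
    and "card (cl ((`) g ` S) (g v)) = card (cl S v)"
  using cl_aut[OF graph_aut_bij[OF g], of S v] graph_aut_bij[OF g]
  by (auto simp: bij_is_inj inj_image_mem_iff card_image inj_aut[OF g])

text \<open>The truncation of \<open>min m n / n\<close> at \<open>N\<close> is still subadditive, which is all that is needed when a
  closed edge between two clusters is opened, and it makes the functions below local.\<close>
definition phi :: "nat \<Rightarrow> nat \<Rightarrow> nat \<Rightarrow> real" where
  "phi n N m = (if m \<le> N then real (min m n) / real n else 0)"

lemma phi_nonneg: "0 \<le> phi n N m"
  by (simp add: phi_def)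

text \<open>Two clusters of size at least \<open>n\<close> contribute 1 each, while their union
  contributes at most 1. A cluster above \<open>N\<close> has weight 0, and so has every union
  containing it, so the cut-off does not break subadditivity.\<close>

lemma phi_merge:
  assumes "0 < n"
  shows "of_bool (n \<le> a \<and> a \<le> N \<and> n \<le> b \<and> b \<le> N) \<le> phi n N a + phi n N b - phi n N (a + b)"
proof -
  have "min (a + b) n \<le> min a n + min b n" by auto
  then have "real (min (a + b) n) / n \<le> (real (min a n) + real (min b n)) / n"
    by (intro divide_right_mono) auto
  then show ?thesis using assms by (auto simp: phi_def add_divide_distrib min_def)
qed

text \<open>The share of the edge \<open>{v, w}\<close>, seen from \<open>v\<close>, in the total
  \<open>zeta\<close> over the edges touching the cluster of \<open>v\<close>, weighted by
  \<open>phi\<close>.\<close>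

definition edge_flux :: "real \<Rightarrow> nat \<Rightarrow> nat \<Rightarrow> 'v \<Rightarrow> 'v \<Rightarrow> 'v set set \<Rightarrow> real" where
  "edge_flux p n N v w S = (if card (cl S v) \<le> N then
     zeta p S {v, w} * (if w \<in> cl S v then 1/2 else 1) * phi n N (card (cl S v)) else 0)"

definition two_clusters :: "nat \<Rightarrow> nat \<Rightarrow> 'v \<Rightarrow> 'v \<Rightarrow> 'v set set \<Rightarrow> real" where
  "two_clusters n N x w S = of_bool ({x, w} \<notin> S \<and> w \<notin> cl S x \<and>
     n \<le> card (cl S x) \<and> card (cl S x) \<le> N \<and> n \<le> card (cl S w) \<and> card (cl S w) \<le> N)"

lemma zeta_restrict: "e \<in> B \<Longrightarrow> zeta p (S \<inter> B) e = zeta p S e"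
  by (simp add: zeta_def)

lemma edge_in_bedges:
  assumes "finite S" "S \<subseteq> E" "card (cl S u) \<le> N" "v \<in> cl S u" "adj v w" "bedges N u \<subseteq> B"
  shows "{v, w} \<in> B"
proof -
  have "v \<in> ball N u" using cl_subset_ball assms(1-4) by blast
  then have "{v, w} \<in> bedges N u" using assms(5) by (auto simp: bedges_def touching_def)
  then show ?thesis using assms(6) by blast
qed

lemma supp_edge_flux:
  assumes "adj v w" shows "supp (bedges N v) (edge_flux p n N v w)"
  unfolding edge_flux_def
proof (rule supp_cluster)
  fix S assume S: "finite S" "S \<subseteq> E" "card (cl S v) \<le> N" "cl (S \<inter> bedges N v) v = cl S v"
  have "zeta p (S \<inter> bedges N v) {v, w} = zeta p S {v, w}"
    using edge_in_bedges[OF S(1-3) cl_refl assms order.refl] by (rule zeta_restrict)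
  then show "zeta p (S \<inter> bedges N v) {v, w} * (if w \<in> cl (S \<inter> bedges N v) v then 1/2 else 1) * phi n N (card (cl (S \<inter> bedges N v) v))
    = zeta p S {v, w} * (if w \<in> cl S v then 1/2 else 1) * phi n N (card (cl S v))"
    using S(4) by simp
qed (use bedges_subset in auto)

lemma supp_two_clusters:
  assumes "adj x w" "bedges N x \<subseteq> B" "bedges N w \<subseteq> B" "finite B" "B \<subseteq> E"
  shows "supp B (two_clusters n N x w)"
proof -
  have "two_clusters n N x w S = two_clusters n N x w (S \<inter> B)" if S: "finite S" "S \<subseteq> E" for S
  proof (cases "card (cl S x) \<le> N \<and> card (cl S w) \<le> N")
    case True
    then have "cl (S \<inter> B) x = cl S x" "cl (S \<inter> B) w = cl S w"
      using cl_local(2)[OF S] assms by blast+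
    moreover have "{x, w} \<in> B" using edge_in_bedges[OF S] True assms by auto
    ultimately show ?thesis by (simp add: two_clusters_def)
  next
    case False
    then show ?thesis using cl_local(1)[OF S assms(2)] cl_local(1)[OF S assms(3)]
      by (auto simp: two_clusters_def)
  qed
  then show ?thesis using assms by (simp add: supp_def)
qed

lemma edge_flux_aut: "graph_aut adj g \<Longrightarrow> edge_flux p n N (g v) (g w) ((`) g ` S) = edge_flux p n N v w S"
  by (simp add: edge_flux_def mem_cl_aut zeta_aut)

lemma two_clusters_aut: "graph_aut adj g \<Longrightarrow> two_clusters n N (g x) (g w) ((`) g ` S) = two_clusters n N x w S"
proof -
  assume g: "graph_aut adj g"
  have "{g x, g w} \<in> (`) g ` S \<longleftrightarrow> {x, w} \<in> S"
    using zeta_aut[OF g, of 0 S x w] by (auto simp: zeta_def split: if_splits)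
  then show ?thesis using g by (simp add: two_clusters_def mem_cl_aut)
qed

text \<open>Fix all edges but \<open>{x, w}\<close> and average over its state. If its endpoints are
  connected without it, the open and closed contributions cancel. Otherwise, with cluster sizes
  \<open>a\<close> and \<open>b\<close>, the mean is \<open>p * (1 - p)\<close> times
  \<open>phi a + phi b - phi (a + b)\<close>, and \<open>phi_merge\<close> applies. The factor
  \<open>1 - p\<close> is the probability that the edge is closed, as \<open>two_clusters\<close>
  demands.\<close>

lemma EE_edge_flux_ge:
  assumes p: "0 \<le> p" "p \<le> 1" and n: "0 < n" and xw: "adj x w"
  shows "p * EE p (two_clusters n N x w) \<le> EE p (edge_flux p n N x w) + EE p (edge_flux p n N w x)"
proof -
  define B where "B = bedges N x \<union> bedges N w"
  have B: "finite B" "B \<subseteq> E" "bedges N x \<subseteq> B" "bedges N w \<subseteq> B"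
    using bedges_subset by (auto simp: B_def)
  let ?e = "{x, w}" and ?B = "B - {{x, w}}"
  have e: "?e \<in> B" using xw unfolding B_def by (auto simp: bedges_def touching_def)
  have wx: "adj w x" using xw adj_sym by blast
  let ?A = "\<lambda>S. edge_flux p n N x w S + edge_flux p n N w x S"
  have "EE p (edge_flux p n N x w) = bexp p B (edge_flux p n N x w)"
    by (intro EE_eq supp_mono[OF supp_edge_flux[OF xw] B(3) B(1,2)])
  moreover have "EE p (edge_flux p n N w x) = bexp p B (edge_flux p n N w x)"
    by (intro EE_eq supp_mono[OF supp_edge_flux[OF wx] B(4) B(1,2)])
  ultimately have sum: "EE p (edge_flux p n N x w) + EE p (edge_flux p n N w x) = bexp p B ?A"
    by (simp add: bexp_add)
  let ?a = "\<lambda>S. card (cl S x)" and ?b = "\<lambda>S. card (cl S w)"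
  have nonneg: "0 \<le> p * (1 - p)" using p by simp
  have eq: "two_clusters n N x w (insert ?e S) = 0" for S by (simp add: two_clusters_def)
  have "p * EE p (two_clusters n N x w) = p * bexp p B (two_clusters n N x w)"
    using EE_eq[OF supp_two_clusters[OF xw B(3,4,1,2)]] by simp
  also have "\<dots> = (1 - p) * bexp p ?B (\<lambda>S. p * two_clusters n N x w S)"
    unfolding bexp_remove[OF B(1) e, of p "two_clusters n N x w"] eq by (simp add: bexp_cmult)
  also have "\<dots> \<le> (1 - p) * bexp p ?B (\<lambda>S. p * ?A (insert ?e S) / (1 - p) + ?A S)"
  \<comment> \<open>The open contribution is divided by \<open>1 - p\<close> to put both states
    under one expectation. For \<open>p = 1\<close> the outer factor makes both sides zero.\<close>
  proof (cases "p = 1")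
    case False
    then have p1: "1 - p > 0" using p by simp
    show ?thesis
    proof (intro mult_left_mono bexp_mono p)
      fix S assume S: "S \<subseteq> ?B"
      then have fin: "finite S" using B(1) finite_subset by blast
      have cl1: "cl (insert ?e S) x = cl S x \<union> cl S w" "cl (insert ?e S) w = cl S x \<union> cl S w"
        using cl_insert_edge[of x w S] cl_insert_edge[of w x S] by (auto simp: insert_commute)
      let ?u = "card (cl S x \<union> cl S w)"
      have op: "?A (insert ?e S) = - (1 - p) * phi n N ?u"
        unfolding edge_flux_def cl1 by (simp add: zeta_def insert_commute phi_def)
      have eS: "{x, w} \<notin> S" "{w, x} \<notin> S" using S by (auto simp: insert_commute)
      have lhs: "p * ?A (insert ?e S) / (1 - p) + ?A S = ?A S - p * phi n N ?u"
      proof -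
        have "p * (- (1 - p) * phi n N ?u) / (1 - p) = - (p * phi n N ?u)"
          using p1 by (simp add: divide_eq_eq algebra_simps)
        then show ?thesis unfolding op by simp
      qed
      show "p * two_clusters n N x w S \<le> p * ?A (insert ?e S) / (1 - p) + ?A S"
      proof (cases "w \<in> cl S x")
        case True
        then have "cl S w = cl S x" by (rule cl_eq)
        then have "?A S = p * phi n N ?u" using True eS cl_refl[of x S]
          by (simp add: edge_flux_def zeta_def phi_def)
        then show ?thesis unfolding lhs using True by (simp add: two_clusters_def)
      next
        case False
        then have x: "x \<notin> cl S w" using cl_sym by metis
        have "cl S x \<inter> cl S w = {}"
        proof (rule ccontr)
          assume "cl S x \<inter> cl S w \<noteq> {}"
          then obtain y where "y \<in> cl S x" "y \<in> cl S w" by blast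
          then have "cl S x = cl S w" using cl_eq by metis
          then show False using x cl_refl[of x S] by simp
        qed
        then have u: "?u = ?a S + ?b S" using fin by (simp add: card_Un_disjoint)
        have "?A S = p * (phi n N (?a S) + phi n N (?b S))"
          using eS False x by (simp add: edge_flux_def zeta_def phi_def algebra_simps)
        then have "p * ?A (insert ?e S) / (1 - p) + ?A S = p * (phi n N (?a S) + phi n N (?b S) - phi n N (?a S + ?b S))"
          unfolding lhs u by (simp add: algebra_simps)
        moreover have "two_clusters n N x w S \<le> of_bool (n \<le> ?a S \<and> ?a S \<le> N \<and> n \<le> ?b S \<and> ?b S \<le> N)"
          by (simp add: two_clusters_def)
        ultimately show ?thesis
          using phi_merge[OF n, of "?a S" N "?b S"] p by (simp add: mult_left_mono)
      qed
    qed (use p in auto)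
  qed simp
  also have "\<dots> \<le> bexp p B ?A"
  proof (cases "p = 1")
    case True
    have cl1: "cl (insert ?e S) x = cl S x \<union> cl S w" "cl (insert ?e S) w = cl S x \<union> cl S w" for S
      using cl_insert_edge[of x w S] cl_insert_edge[of w x S] by (auto simp: insert_commute)
    have "?A (insert ?e S) = 0" for S
      unfolding edge_flux_def cl1 using True by (simp add: zeta_def insert_commute phi_def)
    then show ?thesis using True unfolding bexp_remove[OF B(1) e, of p ?A] by simp
  next
    case False
    have "(1 - p) * bexp p ?B (\<lambda>S. p * ?A (insert ?e S) / (1 - p) + ?A S)
        = (1 - p) * (bexp p ?B (\<lambda>S. (p / (1 - p)) * ?A (insert ?e S)) + bexp p ?B ?A)"
      by (subst bexp_add[symmetric]) simp
    also have "\<dots> = p * bexp p ?B (\<lambda>S. ?A (insert ?e S)) + (1 - p) * bexp p ?B ?A"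
      unfolding bexp_cmult using False by (simp add: field_simps)
    also have "\<dots> = bexp p B ?A" by (rule bexp_remove[OF B(1) e, symmetric])
    finally show ?thesis by simp
  qed
  finally show ?thesis using sum by simp
qed

lemma supp_cluster_weight:
  fixes h :: "'v \<Rightarrow> 'v set \<Rightarrow> 'v set set \<Rightarrow> real"
  assumes loc: "\<And>v C S B. touching E {v} \<subseteq> B \<Longrightarrow> h v C (S \<inter> B) = h v C S"
  shows "supp (bedges N u) (\<lambda>S. if card (cl S u) \<le> N then if v \<in> cl S u then h v (cl S u) S / r (cl S u) else 0 else 0)"
proof (rule supp_cluster)
  fix S assume S: "finite S" "S \<subseteq> E" "card (cl S u) \<le> N" "cl (S \<inter> bedges N u) u = cl S u"
  have "h v C (S \<inter> bedges N u) = h v C S" if "v \<in> cl S u" for C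
    by (rule loc) (use that cl_subset_ball[OF S(1-3)] in \<open>auto simp: touching_def bedges_def\<close>)
  then show "(if v \<in> cl (S \<inter> bedges N u) u then h v (cl (S \<inter> bedges N u) u) (S \<inter> bedges N u) / r (cl (S \<inter> bedges N u) u) else 0)
      = (if v \<in> cl S u then h v (cl S u) S / r (cl S u) else 0)"
    unfolding S(4) by simp
qed (use bedges_subset in auto)

text \<open>Each vertex spreads the total weight of its cluster evenly over the cluster.\<close>
lemma cluster_mass_transport:
  fixes h :: "'v \<Rightarrow> 'v set \<Rightarrow> 'v set set \<Rightarrow> real"
  assumes inv: "\<And>g v C S. graph_aut adj g \<Longrightarrow> h (g v) (g ` C) ((`) g ` S) = h v C S"
    and loc: "\<And>v C S B. touching E {v} \<subseteq> B \<Longrightarrow> h v C (S \<inter> B) = h v C S"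
  shows "(\<Sum>x\<in>reps. mu x * bexp p (bedges N x)
            (\<lambda>S. if card (cl S x) \<le> N then (\<Sum>v\<in>cl S x. h v (cl S x) S) / card (cl S x) else 0))
       = (\<Sum>x\<in>reps. mu x * bexp p (bedges N x) (\<lambda>S. if card (cl S x) \<le> N then h x (cl S x) S else 0))"
proof -
  define F where "F u v S = (if card (cl S u) \<le> N then
      if v \<in> cl S u then h v (cl S u) S / real (card (cl S u)) else 0 else 0)" for u v S
  have supp: "supp (bedges N u) (F u v)" for u v
    unfolding F_def by (rule supp_cluster_weight) (rule loc)
  have Finv: "EE p (F (g u) (g v)) = EE p (F u v)" if g: "graph_aut adj g" for g u v
  proof (rule EE_aut[OF g supp])
    fix S
    show "F (g u) (g v) ((`) g ` S) = F u v S"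
      using inv[OF g, of v "cl S u" S]
      by (simp add: F_def mem_cl_aut[OF g] cl_aut[OF graph_aut_bij[OF g], symmetric])
  qed
  \<comment> \<open>A cluster of at most \<open>N\<close> vertices stays in \<open>ball N x\<close>,
    so summing over the ball loses none of the mass.\<close>
  have out: "(\<Sum>v\<in>ball N x. EE p (F x v)) = bexp p (bedges N x)
            (\<lambda>S. if card (cl S x) \<le> N then (\<Sum>v\<in>cl S x. h v (cl S x) S) / card (cl S x) else 0)" for x
    unfolding EE_eq[OF supp] bexp_sum[symmetric]
  proof (rule bexp_cong)
    fix S assume "S \<subseteq> bedges N x"
    then have S: "finite S" "S \<subseteq> E" using bedges_subset finite_subset[of S "bedges N x"] by auto
    show "(\<Sum>v\<in>ball N x. F x v S) = (if card (cl S x) \<le> N then (\<Sum>v\<in>cl S x. h v (cl S x) S) / card (cl S x) else 0)"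
    proof (cases "card (cl S x) \<le> N")
      case True
      then have sub: "cl S x \<subseteq> ball N x" using cl_subset_ball S by blast
      have "(\<Sum>v\<in>ball N x. F x v S) = (\<Sum>v\<in>cl S x. h v (cl S x) S / card (cl S x))"
        by (rule sum.mono_neutral_cong_right) (use sub True in \<open>auto simp: F_def\<close>)
      then show ?thesis using True by (simp add: sum_divide_distrib)
    qed (simp add: F_def)
  qed
  have "in": "(\<Sum>u\<in>ball N x. EE p (F u x)) = bexp p (bedges N x) (\<lambda>S. if card (cl S x) \<le> N then h x (cl S x) S else 0)" for x
  proof -
    define G where "G = (\<Union>u\<in>ball N x. bedges N u)"
    have G: "finite G" "G \<subseteq> E" "\<And>u. u \<in> ball N x \<Longrightarrow> bedges N u \<subseteq> G"
      using bedges_subset by (auto simp: G_def)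
    have "(\<Sum>u\<in>ball N x. EE p (F u x)) = bexp p G (\<lambda>S. \<Sum>u\<in>ball N x. F u x S)"
      unfolding bexp_sum by (intro sum.cong refl EE_eq supp_mono[OF supp] G)
    also have "\<dots> = bexp p G (\<lambda>S. if card (cl S x) \<le> N then h x (cl S x) S else 0)"
    proof (rule bexp_cong)
      fix S assume "S \<subseteq> G"
      then have S: "finite S" "S \<subseteq> E" using G finite_subset[of S G] by auto
      show "(\<Sum>u\<in>ball N x. F u x S) = (if card (cl S x) \<le> N then h x (cl S x) S else 0)"
      proof (cases "card (cl S x) \<le> N")
        case True
        then have sub: "cl S x \<subseteq> ball N x" using cl_subset_ball S by blast
        have "(\<Sum>u\<in>ball N x. F u x S) = (\<Sum>u\<in>cl S x. h x (cl S x) S / card (cl S x))"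
        proof (rule sum.mono_neutral_cong_right)
          show "\<forall>i\<in>ball N x - cl S x. F i x S = 0"
          proof
            fix i assume "i \<in> ball N x - cl S x"
            then have "x \<notin> cl S i" using cl_sym[of x S i] by blast
            then show "F i x S = 0" by (simp add: F_def)
          qed
          fix u assume "u \<in> cl S x"
          then have "cl S u = cl S x" by (rule cl_eq)
          then show "F u x S = h x (cl S x) S / card (cl S x)" using True by (simp add: F_def)
        qed (use sub in auto)
        then show ?thesis using True card_cl_pos[OF S(1), of x] by simp
      next
        case False
        have "F u x S = 0" for u
          using False cl_eq[of x S u] by (auto simp: F_def)
        then show ?thesis using False by simp
      qed
    qed
    also have "\<dots> = bexp p (bedges N x) (\<lambda>S. if card (cl S x) \<le> N then h x (cl S x) S else 0)"
    proof (rule bexp_supp)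
      have "supp (bedges N x) (\<lambda>S. if card (cl S x) \<le> N then if x \<in> cl S x then h x (cl S x) S / (1::real) else 0 else 0)"
        by (rule supp_cluster_weight) (rule loc)
      then show "supp (bedges N x) (\<lambda>S. if card (cl S x) \<le> N then h x (cl S x) S else 0)"
        by (simp cong: if_cong)
    qed (use G in auto)
    finally show ?thesis .
  qed
  show ?thesis
    using mass_transport[of "\<lambda>u v. EE p (F u v)" N, OF Finv] unfolding out "in" .
qed

definition vertex_flux :: "real \<Rightarrow> nat \<Rightarrow> nat \<Rightarrow> 'v \<Rightarrow> 'v set \<Rightarrow> 'v set set \<Rightarrow> real" where
  "vertex_flux p n N v C S =
     (\<Sum>w\<in>nbrs adj v. zeta p S {v, w} * (if w \<in> C then 1/2 else 1)) * phi n N (card C)"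

lemma vertex_flux_aut: "graph_aut adj g \<Longrightarrow> vertex_flux p n N (g v) (g ` C) ((`) g ` S) = vertex_flux p n N v C S"
proof -
  assume g: "graph_aut adj g"
  have "inj g" using graph_aut_bij[OF g] by (rule bij_is_inj)
  then show ?thesis
    by (simp add: vertex_flux_def zeta_aut[OF g] nbrs_aut[OF g] sum.reindex inj_aut[OF g]
        card_image inj_image_mem_iff)
qed

lemma vertex_flux_local: "touching E {v} \<subseteq> B \<Longrightarrow> vertex_flux p n N v C (S \<inter> B) = vertex_flux p n N v C S"
  unfolding vertex_flux_def
  by (intro arg_cong2[where f = "(*)"] sum.cong refl zeta_restrict) (auto simp: touching_def)

lemma vertex_flux_sum:
  "bexp p (bedges N x) (\<lambda>S. if card (cl S x) \<le> N then vertex_flux p n N x (cl S x) S else 0)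
     = (\<Sum>w\<in>nbrs adj x. EE p (edge_flux p n N x w))"
proof -
  have "(\<Sum>w\<in>nbrs adj x. EE p (edge_flux p n N x w)) = (\<Sum>w\<in>nbrs adj x. bexp p (bedges N x) (edge_flux p n N x w))"
    by (intro sum.cong refl EE_eq supp_edge_flux) simp
  also have "\<dots> = bexp p (bedges N x) (\<lambda>S. if card (cl S x) \<le> N then vertex_flux p n N x (cl S x) S else 0)"
    unfolding bexp_sum[symmetric] by (intro bexp_cong) (simp add: edge_flux_def vertex_flux_def sum_distrib_right)
  finally show ?thesis by simp
qed

text \<open>By \<open>exploration_fluctuation\<close> started from \<open>x\<close> with
  \<open>z = t = 0\<close> and by Jensen's inequality, the total \<open>zeta\<close> divided by
  \<open>n\<close> plus the number of touching edges has mean absolute value at most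
  \<open>1 / sqrt n\<close>. The actual weight \<open>phi / card\<close> is at most
  \<open>1 / max n card\<close>, comparable up to \<open>2 * maxdeg\<close> because a cluster of
  \<open>k\<close> vertices touches at most \<open>maxdeg * k\<close> edges.\<close>

lemma cluster_flux_bound:
  assumes p: "0 \<le> p" "p \<le> 1" and n: "0 < n"
  shows "bexp p (bedges N x) (\<lambda>S. if card (cl S x) \<le> N then
      (\<Sum>v\<in>cl S x. vertex_flux p n N v (cl S x) S) / card (cl S x) else 0) \<le> 2 * maxdeg / sqrt n"
proof -
  let ?B = "bedges N x"
  let ?T = "\<lambda>S. touching ?B (cl S x)"
  let ?g = "\<lambda>S. ((0 + (\<Sum>e\<in>?T S. zeta p S e)) / (n + (0::nat) + card (?T S)))"
  let ?f = "\<lambda>S. if card (cl S x) \<le> N then (\<Sum>e\<in>?T S. zeta p S e) * phi n N (card (cl S x)) / card (cl S x) else 0"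
  have "(bexp p ?B (\<lambda>S. \<bar>?g S\<bar>))\<^sup>2 \<le> bexp p ?B (\<lambda>S. \<bar>?g S\<bar>\<^sup>2)"
    by (rule bexp_power2) (use p in auto)
  also have "\<dots> \<le> 1 / n"
  proof -
    have "\<exists>x y. e = {x, y}" if "e \<in> ?B" for e
      using that bedges_subset[of N x] edgeE[of e] by blast
    then show ?thesis
      unfolding power2_abs using exploration_fluctuation[of ?B p n 0 "{x}" 0] p n by simp
  qed
  finally have "sqrt ((bexp p ?B (\<lambda>S. \<bar>?g S\<bar>))\<^sup>2) \<le> sqrt (1 / n)"
    by (rule real_sqrt_le_mono)
  moreover have "0 \<le> bexp p ?B (\<lambda>S. \<bar>?g S\<bar>)"
    using p by (intro bexp_nonneg) auto
  ultimately have b: "bexp p ?B (\<lambda>S. \<bar>?g S\<bar>) \<le> 1 / sqrt n"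
    by (simp add: real_sqrt_divide)
  have "bexp p ?B (\<lambda>S. if card (cl S x) \<le> N then
      (\<Sum>v\<in>cl S x. vertex_flux p n N v (cl S x) S) / card (cl S x) else 0) = bexp p ?B ?f"
  proof (rule bexp_cong)
    fix S assume "S \<subseteq> ?B"
    then have S: "finite S" "S \<subseteq> E" using bedges_subset finite_subset[of S ?B] by auto
    show "(if card (cl S x) \<le> N then (\<Sum>v\<in>cl S x. vertex_flux p n N v (cl S x) S) / card (cl S x) else 0) = ?f S"
    proof (cases "card (cl S x) \<le> N")
      case True
      then have "cl S x \<subseteq> ball N x" using cl_subset_ball S by blast
      then have "?T S = touching E (cl S x)" by (auto simp: touching_def bedges_def)
      then show ?thesis
        using sum_touching[of "cl S x" "zeta p S"] S by (simp add: vertex_flux_def sum_distrib_right[symmetric])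
    qed simp
  qed
  also have "\<dots> \<le> bexp p ?B (\<lambda>S. 2 * maxdeg * \<bar>?g S\<bar>)"
  proof (rule bexp_mono[OF p])
    fix S assume "S \<subseteq> ?B"
    then have S: "finite S" "S \<subseteq> E" using bedges_subset finite_subset[of S ?B] by auto
    let ?k = "card (cl S x)" and ?t = "card (?T S)" and ?z = "\<Sum>e\<in>?T S. zeta p S e"
    have pos: "?k > 0" using S by (simp add: card_cl_pos)
    have "?T S \<subseteq> touching E (cl S x)" using bedges_subset by (auto simp: touching_def)
    then have "?t \<le> card (touching E (cl S x))" using S finite_touching_E by (intro card_mono) auto
    also have "\<dots> \<le> maxdeg * ?k" using S by (intro card_touching_le) auto
    finally have t: "?t \<le> maxdeg * ?k" .
    have "n + ?t \<le> maxdeg * max n ?k + maxdeg * max n ?k"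
    proof (rule add_mono)
      have "n \<le> 1 * max n ?k" by simp
      also have "\<dots> \<le> maxdeg * max n ?k" using maxdeg_pos by (intro mult_right_mono) auto
      finally show "n \<le> maxdeg * max n ?k" .
      show "?t \<le> maxdeg * max n ?k" by (rule order.trans[OF t]) simp
    qed
    then have "real (n + ?t) \<le> real (2 * maxdeg * max n ?k)" by (intro of_nat_mono) simp
    then have le: "1 / real (max n ?k) \<le> 2 * maxdeg / real (n + ?t)"
      using n by (simp add: field_simps)
    have "phi n N ?k / ?k \<le> 1 / real (max n ?k)"
      using n pos by (auto simp: phi_def min_def max_def)
    also note le
    finally have "phi n N ?k / ?k \<le> 2 * maxdeg / real (n + ?t)" .
    then have "\<bar>?z\<bar> * (phi n N ?k / ?k) \<le> \<bar>?z\<bar> * (2 * maxdeg / real (n + ?t))"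
      by (rule mult_left_mono) simp
    moreover have "?z * phi n N ?k / ?k \<le> \<bar>?z\<bar> * (phi n N ?k / ?k)"
      using phi_nonneg[of n N ?k] by (simp add: mult_right_mono divide_right_mono)
    moreover have "\<bar>?z\<bar> * (2 * maxdeg / real (n + ?t)) = 2 * maxdeg * \<bar>?g S\<bar>"
      by (simp add: abs_divide)
    moreover have "0 \<le> 2 * maxdeg * \<bar>?g S\<bar>" by simp
    ultimately show "?f S \<le> 2 * maxdeg * \<bar>?g S\<bar>"
      by (smt (verit))
  qed
  also have "\<dots> = 2 * maxdeg * bexp p ?B (\<lambda>S. \<bar>?g S\<bar>)" by (rule bexp_cmult)
  also have "\<dots> \<le> 2 * maxdeg * (1 / sqrt n)" using b by (intro mult_left_mono) auto
  finally show ?thesis by simp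
qed

lemma nbrs_subset_ball1: "nbrs adj x \<subseteq> ball 1 x"
  using ball_step[of x 0 x] by auto

text \<open>Hutchcroft's two-ghost inequality, after Aizenman, Kesten and Newman: the flux through an edge
  detects pairs of large clusters meeting at it, while the total flux of one cluster is a stopped
  martingale.\<close>
lemma two_clusters_bound:
  obtains K where "0 \<le> K"
    and "\<And>p n N x w. 0 \<le> p \<Longrightarrow> p \<le> 1 \<Longrightarrow> 0 < n \<Longrightarrow> adj x w \<Longrightarrow> p * EE p (two_clusters n N x w) \<le> K / sqrt (real n)"
proof
  define M where "M = (\<Sum>x\<in>reps. mu x)"
  define m where "m = Min (mu ` reps)"
  have m: "m > 0" unfolding m_def using finite_reps reps_nonempty mu_pos by (subst Min_gr_iff) auto
  have M: "M \<ge> 0" unfolding M_def using mu_pos by (intro sum_nonneg) (auto intro: less_imp_le)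
  \<comment> \<open>The two orientations of an edge give a factor 2, a single cluster gives
    \<open>2 * maxdeg\<close>, and \<open>M / m\<close> passes from the weighted sum over
    representatives to one of its terms.\<close>
  let ?K = "4 * maxdeg * M / m"
  show "0 \<le> ?K" using m M by simp
  fix p :: real and n N :: nat and x0 w0
  assume p: "0 \<le> p" "p \<le> 1" and n: "0 < n" and xw0: "adj x0 w0"
  obtain x g where x: "x \<in> reps" "graph_aut adj g" "x0 = g x" by (rule repE)
  define w where "w = inv g w0"
  have w: "w0 = g w" using x by (simp add: w_def)
  have xw: "adj x w" using xw0 graph_aut_adj[OF x(2)] unfolding x(3) w by blast
  define s where "s = (\<lambda>x w. EE p (two_clusters n N x w))"
  define d where "d = (\<lambda>x w. EE p (edge_flux p n N x w))"
  have s0: "s x0 w0 = s x w"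
    unfolding s_def x(3) w
    by (rule EE_aut[OF x(2) supp_two_clusters[OF xw Un_upper1 Un_upper2]])
       (use two_clusters_aut[OF x(2)] bedges_subset in auto)
  have s_nonneg: "0 \<le> s x w" if "adj x w" for x w
    unfolding s_def using p bedges_subset
    by (subst EE_eq[OF supp_two_clusters[OF that Un_upper1 Un_upper2]])
       (auto intro!: bexp_nonneg simp: two_clusters_def)
  have d_inv: "(if adj (h u) (h v) then d (h u) (h v) else 0) = (if adj u v then d u v else 0)"
    if "graph_aut adj h" for h u v
    using EE_aut[OF that supp_edge_flux edge_flux_aut[OF that]] graph_aut_adj[OF that] by (simp add: d_def)
  have R1: "(\<Sum>x\<in>reps. mu x * (\<Sum>w\<in>nbrs adj x. d x w)) = (\<Sum>x\<in>reps. mu x * bexp p (bedges N x)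
      (\<lambda>S. if card (cl S x) \<le> N then (\<Sum>v\<in>cl S x. vertex_flux p n N v (cl S x) S) / card (cl S x) else 0))"
    using cluster_mass_transport[of "vertex_flux p n N" p N, OF vertex_flux_aut vertex_flux_local]
    by (simp add: vertex_flux_sum d_def)
  have ball1: "(\<Sum>v\<in>ball 1 x. if adj x v then h v else 0) = (\<Sum>w\<in>nbrs adj x. h w)" for x and h :: "'v \<Rightarrow> real"
    by (rule sum.mono_neutral_cong_right) (use nbrs_subset_ball1 in auto)
  have ball2: "(\<Sum>u\<in>ball 1 x. if adj u x then h u else 0) = (\<Sum>w\<in>nbrs adj x. h w)" for x and h :: "'v \<Rightarrow> real"
    using ball1[of x h] adj_sym[of x] by simp
  \<comment> \<open>Mass transport along edges: both orientations have the same total flux, so only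
    the outgoing one has to be bounded.\<close>
  have R2: "(\<Sum>x\<in>reps. mu x * (\<Sum>w\<in>nbrs adj x. d x w)) = (\<Sum>x\<in>reps. mu x * (\<Sum>w\<in>nbrs adj x. d w x))"
    using mass_transport[of "\<lambda>u v. if adj u v then d u v else 0" 1, OF d_inv]
    unfolding ball1 ball2 .
  have "p * (mu x * s x w) \<le> p * (\<Sum>x\<in>reps. mu x * (\<Sum>w\<in>nbrs adj x. s x w))"
  proof (rule mult_left_mono)
    have "mu x * s x w \<le> mu x * (\<Sum>w\<in>nbrs adj x. s x w)"
      using xw s_nonneg mu_pos[of x] by (intro mult_left_mono member_le_sum) auto
    also have "\<dots> \<le> (\<Sum>x\<in>reps. mu x * (\<Sum>w\<in>nbrs adj x. s x w))"
      using x s_nonneg mu_pos finite_reps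
      by (intro member_le_sum) (auto intro!: mult_nonneg_nonneg sum_nonneg less_imp_le[OF mu_pos])
    finally show "mu x * s x w \<le> (\<Sum>x\<in>reps. mu x * (\<Sum>w\<in>nbrs adj x. s x w))" .
  qed (use p in auto)
  also have "\<dots> = (\<Sum>x\<in>reps. mu x * (\<Sum>w\<in>nbrs adj x. p * s x w))"
    by (simp add: sum_distrib_left mult_ac)
  also have "\<dots> \<le> (\<Sum>x\<in>reps. mu x * (\<Sum>w\<in>nbrs adj x. d x w + d w x))"
    unfolding s_def d_def using mu_pos EE_edge_flux_ge[OF p n]
    by (intro sum_mono mult_left_mono) (auto intro: less_imp_le)
  also have "\<dots> = 2 * (\<Sum>x\<in>reps. mu x * (\<Sum>w\<in>nbrs adj x. d x w))"
    using R2 by (simp add: sum.distrib distrib_left)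
  also have "\<dots> \<le> 2 * (\<Sum>x\<in>reps. mu x * (2 * maxdeg / sqrt n))"
    unfolding R1 using cluster_flux_bound[OF p n] mu_pos
    by (intro mult_left_mono sum_mono) (auto intro: less_imp_le)
  also have "\<dots> = 4 * maxdeg * M / sqrt n" by (simp add: M_def sum_distrib_left sum_divide_distrib mult_ac)
  finally have "mu x * (p * s x w) \<le> 4 * maxdeg * M / sqrt n" by (simp add: mult_ac)
  moreover have "m * (p * s x w) \<le> mu x * (p * s x w)"
  proof (rule mult_right_mono)
    show "m \<le> mu x" unfolding m_def using x finite_reps by (intro Min_le) auto
  qed (use p s_nonneg[OF xw] in auto)
  ultimately have "m * (p * s x w) \<le> 4 * maxdeg * M / sqrt n" by simp
  then have "p * s x w \<le> 4 * maxdeg * M / sqrt n / m"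
    unfolding pos_le_divide_eq[OF m] by (simp only: mult.commute)
  then have "p * s x w \<le> ?K / sqrt n" by (simp add: mult.commute)
  then show "p * EE p (two_clusters n N x0 w0) \<le> ?K / sqrt n" using s0 by (simp add: s_def)
qed


section \<open>Clusters and the random walk\<close>

lemma nbrs_nonempty [simp]: "nbrs adj v \<noteq> {}"
  by (metis card.empty deg_pos less_irrefl)

definition walk_into :: "nat \<Rightarrow> 'v set \<Rightarrow> 'v \<Rightarrow> real" where
  "walk_into s C w = (\<Sum>v\<in>C. srw_prob adj s w v)"

lemma srw_prob_nonneg: "0 \<le> srw_prob adj s v w"
  by (induction s arbitrary: v) (auto intro!: divide_nonneg_nonneg sum_nonneg)

lemma srw_prob_relpowp: "srw_prob adj s v w \<noteq> 0 \<Longrightarrow> (adj ^^ s) v w"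
proof (induction s arbitrary: v)
  case (Suc s)
  then have "(\<Sum>u\<in>nbrs adj v. srw_prob adj s u w) \<noteq> 0" by auto
  then obtain u where "u \<in> nbrs adj v" "srw_prob adj s u w \<noteq> 0" by (meson sum.neutral)
  then have "adj v u" "(adj ^^ s) u w" using Suc.IH by auto
  then show ?case by (rule relpowp_Suc_I2)
qed (auto split: if_splits)

lemma srw_prob_ball: "w \<notin> ball s v \<Longrightarrow> srw_prob adj s v w = 0"
  using srw_prob_relpowp by (force simp: ball_def)

lemma srw_prob_sum: "(\<Sum>w\<in>ball s v. srw_prob adj s v w) = 1"
proof -
  \<comment> \<open>Different neighbours have different balls; a common superset \<open>A\<close>
    lets their sums be interchanged.\<close>
  have "(\<Sum>w\<in>A. srw_prob adj s v w) = 1" if "finite A" "ball s v \<subseteq> A" for A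
    using that
  proof (induction s arbitrary: v)
    case 0
    then have "v \<in> A" by simp
    then show ?case using 0 by simp
  next
    case (Suc s)
    have sub: "ball s u \<subseteq> A" if u: "u \<in> nbrs adj v" for u
    proof
      fix w assume "w \<in> ball s u"
      then obtain k where "k \<le> s" "(adj ^^ k) u w" by (auto simp: ball_def)
      then have "Suc k \<le> Suc s" "(adj ^^ Suc k) v w" using u relpowp_Suc_I2[of adj v u k w] by auto
      then have "w \<in> ball (Suc s) v" unfolding ball_def by blast
      then show "w \<in> A" using Suc.prems by blast
    qed
    have "(\<Sum>w\<in>A. srw_prob adj (Suc s) v w) = (\<Sum>w\<in>A. \<Sum>u\<in>nbrs adj v. srw_prob adj s u w) / deg v"
      by (simp add: sum_divide_distrib)
    also have "(\<Sum>w\<in>A. \<Sum>u\<in>nbrs adj v. srw_prob adj s u w) = (\<Sum>u\<in>nbrs adj v. \<Sum>w\<in>A. srw_prob adj s u w)"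
      by (rule sum.swap)
    also have "(\<Sum>u\<in>nbrs adj v. \<Sum>w\<in>A. srw_prob adj s u w) = (\<Sum>u\<in>nbrs adj v. 1)"
      using Suc.prems sub by (intro sum.cong refl Suc.IH)
    finally show ?case using deg_pos[of v] by simp
  qed
  then show ?thesis by simp
qed

lemma srw_prob_aut: "graph_aut adj g \<Longrightarrow> srw_prob adj s (g v) (g w) = srw_prob adj s v w"
proof (induction s arbitrary: v)
  case 0
  then show ?case using graph_aut_bij[of g] by (auto simp: bij_is_inj inj_eq)
next
  case (Suc s)
  then show ?case by (simp add: nbrs_aut sum.reindex inj_aut card_image)
qed

lemma walk_into_Suc: "walk_into (Suc s) C w = (\<Sum>u\<in>nbrs adj w. walk_into s C u) / deg w"
proof -
  have "walk_into (Suc s) C w = (\<Sum>v\<in>C. \<Sum>u\<in>nbrs adj w. srw_prob adj s u v) / deg w"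
    by (simp add: walk_into_def sum_divide_distrib)
  also have "(\<Sum>v\<in>C. \<Sum>u\<in>nbrs adj w. srw_prob adj s u v) = (\<Sum>u\<in>nbrs adj w. walk_into s C u)"
    unfolding walk_into_def by (rule sum.swap)
  finally show ?thesis .
qed

lemma walk_into_0: "finite C \<Longrightarrow> walk_into 0 C w = of_bool (w \<in> C)"
  by (simp add: walk_into_def)

lemma walk_into_nonneg: "0 \<le> walk_into s C w"
  unfolding walk_into_def by (intro sum_nonneg srw_prob_nonneg)

lemma walk_into_ball: "w \<notin> (\<Union>v\<in>C. ball s v) \<Longrightarrow> walk_into s C w = 0"
  unfolding walk_into_def by (intro sum.neutral) (auto simp: srw_prob_ball ball_sym[of w])

text \<open>\<open>return_mass m C\<close> is the inner product of the indicator function of \<open>C\<close> with its image under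
  \<open>m\<close> steps of the walk, in the space weighted by the degrees, in which the walk is self-adjoint.\<close>
definition return_mass :: "nat \<Rightarrow> 'v set \<Rightarrow> real" where
  "return_mass m C = (\<Sum>w\<in>C. deg w * walk_into m C w)"

text \<open>Reversibility: after cancelling the degrees, both sides sum \<open>f u * h w\<close>
  over the ordered adjacent pairs in \<open>U\<close>. The vanishing outside \<open>U\<close>
  replaces an infinite sum over all vertices.\<close>

lemma walk_self_adjoint:
  fixes f h :: "'v \<Rightarrow> real"
  assumes U: "finite U" and f: "\<And>u. u \<notin> U \<Longrightarrow> f u = 0" and h: "\<And>u. u \<notin> U \<Longrightarrow> h u = 0"
  shows "(\<Sum>w\<in>U. deg w * ((\<Sum>u\<in>nbrs adj w. f u) / deg w) * h w)
       = (\<Sum>w\<in>U. deg w * f w * ((\<Sum>u\<in>nbrs adj w. h u) / deg w))"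
proof -
  have *: "(\<Sum>w\<in>U. deg w * ((\<Sum>u\<in>nbrs adj w. f u) / deg w) * h w) = (\<Sum>w\<in>U. \<Sum>u\<in>U. of_bool (adj w u) * (f u * h w))"
    if "\<And>u. u \<notin> U \<Longrightarrow> f u = 0" for f h :: "'v \<Rightarrow> real"
  proof (rule sum.cong[OF refl])
    fix w
    have "(\<Sum>u\<in>nbrs adj w. f u * h w) = (\<Sum>u\<in>nbrs adj w \<inter> U. f u * h w)"
      by (rule sum.mono_neutral_right) (use that in auto)
    also have "\<dots> = (\<Sum>u\<in>U. of_bool (adj w u) * (f u * h w))"
      by (rule sum.mono_neutral_cong_left) (use U in auto)
    finally have *: "(\<Sum>u\<in>nbrs adj w. f u * h w) = (\<Sum>u\<in>U. of_bool (adj w u) * (f u * h w))" .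
    show "deg w * ((\<Sum>u\<in>nbrs adj w. f u) / deg w) * h w = (\<Sum>u\<in>U. of_bool (adj w u) * (f u * h w))"
    proof -
      have "deg w * ((\<Sum>u\<in>nbrs adj w. f u) / deg w) = (\<Sum>u\<in>nbrs adj w. f u)"
        using deg_pos[of w] by simp
      then show ?thesis using * by (simp only: sum_distrib_right)
    qed
  qed
  have "(\<Sum>w\<in>U. deg w * f w * ((\<Sum>u\<in>nbrs adj w. h u) / deg w)) = (\<Sum>w\<in>U. deg w * ((\<Sum>u\<in>nbrs adj w. h u) / deg w) * f w)"
    by (simp add: mult_ac)
  also have "\<dots> = (\<Sum>w\<in>U. \<Sum>u\<in>U. of_bool (adj w u) * (h u * f w))" by (rule *[OF h])
  also have "\<dots> = (\<Sum>u\<in>U. \<Sum>w\<in>U. of_bool (adj w u) * (h u * f w))" by (rule sum.swap)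
  also have "\<dots> = (\<Sum>u\<in>U. \<Sum>w\<in>U. of_bool (adj u w) * (f w * h u))"
    by (intro sum.cong refl) (simp add: adj_sym mult.commute)
  also have "\<dots> = (\<Sum>w\<in>U. deg w * ((\<Sum>u\<in>nbrs adj w. f u) / deg w) * h w)" by (rule *[OF f, symmetric])
  finally show ?thesis by simp
qed

text \<open>Steps are moved one at a time from one factor to the other. The set \<open>U\<close>
  contains all vertices that the walks can reach within the \<open>R\<close> steps in play.\<close>

lemma walk_inner:
  assumes C: "finite C" and U: "finite U" "(\<Union>v\<in>C. ball R v) \<subseteq> U" and st: "s + t \<le> R"
  shows "(\<Sum>w\<in>U. deg w * walk_into s C w * walk_into t C w) = return_mass (s + t) C"
  using st
proof (induction s arbitrary: t)
  case 0
  have "C \<subseteq> U" using U(2) self_in_ball by blast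
  then show ?case
    unfolding return_mass_def using U C
    by (intro sum.mono_neutral_cong_right) (auto simp: walk_into_0)
next
  case (Suc s)
  have zero: "walk_into r C u = 0" if "r \<le> R" "u \<notin> U" for r u
    by (rule walk_into_ball) (use that U ball_mono[of r R] in blast)
  have "(\<Sum>w\<in>U. deg w * walk_into (Suc s) C w * walk_into t C w) = (\<Sum>w\<in>U. deg w * walk_into s C w * walk_into (Suc t) C w)"
    unfolding walk_into_Suc by (rule walk_self_adjoint) (use U zero Suc.prems in auto)
  also have "\<dots> = return_mass (Suc s + t) C" using Suc.IH[of "Suc t"] Suc.prems by simp
  finally show ?case .
qed

lemma return_mass_nonneg: "0 \<le> return_mass m C"
  unfolding return_mass_def by (intro sum_nonneg mult_nonneg_nonneg walk_into_nonneg) auto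

lemma return_mass_0: "finite C \<Longrightarrow> return_mass 0 C = (\<Sum>w\<in>C. real (deg w))"
  by (simp add: return_mass_def walk_into_0)

lemma return_mass_log_convex:
  assumes C: "finite C"
  shows "(return_mass (s + t) C)\<^sup>2 \<le> return_mass (2 * s) C * return_mass (2 * t) C"
proof -
  define U where "U = (\<Union>v\<in>C. ball (2 * s + 2 * t) v)"
  have U: "finite U" "(\<Union>v\<in>C. ball (2 * s + 2 * t) v) \<subseteq> U" using C by (auto simp: U_def)
  let ?f = "\<lambda>s w. sqrt (deg w) * walk_into s C w"
  have eq: "(\<Sum>w\<in>U. ?f s w * ?f t w) = (\<Sum>w\<in>U. deg w * walk_into s C w * walk_into t C w)" for s t
  proof (rule sum.cong[OF refl])
    fix w
    have "?f s w * ?f t w = (sqrt (deg w) * sqrt (deg w)) * walk_into s C w * walk_into t C w"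
      by (simp only: mult_ac)
    then show "?f s w * ?f t w = deg w * walk_into s C w * walk_into t C w" by simp
  qed
  have "(\<Sum>w\<in>U. ?f s w * ?f t w)\<^sup>2 \<le> (\<Sum>w\<in>U. (?f s w)\<^sup>2) * (\<Sum>w\<in>U. (?f t w)\<^sup>2)"
    by (rule Cauchy_Schwarz_ineq_sum)
  then show ?thesis
    unfolding power2_eq_square[of "?f _ _"] eq
    using walk_inner[OF C U, of s t] walk_inner[OF C U, of s s] walk_inner[OF C U, of t t]
    by (simp add: mult_2)
qed

text \<open>Along multiples of \<open>2 * s\<close> the sequence is log-convex, so each successive
  ratio is at least the first one, and \<open>k\<close> of them multiply up. Everything is written
  without quotients because a term may be zero.\<close>

lemma return_mass_power:
  assumes C: "finite C"
  shows "return_mass (2 * s) C ^ k * return_mass 0 C \<le> return_mass 0 C ^ k * return_mass (2 * s * k) C"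
proof -
  define D where "D j = return_mass (2 * s * j) C" for j
  have D: "0 \<le> D j" for j by (simp add: D_def return_mass_nonneg)
  have conv: "(D (Suc j))\<^sup>2 \<le> D j * D (Suc (Suc j))" for j
  proof -
    have "s * j + s * Suc (Suc j) = 2 * s * Suc j" by (simp add: algebra_simps)
    then show ?thesis
      using return_mass_log_convex[OF C, of "s * j" "s * Suc (Suc j)"]
      by (simp only: D_def mult.assoc)
  qed
  have step: "D j * D 1 \<le> D 0 * D (Suc j)" for j
  proof (induction j)
    case (Suc j)
    show ?case
    proof (cases "D j = 0")
      case True
      then have "(D (Suc j))\<^sup>2 \<le> 0" using conv[of j] by simp
      then have "D (Suc j) = 0" by simp
      then show ?thesis using D by simp
    next
      case False
      then have pos: "D j > 0" using D[of j] by simp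
      have "D j * (D (Suc j) * D 1) = D (Suc j) * (D j * D 1)" by simp
      also have "\<dots> \<le> D (Suc j) * (D 0 * D (Suc j))" using Suc D by (intro mult_left_mono)
      also have "\<dots> = D 0 * (D (Suc j))\<^sup>2" by (simp add: power2_eq_square)
      also have "\<dots> \<le> D 0 * (D j * D (Suc (Suc j)))" using conv D by (intro mult_left_mono)
      also have "\<dots> = D j * (D 0 * D (Suc (Suc j)))" by simp
      finally show ?thesis using pos by simp
    qed
  qed simp
  have "D 1 ^ k * D 0 \<le> D 0 ^ k * D k"
  proof (induction k)
    case (Suc k)
    have "D 1 ^ Suc k * D 0 = D 1 * (D 1 ^ k * D 0)" by simp
    also have "\<dots> \<le> D 1 * (D 0 ^ k * D k)" using Suc D by (intro mult_left_mono)
    also have "\<dots> = D 0 ^ k * (D k * D 1)" by simp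
    also have "\<dots> \<le> D 0 ^ k * (D 0 * D (Suc k))" using step D by (intro mult_left_mono) auto
    finally show ?case by (simp add: mult_ac)
  qed simp
  then show ?thesis by (simp add: D_def)
qed

text \<open>The quantity is the squared norm of the \<open>m\<close>-step image of the indicator of
  \<open>C\<close>. Splitting it over \<open>v \<in> C\<close>, Cauchy-Schwarz costs a factor
  \<open>card C\<close> and leaves the diagonal terms
  \<open>deg v * srw_prob (2 * m) v v\<close>.\<close>

lemma return_mass_le_card:
  fixes \<epsilon> :: real
  assumes C: "finite C" and \<epsilon>: "\<And>v. srw_prob adj (2 * m) v v \<le> \<epsilon>"
  shows "return_mass (2 * m) C \<le> card C * \<epsilon> * return_mass 0 C"
proof -
  define U where "U = (\<Union>v\<in>C. ball (2 * m) v)"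
  have U: "finite U" "(\<Union>v\<in>C. ball (2 * m) v) \<subseteq> U" using C by (auto simp: U_def)
  have "return_mass (2 * m) C = (\<Sum>w\<in>U. deg w * walk_into m C w * walk_into m C w)"
    using walk_inner[OF C U, of m m] by (simp add: mult_2)
  also have "\<dots> \<le> (\<Sum>w\<in>U. deg w * (card C * (\<Sum>v\<in>C. (srw_prob adj m w v)\<^sup>2)))"
  proof (rule sum_mono)
    fix w
    have "(walk_into m C w)\<^sup>2 = (\<Sum>v\<in>C. 1 * srw_prob adj m w v)\<^sup>2" by (simp add: walk_into_def)
    also have "\<dots> \<le> (\<Sum>v\<in>C. 1\<^sup>2) * (\<Sum>v\<in>C. (srw_prob adj m w v)\<^sup>2)" by (rule Cauchy_Schwarz_ineq_sum)
    finally show "deg w * walk_into m C w * walk_into m C w \<le> deg w * (card C * (\<Sum>v\<in>C. (srw_prob adj m w v)\<^sup>2))"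
      by (simp add: power2_eq_square mult.assoc mult_left_mono)
  qed
  also have "\<dots> = card C * (\<Sum>w\<in>U. \<Sum>v\<in>C. deg w * (srw_prob adj m w v)\<^sup>2)"
    by (simp add: sum_distrib_left mult_ac)
  also have "\<dots> = card C * (\<Sum>v\<in>C. \<Sum>w\<in>U. deg w * (srw_prob adj m w v)\<^sup>2)"
    by (subst sum.swap) simp
  also have "\<dots> = card C * (\<Sum>v\<in>C. return_mass (2 * m) {v})"
  proof -
    have "(\<Sum>w\<in>U. deg w * (srw_prob adj m w v)\<^sup>2) = return_mass (2 * m) {v}" if "v \<in> C" for v
    proof -
      have "(\<Union>v\<in>{v}. ball (2 * m) v) \<subseteq> U" using that by (auto simp: U_def)
      then have "(\<Sum>w\<in>U. deg w * walk_into m {v} w * walk_into m {v} w) = return_mass (m + m) {v}"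
        using U by (intro walk_inner) auto
      then show ?thesis by (simp add: walk_into_def power2_eq_square mult_2 mult.assoc)
    qed
    then show ?thesis by simp
  qed
  also have "\<dots> \<le> card C * (\<Sum>v\<in>C. deg v * \<epsilon>)"
    using \<epsilon> by (intro mult_left_mono sum_mono) (auto simp: return_mass_def walk_into_def intro!: mult_left_mono)
  also have "\<dots> = card C * \<epsilon> * return_mass 0 C"
    using C by (simp add: return_mass_0 sum_distrib_right[symmetric])
  finally show ?thesis .
qed

text \<open>By log-convexity, the fraction of walks from \<open>C\<close> that are back in \<open>C\<close> decays fastest initially.\<close>
lemma return_mass_decay:
  fixes \<rho> \<epsilon> :: real
  assumes C: "finite C" "C \<noteq> {}" and k: "0 < k" and \<rho>: "0 \<le> \<rho>"
    and \<epsilon>: "\<And>v. srw_prob adj (2 * (s * k)) v v \<le> \<epsilon>" "card C * \<epsilon> \<le> \<rho> ^ k"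
  shows "return_mass (2 * s) C \<le> \<rho> * return_mass 0 C"
proof -
  have pos: "0 < return_mass 0 C"
    using C deg_pos by (auto simp: return_mass_0 intro!: sum_pos)
  have "return_mass (2 * s) C ^ k * return_mass 0 C \<le> return_mass 0 C ^ k * return_mass (2 * (s * k)) C"
    using return_mass_power[OF C(1), of s k] by (simp add: mult.assoc)
  also have "\<dots> \<le> return_mass 0 C ^ k * (card C * \<epsilon> * return_mass 0 C)"
    using return_mass_le_card[OF C(1) \<epsilon>(1)] pos by (intro mult_left_mono) auto
  also have "\<dots> \<le> return_mass 0 C ^ k * (\<rho> ^ k * return_mass 0 C)"
    using \<epsilon>(2) pos by (intro mult_left_mono mult_right_mono) auto
  also have "\<dots> = (\<rho> * return_mass 0 C) ^ k * return_mass 0 C" by (simp add: power_mult_distrib)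
  finally have "return_mass (2 * s) C ^ k \<le> (\<rho> * return_mass 0 C) ^ k" using pos by simp
  then show ?thesis
    using k pos \<rho> by (metis Suc_pred power_le_imp_le_base mult_nonneg_nonneg less_imp_le)
qed

definition conn_upto :: "nat \<Rightarrow> 'v \<Rightarrow> 'v \<Rightarrow> 'v set set \<Rightarrow> real" where
  "conn_upto N o' v S = of_bool (card (cl S o') \<le> N \<and> v \<in> cl S o')"

lemma supp_conn_upto: "supp (bedges N x) (conn_upto N x v)"
proof -
  have "supp (bedges N x) (\<lambda>S. if card (cl S x) \<le> N then (of_bool (v \<in> cl S x) :: real) else 0)"
    by (rule supp_cluster) (use bedges_subset in auto)
  moreover have "(\<lambda>S. if card (cl S x) \<le> N then (of_bool (v \<in> cl S x) :: real) else 0) = conn_upto N x v"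
    by (auto simp: conn_upto_def fun_eq_iff)
  ultimately show ?thesis by simp
qed

text \<open>Every cluster of size at most \<open>N\<close> satisfies
  \<open>return_mass_decay\<close>, and mass transport turns this average over the cluster into a
  bound at the vertex \<open>x\<close>. The resulting bound is an average over the endpoint of a
  walk of \<open>2 * s\<close> steps, so some possible endpoint does no worse.\<close>

lemma exists_decorrelated:
  obtains K where "0 \<le> K"
    and "\<And>p N s k \<rho> \<epsilon> x. 0 \<le> p \<Longrightarrow> p \<le> 1 \<Longrightarrow> 0 < k \<Longrightarrow> 0 \<le> \<rho> \<Longrightarrow> 0 \<le> \<epsilon> \<Longrightarrow> x \<in> reps \<Longrightarrow>
      (\<And>v. srw_prob adj (2 * (s * k)) v v \<le> \<epsilon>) \<Longrightarrow> N * \<epsilon> \<le> \<rho> ^ k \<Longrightarrow>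
      \<exists>v. (adj ^^ (2 * s)) x v \<and> EE p (conn_upto N x v) \<le> K * \<rho>"
proof
  define M where "M = (\<Sum>x\<in>reps. mu x)"
  define m where "m = Min (mu ` reps)"
  have m: "m > 0" unfolding m_def using finite_reps reps_nonempty mu_pos by (subst Min_gr_iff) auto
  have M: "M \<ge> 0" unfolding M_def using mu_pos by (intro sum_nonneg) (auto intro: less_imp_le)
  let ?K = "maxdeg * M / m"
  show "0 \<le> ?K" using m M by simp
  fix p \<rho> \<epsilon> :: real and N s k :: nat and x
  assume p: "0 \<le> p" "p \<le> 1" and k: "0 < k" and \<rho>: "0 \<le> \<rho>" "0 \<le> \<epsilon>" and x: "x \<in> reps"
    and \<epsilon>: "\<And>v. srw_prob adj (2 * (s * k)) v v \<le> \<epsilon>" "N * \<epsilon> \<le> \<rho> ^ k"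
  define h :: "'v \<Rightarrow> 'v set \<Rightarrow> 'v set set \<Rightarrow> real"
    where "h v C S = deg v * walk_into (2 * s) C v" for v C S
  define L where "L x = bexp p (bedges N x) (\<lambda>S. if card (cl S x) \<le> N then h x (cl S x) S else 0)" for x
  have L_nonneg: "0 \<le> L x" for x
    unfolding L_def h_def using p by (intro bexp_nonneg) (auto simp: walk_into_nonneg)
  have "(\<Sum>x\<in>reps. mu x * L x) = (\<Sum>x\<in>reps. mu x * bexp p (bedges N x)
            (\<lambda>S. if card (cl S x) \<le> N then (\<Sum>v\<in>cl S x. h v (cl S x) S) / card (cl S x) else 0))"
    unfolding L_def
    by (rule cluster_mass_transport[symmetric])
       (auto simp: h_def walk_into_def deg_aut sum.reindex inj_aut srw_prob_aut)
  also have "\<dots> \<le> (\<Sum>x\<in>reps. mu x * (maxdeg * \<rho>))"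
  proof (intro sum_mono mult_left_mono)
    fix x
    have "bexp p (bedges N x) (\<lambda>S. if card (cl S x) \<le> N then (\<Sum>v\<in>cl S x. h v (cl S x) S) / card (cl S x) else 0)
       \<le> bexp p (bedges N x) (\<lambda>S. maxdeg * \<rho>)"
    proof (rule bexp_mono[OF p])
      fix S assume "S \<subseteq> bedges N x"
      then have S: "finite S" using finite_subset[of S "bedges N x"] by auto
      have pos: "0 < card (cl S x)" using S by (rule card_cl_pos)
      show "(if card (cl S x) \<le> N then (\<Sum>v\<in>cl S x. h v (cl S x) S) / card (cl S x) else 0) \<le> maxdeg * \<rho>"
      proof (cases "card (cl S x) \<le> N")
        case True
        have "(\<Sum>v\<in>cl S x. h v (cl S x) S) = return_mass (2 * s) (cl S x)"
          by (simp add: h_def return_mass_def)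
        also have "\<dots> \<le> \<rho> * return_mass 0 (cl S x)"
        proof (rule return_mass_decay)
          have "card (cl S x) * \<epsilon> \<le> N * \<epsilon>" using True \<rho> by (intro mult_right_mono) auto
          then show "card (cl S x) * \<epsilon> \<le> \<rho> ^ k" using \<epsilon>(2) by simp
          show "finite (cl S x)" using S by simp
          show "cl S x \<noteq> {}" using cl_refl[of x S] by blast
        qed (rule k \<rho> \<epsilon>(1))+
        also have "\<dots> \<le> \<rho> * (maxdeg * card (cl S x))"
        proof (rule mult_left_mono)
          have "(\<Sum>w\<in>cl S x. real (deg w)) \<le> (\<Sum>w\<in>cl S x. real maxdeg)"
            by (intro sum_mono) (simp add: deg_le)
          then show "return_mass 0 (cl S x) \<le> maxdeg * card (cl S x)"
            using S by (simp add: return_mass_0 mult.commute)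
        qed (rule \<rho>)
        finally show ?thesis using pos True by (simp add: pos_divide_le_eq mult_ac)
      qed (use \<rho> in auto)
    qed
    then show "bexp p (bedges N x) (\<lambda>S. if card (cl S x) \<le> N then (\<Sum>v\<in>cl S x. h v (cl S x) S) / card (cl S x) else 0)
       \<le> maxdeg * \<rho>" by simp
  qed (use mu_pos in \<open>auto intro: less_imp_le\<close>)
  also have "\<dots> = M * (maxdeg * \<rho>)" by (simp add: M_def sum_distrib_right)
  finally have total: "(\<Sum>x\<in>reps. mu x * L x) \<le> M * (maxdeg * \<rho>)" .
  have "m * L x \<le> mu x * L x"
    using x finite_reps L_nonneg by (intro mult_right_mono) (auto simp: m_def)
  also have "\<dots> \<le> (\<Sum>x\<in>reps. mu x * L x)"
    using x finite_reps L_nonneg mu_pos by (intro member_le_sum) (auto intro!: mult_nonneg_nonneg less_imp_le[OF mu_pos])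
  also note total
  finally have "L x \<le> M * (maxdeg * \<rho>) / m"
    unfolding pos_le_divide_eq[OF m] by (simp only: mult.commute)
  then have Lx: "L x \<le> ?K * \<rho>" by (simp add: mult_ac)
  have sum_le: "(\<Sum>v\<in>ball (2 * s) x. srw_prob adj (2 * s) x v * EE p (conn_upto N x v)) \<le> L x"
  proof -
    have "(\<Sum>v\<in>ball (2 * s) x. srw_prob adj (2 * s) x v * EE p (conn_upto N x v))
        = bexp p (bedges N x) (\<lambda>S. \<Sum>v\<in>ball (2 * s) x. srw_prob adj (2 * s) x v * conn_upto N x v S)"
      by (simp add: bexp_sum bexp_cmult EE_eq[OF supp_conn_upto])
    also have "\<dots> \<le> L x"
      unfolding L_def
    proof (rule bexp_mono[OF p])
      fix S assume "S \<subseteq> bedges N x"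
      then have S: "finite S" using finite_subset[of S "bedges N x"] by auto
      show "(\<Sum>v\<in>ball (2 * s) x. srw_prob adj (2 * s) x v * conn_upto N x v S) \<le> (if card (cl S x) \<le> N then h x (cl S x) S else 0)"
      proof (cases "card (cl S x) \<le> N")
        case True
        have "(\<Sum>v\<in>ball (2 * s) x. srw_prob adj (2 * s) x v * conn_upto N x v S)
            = (\<Sum>v\<in>ball (2 * s) x \<inter> cl S x. srw_prob adj (2 * s) x v)"
          by (rule sum.mono_neutral_cong_right) (use True in \<open>auto simp: conn_upto_def\<close>)
        also have "\<dots> \<le> walk_into (2 * s) (cl S x) x"
          unfolding walk_into_def using S srw_prob_nonneg by (intro sum_mono2) auto
        also have "\<dots> \<le> h x (cl S x) S"
        proof -
          have "1 * walk_into (2 * s) (cl S x) x \<le> deg x * walk_into (2 * s) (cl S x) x"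
            using deg_pos[of x] walk_into_nonneg by (intro mult_right_mono) auto
          then show ?thesis by (simp add: h_def)
        qed
        finally show ?thesis using True by simp
      qed (simp add: conn_upto_def)
    qed
    finally show ?thesis .
  qed
  show "\<exists>v. (adj ^^ (2 * s)) x v \<and> EE p (conn_upto N x v) \<le> ?K * \<rho>"
  proof (rule ccontr)
    assume "\<not> ?thesis"
    then have big: "?K * \<rho> < EE p (conn_upto N x v)" if "srw_prob adj (2 * s) x v \<noteq> 0" for v
      using srw_prob_relpowp[OF that] by force
    have "(\<Sum>v\<in>ball (2 * s) x. srw_prob adj (2 * s) x v * (?K * \<rho>))
        < (\<Sum>v\<in>ball (2 * s) x. srw_prob adj (2 * s) x v * EE p (conn_upto N x v))"
    proof (rule sum_strict_mono_ex1)
      show "\<forall>v\<in>ball (2 * s) x. srw_prob adj (2 * s) x v * (?K * \<rho>) \<le> srw_prob adj (2 * s) x v * EE p (conn_upto N x v)"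
      proof
        fix v
        show "srw_prob adj (2 * s) x v * (?K * \<rho>) \<le> srw_prob adj (2 * s) x v * EE p (conn_upto N x v)"
        proof (cases "srw_prob adj (2 * s) x v = 0")
          case False
          then show ?thesis using big srw_prob_nonneg by (intro mult_left_mono) (auto intro: less_imp_le)
        qed simp
      qed
      obtain v where v: "v \<in> ball (2 * s) x" "srw_prob adj (2 * s) x v \<noteq> 0"
        using srw_prob_sum[of "2 * s" x] by (metis sum.neutral zero_neq_one)
      then have "0 < srw_prob adj (2 * s) x v" using srw_prob_nonneg[of "2 * s" x v] by simp
      then show "\<exists>v\<in>ball (2 * s) x. srw_prob adj (2 * s) x v * (?K * \<rho>) < srw_prob adj (2 * s) x v * EE p (conn_upto N x v)"
        using v big mult_strict_left_mono by blast
    qed simp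
    moreover have "(\<Sum>v\<in>ball (2 * s) x. srw_prob adj (2 * s) x v * (?K * \<rho>)) = ?K * \<rho>"
      unfolding sum_distrib_right[symmetric] srw_prob_sum by simp
    ultimately show False using sum_le Lx by linarith
  qed
qed


section \<open>Cluster tails\<close>

definition big :: "nat \<Rightarrow> 'v \<Rightarrow> 'v set set \<Rightarrow> real" where
  "big n v S = of_bool (n \<le> card (cl S v))"

definition theta :: "real \<Rightarrow> nat \<Rightarrow> 'v \<Rightarrow> real" where
  "theta p n v = EE p (big n v)"

definition tmax :: "real \<Rightarrow> nat \<Rightarrow> real" where
  "tmax p n = Max (theta p n ` reps)"

lemma supp_big: "supp (bedges n v) (big n v)"
proof (cases n)
  case 0
  then show ?thesis using bedges_subset by (simp add: supp_def big_def)
next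
  case (Suc m)
  have "bedges m v \<subseteq> bedges n v" using Suc by (intro bedges_mono) simp
  then have "card (cl (S \<inter> bedges n v) v) \<le> m \<longleftrightarrow> card (cl S v) \<le> m" if "finite S" "S \<subseteq> E" for S
    using cl_local(1) that by blast
  moreover have "big n v S = of_bool (\<not> card (cl S v) \<le> m)" for S by (auto simp: big_def Suc)
  ultimately show ?thesis using bedges_subset by (simp add: supp_def)
qed

lemma theta_eq: "finite B \<Longrightarrow> B \<subseteq> E \<Longrightarrow> bedges n v \<subseteq> B \<Longrightarrow> theta p n v = bexp p B (big n v)"
  unfolding theta_def by (intro EE_eq supp_mono[OF supp_big])

lemma theta_eq_bedges: "theta p n v = bexp p (bedges n v) (big n v)"
  by (rule theta_eq) (use bedges_subset in auto)

lemma theta_nonneg: "0 \<le> p \<Longrightarrow> p \<le> 1 \<Longrightarrow> 0 \<le> theta p n v"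
  unfolding theta_eq_bedges by (intro bexp_nonneg) (auto simp: big_def)

lemma theta_aut: "graph_aut adj g \<Longrightarrow> theta p n (g v) = theta p n v"
  unfolding theta_def by (rule EE_aut[OF _ supp_big]) (auto simp: big_def mem_cl_aut)

lemma theta_antimono:
  assumes "0 \<le> p" "p \<le> 1" "m \<le> n" shows "theta p n v \<le> theta p m v"
proof -
  have "theta p m v = bexp p (bedges n v) (big m v)"
    by (intro theta_eq bedges_mono assms) (use bedges_subset in auto)
  then show ?thesis
    unfolding theta_eq_bedges[of p n] using assms by (auto intro!: bexp_mono simp: big_def)
qed

lemma theta_le_tmax: "theta p n v \<le> tmax p n"
proof -
  obtain x g where x: "x \<in> reps" "graph_aut adj g" "v = g x" by (rule repE)
  then have "theta p n v = theta p n x" by (simp add: theta_aut)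
  also have "\<dots> \<le> tmax p n" unfolding tmax_def using x finite_reps by (intro Max_ge) auto
  finally show ?thesis .
qed

lemma tmax_attained: obtains x where "x \<in> reps" "tmax p n = theta p n x"
proof -
  have "tmax p n \<in> theta p n ` reps"
    unfolding tmax_def using finite_reps reps_nonempty by (intro Max_in) auto
  then show ?thesis using that by blast
qed

lemma tmax_nonneg: "0 \<le> p \<Longrightarrow> p \<le> 1 \<Longrightarrow> 0 \<le> tmax p n"
  using theta_nonneg theta_le_tmax order.trans by blast

lemma bexp_big_le_theta:
  assumes p: "0 \<le> p" "p \<le> 1" and F: "finite F" "F \<subseteq> E"
  shows "bexp p F (big n v) \<le> theta p n v"
proof -
  let ?G = "F \<union> bedges n v"
  have G: "finite ?G" "?G \<subseteq> E" using F bedges_subset by auto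
  have "bexp p F (big n v) = bexp p F (\<lambda>S. big n v (S \<inter> F))"
    by (intro bexp_cong) (simp add: Int_absorb2)
  also have "\<dots> = bexp p ?G (\<lambda>S. big n v (S \<inter> F))"
    by (rule bexp_restrict[symmetric]) (use G in auto)
  also have "\<dots> \<le> bexp p ?G (big n v)"
  proof (rule bexp_mono[OF p])
    fix S assume "S \<subseteq> ?G"
    then have "finite S" using G(1) finite_subset by blast
    then have "card (cl (S \<inter> F) v) \<le> card (cl S v)" by (intro card_mono cl_mono) auto
    then show "big n v (S \<inter> F) \<le> big n v S" by (auto simp: big_def)
  qed
  also have "\<dots> = theta p n v" using theta_eq[OF G] by simp
  finally show ?thesis .
qed

text \<open>Let each vertex be a ghost with probability \<open>1 - z = \<delta> / (M + 1)\<close>,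
  where clusters exceed \<open>M\<close> with probability at most \<open>\<delta>\<close>. Smaller
  ones avoid the ghosts with probability at least \<open>z ^ M \<ge> 1 - \<delta>\<close>, so every
  cluster does so with probability at least \<open>\<kappa> = (1 - \<delta>)\<^sup>2\<close>. The
  choice of \<open>\<delta>\<close> gives \<open>q \<le> p * \<kappa>\<close>. A cluster of size
  \<open>n\<close> avoids them with probability at most \<open>z ^ n\<close>, and the constant 4
  bounds \<open>1 / \<kappa>\<close>.\<close>

lemma exponential_decay:
  assumes q: "0 \<le> q" "q < p" "p \<le> 1" and lim: "\<And>v. (\<lambda>n. theta p n v) \<longlonglongrightarrow> 0"
  obtains z where "0 < z" "z < 1" "\<And>n. tmax q n \<le> 4 * z ^ n"
proof -
  have p: "0 \<le> p" "p \<le> 1" "0 < p" using q by auto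
  define r where "r = q / p"
  have r: "0 \<le> r" "r < 1" using q by (auto simp: r_def)
  define \<delta> where "\<delta> = (1 - r) / 2"
  have \<delta>: "0 < \<delta>" "\<delta> \<le> 1 / 2" using r by (auto simp: \<delta>_def)
  have "2 * \<delta> = 1 - r" unfolding \<delta>_def by simp
  then have "q / p = 1 - 2 * \<delta>" by (simp flip: r_def)
  also have "\<dots> \<le> (1 - \<delta>)\<^sup>2" by (simp add: power2_eq_square algebra_simps)
  finally have "q / p \<le> (1 - \<delta>)\<^sup>2" .
  then have qp2: "q \<le> p * (1 - \<delta>)\<^sup>2" using p by (simp add: field_simps)
  have "\<forall>\<^sub>F n in sequentially. \<forall>x\<in>reps. theta p n x < \<delta>"
    using finite_reps lim \<delta> by (intro eventually_ball_finite ballI order_tendstoD(2))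
  then obtain M where "\<forall>x\<in>reps. theta p M x < \<delta>" by (auto simp: eventually_sequentially)
  then have "tmax p M \<le> \<delta>" by (metis tmax_attained less_imp_le)
  then have M: "theta p (Suc M) v \<le> \<delta>" for v
    using theta_le_tmax[of p M v] theta_antimono[OF p(1,2), of M "Suc M" v] by simp
  define z where "z = 1 - \<delta> / (M + 1)"
  have "\<delta> / (M + 1) \<le> \<delta> / 1" using \<delta> by (intro divide_left_mono) auto
  then have z: "0 < z" "z < 1" using \<delta> by (auto simp: z_def)
  have "1 - \<delta> \<le> 1 + M * (- (\<delta> / (M + 1)))" using \<delta> by (simp add: field_simps)
  also have "\<dots> \<le> (1 + (- (\<delta> / (M + 1)))) ^ M"
    by (rule Bernoulli_inequality) (use z in \<open>auto simp: z_def\<close>)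
  finally have zM: "1 - \<delta> \<le> z ^ M" by (simp add: z_def)
  have ghost: "(1 - \<delta>)\<^sup>2 \<le> bexp p F (\<lambda>S. z ^ card (cl S y))" if F: "finite F" "F \<subseteq> E" for F y
  proof -
    have "(1 - \<delta>)\<^sup>2 \<le> z ^ M * (1 - bexp p F (big (Suc M) y))"
      unfolding power2_eq_square
      using zM M[of y] bexp_big_le_theta[OF p(1,2) F, of "Suc M" y] \<delta> z by (intro mult_mono) auto
    also have "\<dots> = bexp p F (\<lambda>S. z ^ M * (1 - big (Suc M) y S))"
      unfolding bexp_cmult bexp_diff using F by simp
    also have "\<dots> \<le> bexp p F (\<lambda>S. z ^ card (cl S y))"
      using z by (intro bexp_mono p) (auto simp: big_def not_le intro!: power_decreasing)
    finally show ?thesis .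
  qed
  have "theta q n v \<le> 4 * z ^ n" for n v
  proof -
    let ?B = "bedges n v"
    have B: "finite ?B" "?B \<subseteq> E" using bedges_subset by auto
    let ?Z = "bexp p ?B (\<lambda>S. z ^ card (clA S {v}))"
    have "bexp q ?B (\<lambda>S. of_bool (n \<le> card (clA S {v}))) * ?Z
       \<le> bexp p ?B (\<lambda>S. of_bool (n \<le> card (clA S {v})) * z ^ card (clA S {v}))"
    proof (rule ghost_comparison[OF B(1) p(1,2), where \<kappa> = "(1 - \<delta>)\<^sup>2"])
      show "(1 - \<delta>)\<^sup>2 \<le> bexp p F (\<lambda>S. z ^ card (cl S y))" if "F \<subseteq> ?B" for F y
        using ghost that B finite_subset[OF that] by blast
    qed (use q z qp2 in auto)
    also have "\<dots> \<le> bexp p ?B (\<lambda>S. z ^ n)"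
      using z by (intro bexp_mono p) (auto intro: power_decreasing)
    also have "\<dots> = z ^ n" by simp
    finally have "theta q n v * ?Z \<le> z ^ n"
      unfolding theta_eq_bedges big_def by simp
    moreover have "theta q n v * (1 / 4) \<le> theta q n v * ?Z"
    proof (rule mult_left_mono)
      have "(1 / 2 :: real)\<^sup>2 \<le> (1 - \<delta>)\<^sup>2" using \<delta> by (intro power_mono) auto
      then show "1 / 4 \<le> ?Z" using ghost[OF B, of v] by (simp add: power2_eq_square)
    qed (use q theta_nonneg in auto)
    ultimately show ?thesis by simp
  qed
  then have "tmax q n \<le> 4 * z ^ n" for n by (metis tmax_attained)
  then show ?thesis using that z by blast
qed

section \<open>Distinct large clusters along a path\<close>

definition separated :: "nat \<Rightarrow> nat \<Rightarrow> 'v list \<Rightarrow> 'v set set \<Rightarrow> real" where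
  "separated n N xs S = of_bool (last xs \<notin> cl S (hd xs) \<and> n \<le> card (cl S (hd xs)) \<and>
     n \<le> card (cl S (last xs)) \<and> (\<forall>x\<in>set xs. card (cl S x) \<le> N))"

lemma separated_nonneg [simp]: "0 \<le> separated n N xs S"
  by (simp add: separated_def)

lemma two_clusters_nonneg [simp]: "0 \<le> two_clusters n N x y S"
  by (simp add: two_clusters_def)

text \<open>If the next vertex of the path lies in a small cluster, then opening the first edge attaches that
  cluster to the large cluster of the first vertex.\<close>
lemma separated_step:
  assumes S: "finite S" and ys: "ys \<noteq> []"
  shows "separated n N (x # y # ys) S \<le> two_clusters n N x y S + separated n N (y # ys) S
     + separated n (N + n) (y # ys) (insert {x, y} S)"
proof (cases "separated n N (x # y # ys) S = 0")
  case True
  then show ?thesis by simp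
next
  case False
  let ?l = "last ys" and ?S = "insert {x, y} S"
  have sep: "?l \<notin> cl S x" "n \<le> card (cl S x)" "n \<le> card (cl S ?l)"
    and le: "\<And>z. z \<in> insert x (insert y (set ys)) \<Longrightarrow> card (cl S z) \<le> N"
    using False ys by (auto simp: separated_def)
  consider "n \<le> card (cl S y)" "?l \<in> cl S y" | "n \<le> card (cl S y)" "?l \<notin> cl S y" | "card (cl S y) < n"
    by linarith
  then show ?thesis
  proof cases
    case 1
    have "y \<notin> cl S x" using 1 sep(1) cl_trans by metis
    moreover from this have "{x, y} \<notin> S" using cl_step[OF cl_refl] by metis
    ultimately have "two_clusters n N x y S = 1" using 1 sep le by (simp add: two_clusters_def)
    moreover have "separated n N (x # y # ys) S \<le> 1" by (simp add: separated_def)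
    ultimately show ?thesis by (simp add: add_increasing add_increasing2)
  next
    case 2
    then have "separated n N (y # ys) S = 1" using sep le ys by (simp add: separated_def)
    moreover have "separated n N (x # y # ys) S \<le> 1" by (simp add: separated_def)
    ultimately show ?thesis by (simp add: add_increasing add_increasing2)
  next
    case 3
    have ly: "?l \<notin> cl S y" using 3 sep(3) cl_eq by (metis not_less)
    have l: "cl ?S ?l = cl S ?l" by (rule cl_insert_edge_other[OF sep(1) ly])
    have xy: "cl ?S x = cl S x \<union> cl S y" "cl ?S y = cl S x \<union> cl S y"
      using cl_insert_edge[of x y S] cl_insert_edge[of y x S] by (auto simp: insert_commute)
    have union: "card (cl S x \<union> cl S y) \<le> N + n"
      using card_Un_le[of "cl S x" "cl S y"] 3 le[of x] by simp
    have "card (cl ?S z) \<le> N + n" if z: "z \<in> insert y (set ys)" for z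
    proof (cases "z \<in> cl S x \<or> z \<in> cl S y")
      case True
      then have "z \<in> cl ?S x" using xy by blast
      then have "cl ?S z = cl ?S x" by (rule cl_eq)
      then show ?thesis using union xy by simp
    next
      case False
      then have "cl ?S z = cl S z" using cl_insert_edge_other by metis
      then show ?thesis using le[of z] z by simp
    qed
    moreover have "n \<le> card (cl S x \<union> cl S y)"
      using sep(2) card_mono[of "cl S x \<union> cl S y" "cl S x"] S by simp
    ultimately have "separated n (N + n) (y # ys) ?S = 1"
      using sep ly ys by (simp add: separated_def l xy)
    moreover have "separated n N (x # y # ys) S \<le> 1" by (simp add: separated_def)
    ultimately show ?thesis by (simp add: add_increasing add_increasing2)
  qed
qed

text \<open>Each application of \<open>separated_step\<close> produces one two-cluster term and two
  copies of the event for the shorter path, one of which costs \<open>1 / p\<close> for the opened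
  edge; hence the factor \<open>2 + 1 / p\<close> per vertex. An opening may raise the cut-off by
  \<open>n\<close>, which explains the range allowed for \<open>N'\<close>.\<close>

lemma separated_bound:
  assumes p: "0 < p" "p \<le> 1" and F: "finite F" "F \<subseteq> E" and \<sigma>: "0 \<le> \<sigma>"
    and "xs \<noteq> []" "successively adj xs" "\<And>x y. x \<in> set xs \<Longrightarrow> y \<in> set xs \<Longrightarrow> adj x y \<Longrightarrow> {x, y} \<in> F"
    and "\<And>x y N'. x \<in> set xs \<Longrightarrow> y \<in> set xs \<Longrightarrow> adj x y \<Longrightarrow> N' \<le> N + length xs * n \<Longrightarrow>
           bexp p F (two_clusters n N' x y) \<le> \<sigma>"
  shows "bexp p F (separated n N xs) \<le> \<sigma> * (2 + 1 / p) ^ length xs"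
  using assms(6-)
proof (induction xs arbitrary: N rule: induct_list012)
  case (2 x)
  have "separated n N [x] = (\<lambda>S. 0)" by (auto simp: separated_def fun_eq_iff)
  then show ?case using \<sigma> p by simp
next
  case (3 x y ys)
  let ?A = "2 + 1 / p"
  have A: "1 \<le> ?A" using p by simp
  have xy: "adj x y" using 3 by simp
  have e: "{x, y} \<in> F" using 3(5)[of x y] xy by simp
  have IH: "bexp p F (separated n N' (y # ys)) \<le> \<sigma> * ?A ^ length (y # ys)" if "N' \<le> N + n" for N'
  proof (rule "3.IH"(2))
    fix u v N'' assume "u \<in> set (y # ys)" "v \<in> set (y # ys)" "adj u v" "N'' \<le> N' + length (y # ys) * n"
    then show "bexp p F (two_clusters n N'' u v) \<le> \<sigma>" using that by (intro 3(6)) auto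
  qed (use 3 in auto)
  show ?case
  proof (cases "ys = []")
    \<comment> \<open>With one edge left, the separated clusters already meet at it.\<close>
    case True
    have "bexp p F (separated n N [x, y]) \<le> bexp p F (two_clusters n N x y)"
    proof (rule bexp_mono)
      fix S assume "S \<subseteq> F"
      show "separated n N [x, y] S \<le> two_clusters n N x y S"
        using cl_step[OF cl_refl, of x y S] by (auto simp: separated_def two_clusters_def)
    qed (use p in auto)
    also have "\<dots> \<le> \<sigma>" using xy by (intro 3(6)) auto
    also have "\<dots> \<le> \<sigma> * ?A ^ length [x, y]"
      using mult_left_mono[OF one_le_power[OF A] \<sigma>, of "length [x, y]"] by (simp only: mult_1_right)
    finally show ?thesis using True by simp
  next
    case False
    let ?g = "separated n (N + n) (y # ys)"
    let ?L = "\<sigma> * ?A ^ length (y # ys)"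
    have "p * bexp p F (\<lambda>S. ?g (insert {x, y} S)) \<le> bexp p F ?g"
      by (rule bexp_insert_tolerance[OF F(1) e p]) (auto simp: separated_def)
    also have "\<dots> \<le> ?L" by (rule IH) simp
    finally have ins: "bexp p F (\<lambda>S. ?g (insert {x, y} S)) \<le> ?L / p"
      using p by (simp add: pos_le_divide_eq mult.commute)
    have "bexp p F (separated n N (x # y # ys)) \<le> bexp p F (\<lambda>S. two_clusters n N x y S
        + separated n N (y # ys) S + ?g (insert {x, y} S))"
    proof (rule bexp_mono)
      fix S assume "S \<subseteq> F"
      then have "finite S" using F(1) finite_subset by blast
      then show "separated n N (x # y # ys) S \<le> two_clusters n N x y S + separated n N (y # ys) S
          + ?g (insert {x, y} S)" by (rule separated_step[OF _ False])
    qed (use p in auto)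
    also have "\<dots> = bexp p F (two_clusters n N x y) + bexp p F (separated n N (y # ys))
        + bexp p F (\<lambda>S. ?g (insert {x, y} S))" by (simp add: bexp_add)
    also have "\<dots> \<le> \<sigma> + ?L + ?L / p"
      using ins xy by (intro add_mono IH 3(6)) auto
    also have "\<dots> \<le> ?L + ?L + ?L / p"
      using mult_left_mono[OF one_le_power[OF A] \<sigma>, of "length (y # ys)"] by simp
    also have "\<dots> = ?L * ?A" by (simp add: algebra_simps)
    finally show ?thesis by (simp add: mult_ac)
  qed
qed simp

lemma relpowp_path: "(adj ^^ r) x v \<Longrightarrow> \<exists>xs. length xs = Suc r \<and> hd xs = x \<and> last xs = v \<and> successively adj xs"
proof (induction r arbitrary: x)
  case 0
  then show ?case by (intro exI[of _ "[x]"]) auto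
next
  case (Suc r)
  then obtain y where y: "adj x y" "(adj ^^ r) y v" by (meson relpowp_Suc_E2)
  then obtain xs where xs: "length xs = Suc r" "hd xs = y" "last xs = v" "successively adj xs"
    using Suc.IH by blast
  then show ?case using y by (intro exI[of _ "x # xs"]) (cases xs, auto)
qed

lemma theta_adj:
  assumes p: "0 < p" "p \<le> 1" and xy: "adj x y"
  shows "p * theta p n y \<le> theta p n x"
proof -
  define B where "B = insert {x, y} (bedges n x \<union> bedges n y)"
  have B: "finite B" "B \<subseteq> E" "bedges n x \<subseteq> B" "bedges n y \<subseteq> B" "{x, y} \<in> B"
    using bedges_subset xy by (auto simp: B_def)
  have "p * bexp p B (big n y) \<le> bexp p B (big n x)"
  proof (rule bexp_insert_tolerance[OF B(1,5) p])
    fix S assume "S \<subseteq> B"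
    then have "finite S" using B(1) finite_subset by blast
    then have "card (cl S y) \<le> card (cl (insert {x, y} S) x)"
      unfolding cl_insert_edge by (intro card_mono) auto
    then show "big n y S \<le> big n x (insert {x, y} S)" by (auto simp: big_def)
  qed (simp add: big_def)
  then show ?thesis using B by (simp add: theta_eq)
qed

text \<open>Opening a path between two vertices costs \<open>p\<close> per edge, and finitely many
  pairs of representatives suffice. So \<open>D\<close> depends on neither \<open>p\<close> nor
  \<open>n\<close>.\<close>

lemma theta_comparable:
  obtains D where "\<And>p n u. 0 < p \<Longrightarrow> p \<le> 1 \<Longrightarrow> p ^ D * tmax p n \<le> theta p n u"
proof -
  have step: "p ^ d * theta p n y \<le> theta p n x" if p: "0 < p" "p \<le> 1" and "(adj ^^ d) x y" for p d n x y
    using that(3)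
  proof (induction d arbitrary: y)
    case (Suc d)
    then obtain w where w: "(adj ^^ d) x w" "adj w y" by (meson relpowp_Suc_E)
    have "p ^ Suc d * theta p n y = p ^ d * (p * theta p n y)" by simp
    also have "\<dots> \<le> p ^ d * theta p n w" using theta_adj[OF p w(2)] p by (intro mult_left_mono) auto
    also have "\<dots> \<le> theta p n x" by (rule Suc.IH[OF w(1)])
    finally show ?case .
  qed simp
  have "\<forall>x y. \<exists>k. y \<in> ball k x" using in_some_ball by blast
  then obtain r where r: "\<And>x y. y \<in> ball (r x y) x" by metis
  define D where "D = Max (case_prod r ` (reps \<times> reps))"
  show ?thesis
  proof
    fix p :: real and n u assume p: "0 < p" "p \<le> 1"
    obtain x g where x: "x \<in> reps" "graph_aut adj g" "u = g x" by (rule repE)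
    obtain y where y: "y \<in> reps" "tmax p n = theta p n y" by (rule tmax_attained)
    obtain d where d: "d \<le> r x y" "(adj ^^ d) x y" using r[of y x] by (auto simp: ball_def)
    have "r x y \<le> D" unfolding D_def using x y finite_reps by (intro Max_ge) force+
    then have "p ^ D \<le> p ^ d" using d p by (intro power_decreasing) auto
    then have "p ^ D * tmax p n \<le> p ^ d * tmax p n"
      using p tmax_nonneg by (intro mult_right_mono) auto
    also have "\<dots> \<le> theta p n x" using step[OF p d(2)] y by simp
    finally show "p ^ D * tmax p n \<le> theta p n u" using x by (simp add: theta_aut)
  qed
qed

lemma key_inequality:
  obtains D :: nat and K :: real where "0 \<le> K"
    and "\<And>p n N s k \<rho> \<epsilon>. 0 < p \<Longrightarrow> p \<le> 1 \<Longrightarrow> 0 < n \<Longrightarrow> 0 < k \<Longrightarrow> 0 \<le> \<rho> \<Longrightarrow> 0 \<le> \<epsilon> \<Longrightarrow>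
      (\<And>v. srw_prob adj (2 * (s * k)) v v \<le> \<epsilon>) \<Longrightarrow> real N * \<epsilon> \<le> \<rho> ^ k \<Longrightarrow>
      (p ^ D * tmax p n)\<^sup>2 \<le> K * \<rho> + real (2 * s + 1) * tmax p (Suc N)
         + K / (p * sqrt (real n)) * (2 + 1 / p) ^ (2 * s + 1)"
proof -
  obtain D where D: "\<And>p n u. 0 < p \<Longrightarrow> p \<le> 1 \<Longrightarrow> p ^ D * tmax p n \<le> theta p n u"
    by (rule theta_comparable) blast
  obtain K1 where K1: "0 \<le> K1" "\<And>p n N x w. 0 \<le> p \<Longrightarrow> p \<le> 1 \<Longrightarrow> 0 < n \<Longrightarrow> adj x w \<Longrightarrow>
      p * EE p (two_clusters n N x w) \<le> K1 / sqrt (real n)"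
    by (rule two_clusters_bound) blast
  obtain K2 where K2: "0 \<le> K2"
    "\<And>p N s k \<rho> \<epsilon> x. 0 \<le> p \<Longrightarrow> p \<le> 1 \<Longrightarrow> 0 < k \<Longrightarrow> 0 \<le> \<rho> \<Longrightarrow> 0 \<le> \<epsilon> \<Longrightarrow> x \<in> reps \<Longrightarrow>
      (\<And>v. srw_prob adj (2 * (s * k)) v v \<le> \<epsilon>) \<Longrightarrow> N * \<epsilon> \<le> \<rho> ^ k \<Longrightarrow>
      \<exists>v. (adj ^^ (2 * s)) x v \<and> EE p (conn_upto N x v) \<le> K2 * \<rho>"
    by (rule exists_decorrelated) blast
  define K where "K = max K1 K2"
  show ?thesis
  proof
    show "0 \<le> K" using K1 by (simp add: K_def)
    fix p \<rho> \<epsilon> :: real and n N s k :: nat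
    assume p: "0 < p" "p \<le> 1" and n: "0 < n" and k: "0 < k" and \<rho>: "0 \<le> \<rho>" "0 \<le> \<epsilon>"
      and \<epsilon>: "\<And>v. srw_prob adj (2 * (s * k)) v v \<le> \<epsilon>" "real N * \<epsilon> \<le> \<rho> ^ k"
    obtain x where x: "x \<in> reps" using reps_nonempty by blast
    obtain v where v: "(adj ^^ (2 * s)) x v" "EE p (conn_upto N x v) \<le> K2 * \<rho>"
      using K2(2)[of p k \<rho> \<epsilon> x s N] p k \<rho> x \<epsilon> by auto
    obtain xs where xs: "length xs = Suc (2 * s)" "hd xs = x" "last xs = v" "successively adj xs"
      using relpowp_path[OF v(1)] by blast
    have xs_ne: "xs \<noteq> []" using xs by auto
    have mem: "x \<in> set xs" "v \<in> set xs" using xs xs_ne by auto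
    \<comment> \<open>One radius for all cut-offs in play: \<open>n\<close>, \<open>Suc N\<close>,
      and those up to \<open>N + length xs * n\<close> created by opening edges.\<close>
    define R where "R = Suc (N + length xs * n)"
    define F where "F = (\<Union>z\<in>set xs. bedges R z)"
    have F: "finite F" "F \<subseteq> E" using bedges_subset by (auto simp: F_def)
    have bF: "bedges m z \<subseteq> F" if "z \<in> set xs" "m \<le> R" for m z
      using that bedges_mono[of m R z] by (auto simp: F_def)
    have nR: "n \<le> R" "N \<le> R" "Suc N \<le> R" using xs by (auto simp: R_def)
    let ?\<sigma> = "K1 / (p * sqrt (real n))"
    have sep: "bexp p F (separated n N xs) \<le> ?\<sigma> * (2 + 1 / p) ^ length xs"
    proof (rule separated_bound[OF p F])
      show "0 \<le> ?\<sigma>" using p K1 by simp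
      fix y z assume yz: "y \<in> set xs" "z \<in> set xs" "adj y z"
      have "{y, z} \<in> bedges 0 y" using yz by (auto simp: bedges_def touching_def)
      then show "{y, z} \<in> F" using bF[OF yz(1), of 0] by auto
      fix N' assume "N' \<le> N + length xs * n"
      then have "N' \<le> R" by (simp add: R_def)
      then have "EE p (two_clusters n N' y z) = bexp p F (two_clusters n N' y z)"
        using yz bF F by (intro EE_eq supp_two_clusters)
      then have "p * bexp p F (two_clusters n N' y z) \<le> K1 / sqrt n"
        using K1(2)[of p n y z N'] p n yz by simp
      then have "bexp p F (two_clusters n N' y z) \<le> K1 / sqrt n / p"
        unfolding pos_le_divide_eq[OF p(1)] by (simp only: mult.commute)
      then show "bexp p F (two_clusters n N' y z) \<le> ?\<sigma>"
        by (simp add: mult.commute)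
    qed (use xs xs_ne in auto)
    have "(p ^ D * tmax p n)\<^sup>2 \<le> theta p n x * theta p n v"
      unfolding power2_eq_square using D[OF p] p tmax_nonneg theta_nonneg by (intro mult_mono) auto
    also have "\<dots> = bexp p F (big n x) * bexp p F (big n v)"
      using theta_eq[OF F bF] mem nR by simp
    also have "\<dots> \<le> bexp p F (\<lambda>S. big n x S * big n v S)"
    proof (rule harris)
      fix S T assume ST: "S \<subseteq> T" "T \<subseteq> F"
      then have "finite T" using F(1) finite_subset by blast
      then have "card (cl S z) \<le> card (cl T z)" for z using ST by (intro card_mono cl_mono) auto
      then show "big n x S \<le> big n x T" "big n v S \<le> big n v T"
        by (auto simp: big_def intro: order.trans)
    qed (use F p in auto)
    also have "\<dots> \<le> bexp p F (\<lambda>S. conn_upto N x v S + (\<Sum>z\<in>set xs. big (Suc N) z S) + separated n N xs S)"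
    proof (rule bexp_mono)
      fix S
      show "big n x S * big n v S \<le> conn_upto N x v S + (\<Sum>z\<in>set xs. big (Suc N) z S) + separated n N xs S"
      proof (cases "\<exists>z\<in>set xs. N < card (cl S z)")
        case True
        then obtain z where z: "z \<in> set xs" "N < card (cl S z)" by blast
        have "big (Suc N) z S \<le> (\<Sum>z\<in>set xs. big (Suc N) z S)"
          using z by (intro member_le_sum) (auto simp: big_def)
        moreover have "big (Suc N) z S = 1" using z by (simp add: big_def)
        moreover have "big n x S * big n v S \<le> 1" "0 \<le> conn_upto N x v S" "0 \<le> separated n N xs S"
          by (auto simp: big_def conn_upto_def separated_def)
        ultimately show ?thesis by linarith
      next
        case False
        have "0 \<le> (\<Sum>z\<in>set xs. big (Suc N) z S)" by (intro sum_nonneg) (simp add: big_def)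
        moreover have "big n x S * big n v S \<le> conn_upto N x v S + separated n N xs S"
          using False mem xs by (auto simp: big_def conn_upto_def separated_def not_less)
        ultimately show ?thesis by simp
      qed
    qed (use p in auto)
    also have "\<dots> = EE p (conn_upto N x v) + (\<Sum>z\<in>set xs. theta p (Suc N) z) + bexp p F (separated n N xs)"
    proof -
      have "EE p (conn_upto N x v) = bexp p F (conn_upto N x v)"
        by (intro EE_eq supp_mono[OF supp_conn_upto] bF F mem nR)
      moreover have "(\<Sum>z\<in>set xs. theta p (Suc N) z) = (\<Sum>z\<in>set xs. bexp p F (big (Suc N) z))"
        by (intro sum.cong refl theta_eq F bF nR)
      ultimately show ?thesis by (simp add: bexp_add bexp_sum)
    qed
    also have "\<dots> \<le> K * \<rho> + real (2 * s + 1) * tmax p (Suc N) + K / (p * sqrt (real n)) * (2 + 1 / p) ^ (2 * s + 1)"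
    proof (intro add_mono)
      have "K2 * \<rho> \<le> K * \<rho>" using \<rho> by (intro mult_right_mono) (auto simp: K_def)
      then show "EE p (conn_upto N x v) \<le> K * \<rho>" using v(2) by simp
      have "(\<Sum>z\<in>set xs. theta p (Suc N) z) \<le> (\<Sum>z\<in>set xs. tmax p (Suc N))"
        by (intro sum_mono theta_le_tmax)
      also have "\<dots> \<le> real (2 * s + 1) * tmax p (Suc N)"
      proof -
        have "card (set xs) \<le> 2 * s + 1" using card_length[of xs] xs by simp
        then have "real (card (set xs)) \<le> real (2 * s + 1)" by (rule of_nat_mono)
        then show ?thesis using tmax_nonneg[of p "Suc N"] p by (simp add: mult_right_mono)
      qed
      finally show "(\<Sum>z\<in>set xs. theta p (Suc N) z) \<le> real (2 * s + 1) * tmax p (Suc N)" .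
      have "?\<sigma> * (2 + 1 / p) ^ length xs \<le> K / (p * sqrt (real n)) * (2 + 1 / p) ^ (2 * s + 1)"
        using xs p by (intro mult_mono divide_right_mono) (auto simp: K_def K1(1) le_max_iff_disj intro!: divide_nonneg_nonneg)
      then show "bexp p F (separated n N xs) \<le> K / (p * sqrt (real n)) * (2 + 1 / p) ^ (2 * s + 1)"
        using sep by simp
    qed
    finally show "(p ^ D * tmax p n)\<^sup>2 \<le> K * \<rho> + real (2 * s + 1) * tmax p (Suc N)
         + K / (p * sqrt (real n)) * (2 + 1 / p) ^ (2 * s + 1)" .
  qed
qed

end

section \<open>Propagation across scales\<close>

lemma square_le_power_two: "4 \<le> m \<Longrightarrow> m\<^sup>2 \<le> (2::nat) ^ m"
proof (induction m rule: dec_induct)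
  case (step m)
  have "(Suc m)\<^sup>2 = m\<^sup>2 + (2 * m + 1)" by (simp add: power2_eq_square)
  also have "\<dots> \<le> m\<^sup>2 + m\<^sup>2" unfolding power2_eq_square using step.hyps(1) mult_le_mono1[OF step.hyps(1), of m] by linarith
  also have "\<dots> \<le> 2 ^ Suc m" using step.IH by simp
  finally show ?case .
qed simp

text \<open>Since \<open>A ^ m \<ge> m * m\<close>, the power is at most \<open>(z ^ m) ^ m\<close>,
  which is below \<open>exp (- 2 * m)\<close> once \<open>z ^ m < exp (- 2)\<close>. The spare
  factor \<open>exp (- m)\<close> absorbs the 4.\<close>

lemma double_exp_decay:
  fixes z :: real
  assumes z: "0 < z" "z < 1" and A: "2 \<le> A"
  shows "\<forall>\<^sub>F m in sequentially. 4 * z ^ (A ^ m) \<le> exp (- real m)"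
proof -
  have "(\<lambda>m. z ^ m) \<longlonglongrightarrow> 0" using z by (intro LIMSEQ_power_zero) auto
  then have "\<forall>\<^sub>F m in sequentially. z ^ m < exp (- 2)" by (rule order_tendstoD) simp
  then show ?thesis
    using eventually_ge_at_top[of 4]
  proof eventually_elim
    case (elim m)
    have "m * m \<le> 2 ^ m" using square_le_power_two[OF elim(2)] by (simp add: power2_eq_square)
    also have "\<dots> \<le> A ^ m" using A by (rule power_mono) simp
    finally have "z ^ (A ^ m) \<le> z ^ (m * m)" using z by (intro power_decreasing) auto
    also have "\<dots> = (z ^ m) ^ m" by (rule power_mult)
    also have "\<dots> \<le> exp (- 2) ^ m" using elim z by (intro power_mono) auto
    also have "\<dots> = exp (- real m) * exp (- real m)"
      by (simp add: exp_of_nat_mult[symmetric] exp_add[symmetric])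
    finally have "4 * z ^ (A ^ m) \<le> 4 * exp (- real m) * exp (- real m)" by simp
    moreover have "4 * exp (- real m) \<le> 1"
    proof -
      have "4 \<le> exp (real m)" using exp_ge_add_one_self[of "real m"] elim(2) by linarith
      then show ?thesis by (simp add: exp_minus field_simps)
    qed
    then have "4 * exp (- real m) * exp (- real m) \<le> 1 * exp (- real m)"
      by (intro mult_right_mono) auto
    ultimately show ?case by linarith
  qed
qed

context perc_graph
begin

text \<open>Capping the exponent at 1 ensures that \<open>1 / \<gamma> - 1\<close>, the growth
  exponent of \<open>k\<close>, is nonnegative.\<close>

lemma HK_min:
  assumes "HK adj \<gamma> c" "0 < c" shows "HK adj (min \<gamma> 1) c"
  unfolding HK_def
proof (intro allI impI)
  fix v :: 'v and n :: nat assume n: "1 \<le> n"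
  have "srw_prob adj n v v \<le> exp (- c * real n powr \<gamma>)" using assms n by (simp add: HK_def)
  also have "\<dots> \<le> exp (- c * real n powr min \<gamma> 1)"
    using n assms by (auto intro!: mult_left_mono powr_mono)
  finally show "srw_prob adj n v v \<le> exp (- c * real n powr min \<gamma> 1)" .
qed

text \<open>The parameters of \<open>key_inequality\<close> become functions of \<open>m\<close>:
  \<open>s = m\<close>, \<open>n = A ^ m\<close> and \<open>Suc N = A ^ (B * m)\<close>. The
  constants see \<open>p\<close> only through its lower bound \<open>p0\<close>.\<close>

lemma scale_inequality:
  assumes HK: "HK adj \<gamma> c" and c: "0 < c" and \<gamma>: "1 / 2 < \<gamma>" "\<gamma> \<le> 1" and p0: "0 < p0" "p0 \<le> 1"
    and \<eta>: "\<eta> = 2 - 1 / \<gamma>" and B: "0 < B"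
  obtains A :: nat and a C1 :: real where "2 \<le> A" "0 < a" "a \<le> 1" "1 \<le> C1"
    and "\<And>p m. p0 \<le> p \<Longrightarrow> p \<le> 1 \<Longrightarrow> 1 \<le> m \<Longrightarrow>
      (tmax p (A ^ m))\<^sup>2 \<le> C1 * (exp (- a * real m powr \<eta>) + real (2 * m + 1) * tmax p (A ^ (B * m)))"
proof -
  obtain D :: nat and K :: real where K: "0 \<le> K"
    and key: "\<And>p n N s k \<rho> \<epsilon>. 0 < p \<Longrightarrow> p \<le> 1 \<Longrightarrow> 0 < n \<Longrightarrow> 0 < k \<Longrightarrow> 0 \<le> \<rho> \<Longrightarrow> 0 \<le> \<epsilon> \<Longrightarrow>
      (\<And>v. srw_prob adj (2 * (s * k)) v v \<le> \<epsilon>) \<Longrightarrow> real N * \<epsilon> \<le> \<rho> ^ k \<Longrightarrow>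
      (p ^ D * tmax p n)\<^sup>2 \<le> K * \<rho> + real (2 * s + 1) * tmax p (Suc N)
         + K / (p * sqrt (real n)) * (2 + 1 / p) ^ (2 * s + 1)"
    by (rule key_inequality) blast
  define b where "b = 2 + 1 / p0"
  have b: "2 \<le> b" using p0 by (simp add: b_def)
  \<comment> \<open>Then \<open>1 / sqrt (A ^ m)\<close> beats the opening cost
    \<open>b ^ (2 * m)\<close> with a factor \<open>exp (- m)\<close> to spare.\<close>
  obtain A0 :: nat where "(exp 1 * b\<^sup>2)\<^sup>2 \<le> A0" using real_arch_simple by blast
  define A where "A = max A0 2"
  have A: "2 \<le> A" "(exp 1 * b\<^sup>2)\<^sup>2 \<le> real A" using \<open>_ \<le> real A0\<close> by (auto simp: A_def)
  have sqrtA: "exp 1 * b\<^sup>2 \<le> sqrt A" using A(2) b by (intro real_le_rsqrt)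
  \<comment> \<open>The factor \<open>exp (- L * m)\<close> beats
    \<open>N \<le> exp (B * ln A * m)\<close> and leaves \<open>exp (- m)\<close>.\<close>
  define L where "L = 1 + B * ln A"
  have L: "1 \<le> L" using A by (simp add: L_def)
  \<comment> \<open>With \<open>k \<ge> H * m powr \<alpha>\<close> the time \<open>m * k\<close> is
    at least \<open>H * m powr (1 / \<gamma>)\<close>, where the exponent in \<open>HK\<close>
    reaches \<open>L * m\<close>.\<close>
  define H where "H = (L / c) powr (1 / \<gamma>)"
  have H: "0 < H" "c * H powr \<gamma> = L" using L c \<gamma> by (auto simp: H_def powr_powr)
  define \<alpha> where "\<alpha> = 1 / \<gamma> - 1"
  have \<alpha>: "0 \<le> \<alpha>" "\<eta> = 1 - \<alpha>" "(1 + \<alpha>) * \<gamma> = 1" using \<gamma> \<eta> by (auto simp: \<alpha>_def field_simps)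
  have \<eta>1: "\<eta> \<le> 1" using \<alpha> by simp
  \<comment> \<open>The \<open>+ 1\<close> pays for rounding up:
    \<open>k \<le> (H + 1) * m powr \<alpha>\<close>, so \<open>m / k\<close> is at least
    \<open>a * m powr \<eta>\<close>.\<close>
  define a where "a = 1 / (H + 1)"
  have a: "0 < a" "a \<le> 1" using H by (auto simp: a_def field_simps)
  define C3 where "C3 = K * b / p0"
  have C3: "0 \<le> C3" using K b p0 by (simp add: C3_def)
  define C1 where "C1 = (K + C3 + 1) / (p0 ^ D)\<^sup>2"
  have pD: "0 < (p0 ^ D)\<^sup>2" "(p0 ^ D)\<^sup>2 \<le> 1"
    using p0 by (auto intro!: power_le_one)
  have C1: "1 \<le> C1"
    unfolding C1_def pos_le_divide_eq[OF pD(1)] using pD K C3 by linarith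
  show ?thesis
  proof (rule that[OF A(1) a C1])
    fix p :: real and m :: nat assume p: "p0 \<le> p" "p \<le> 1" and m: "1 \<le> m"
    have pp: "0 < p" using p p0 by simp
    let ?m = "real m"
    define k where "k = nat \<lceil>H * ?m powr \<alpha>\<rceil>"
    have "0 < H * ?m powr \<alpha>" using H m by simp
    then have k: "0 < k" "H * ?m powr \<alpha> \<le> real k" "real k \<le> H * ?m powr \<alpha> + 1"
      unfolding k_def by (auto intro: real_nat_ceiling_ge)
    have "1 \<le> ?m powr \<alpha>" using m \<alpha> by (intro ge_one_powr_ge_zero) auto
    then have k2: "real k \<le> (H + 1) * ?m powr \<alpha>" using k by (simp add: algebra_simps)
    define \<epsilon> where "\<epsilon> = exp (- c * real (2 * (m * k)) powr \<gamma>)"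
    \<comment> \<open>Chosen so that \<open>\<rho> ^ k = exp (- m)\<close>, which is what
      \<open>N * \<epsilon>\<close> is bounded by.\<close>
    define \<rho> where "\<rho> = exp (- ?m / real k)"
    define N where "N = A ^ (B * m) - 1"
    have N: "Suc N = A ^ (B * m)" using A by (simp add: N_def)
    have main: "(p ^ D * tmax p (A ^ m))\<^sup>2 \<le> K * \<rho> + real (2 * m + 1) * tmax p (Suc N)
         + K / (p * sqrt (real (A ^ m))) * (2 + 1 / p) ^ (2 * m + 1)"
    proof (rule key[OF pp p(2) _ k(1)])
      show "0 < A ^ m" using A by simp
      show "srw_prob adj (2 * (m * k)) v v \<le> \<epsilon>" for v
      proof -
        have "1 \<le> 2 * (m * k)" using m k(1) by (simp add: Suc_le_eq)
        then show ?thesis using HK unfolding HK_def \<epsilon>_def by blast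
      qed
      have "L * ?m = c * (H * ?m powr (1 + \<alpha>)) powr \<gamma>"
        using H m \<alpha>(3) by (simp add: powr_mult powr_powr)
      also have "\<dots> \<le> c * real (2 * (m * k)) powr \<gamma>"
      proof (intro mult_left_mono powr_mono2)
        have "H * ?m powr (1 + \<alpha>) = ?m * (H * ?m powr \<alpha>)" using m by (simp add: powr_add)
        also have "\<dots> \<le> ?m * real k" using k by (intro mult_left_mono) auto
        also have "\<dots> \<le> real (2 * (m * k))" by simp
        finally show "H * ?m powr (1 + \<alpha>) \<le> real (2 * (m * k))" .
      qed (use H \<gamma> c in auto)
      finally have "\<epsilon> \<le> exp (- (L * ?m))" by (simp add: \<epsilon>_def)
      moreover have "real N \<le> exp (B * ln A * ?m)"
      proof -
        have "real N \<le> real A ^ (B * m)" unfolding N_def using A by (simp add: of_nat_diff)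
        also have "\<dots> = exp (B * ln A * ?m)"
          using A by (simp add: ln_realpow[symmetric] exp_of_nat_mult[symmetric] mult_ac)
            (simp add: exp_of_nat_mult power_mult)
        finally show ?thesis .
      qed
      ultimately have "real N * \<epsilon> \<le> exp (B * ln A * ?m) * exp (- (L * ?m))"
        by (intro mult_mono) (auto simp: \<epsilon>_def)
      also have "\<dots> = exp (- ?m)" by (simp add: L_def exp_add[symmetric] algebra_simps)
      also have "\<dots> = \<rho> ^ k" using k by (simp add: \<rho>_def exp_of_nat_mult[symmetric])
      finally show "real N * \<epsilon> \<le> \<rho> ^ k" .
    qed (auto simp: \<rho>_def \<epsilon>_def)
    let ?g = "exp (- a * ?m powr \<eta>)"
    have "a * ?m powr \<eta> \<le> ?m / real k"
    proof -
      have "?m powr \<eta> * ?m powr \<alpha> = ?m" using \<alpha>(2) m by (simp add: powr_add[symmetric])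
      then have "a * ?m powr \<eta> * ((H + 1) * ?m powr \<alpha>) = ?m"
        using H by (simp add: a_def)
      moreover have "a * ?m powr \<eta> * real k \<le> a * ?m powr \<eta> * ((H + 1) * ?m powr \<alpha>)"
        using a k2 by (intro mult_left_mono) auto
      ultimately show ?thesis using k by (simp add: pos_le_divide_eq)
    qed
    then have \<rho>g: "\<rho> \<le> ?g" by (simp add: \<rho>_def)
    have "K / (p * sqrt (real (A ^ m))) * (2 + 1 / p) ^ (2 * m + 1) \<le> C3 * ?g"
    proof -
      have bp: "0 \<le> 2 + 1 / p" "2 + 1 / p \<le> b" using p p0 pp by (auto simp: b_def frac_le)
      have "K / (p * sqrt (real (A ^ m))) * (2 + 1 / p) ^ (2 * m + 1) \<le> K / (p0 * sqrt (real (A ^ m))) * b ^ (2 * m + 1)"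
        using p p0 K bp A by (intro mult_mono power_mono divide_left_mono mult_right_mono) auto
      also have "\<dots> = C3 * (b\<^sup>2 / sqrt A) ^ m"
        by (simp add: C3_def real_sqrt_power power_divide power_mult[symmetric] power_add)
      also have "\<dots> \<le> C3 * exp (- 1) ^ m"
      proof (intro mult_left_mono power_mono)
        have "b\<^sup>2 \<le> exp (- 1) * sqrt A"
          using mult_left_mono[OF sqrtA, of "exp (- 1)"] by (simp add: mult.assoc[symmetric] exp_add[symmetric])
        then show "b\<^sup>2 / sqrt A \<le> exp (- 1)" using A by (simp add: divide_le_eq)
      qed (use C3 in auto)
      also have "exp (- 1 :: real) ^ m = exp (- ?m)" by (simp add: exp_of_nat_mult[symmetric])
      also have "C3 * exp (- ?m) \<le> C3 * ?g"
      proof -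
        have "a * ?m powr \<eta> \<le> 1 * ?m powr 1"
          using a m \<eta>1 by (intro mult_mono powr_mono) auto
        then show ?thesis using C3 m by (intro mult_left_mono) auto
      qed
      finally show ?thesis .
    qed
    moreover have "K * \<rho> \<le> K * ?g" using \<rho>g K by (rule mult_left_mono)
    moreover have "(p0 ^ D * tmax p (A ^ m))\<^sup>2 \<le> (p ^ D * tmax p (A ^ m))\<^sup>2"
      using p p0 tmax_nonneg[of p "A ^ m"] by (intro power_mono mult_right_mono) auto
    ultimately have "(p0 ^ D)\<^sup>2 * (tmax p (A ^ m))\<^sup>2 \<le> (K + C3) * ?g + real (2 * m + 1) * tmax p (A ^ (B * m))"
      using main unfolding N power_mult_distrib by (simp add: algebra_simps)
    also have "\<dots> \<le> (K + C3 + 1) * ?g + (K + C3 + 1) * (real (2 * m + 1) * tmax p (A ^ (B * m)))"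
    proof (rule add_mono)
      have "0 \<le> real (2 * m + 1) * tmax p (A ^ (B * m))" using tmax_nonneg[of p] p p0 by simp
      then show "real (2 * m + 1) * tmax p (A ^ (B * m)) \<le> (K + C3 + 1) * (real (2 * m + 1) * tmax p (A ^ (B * m)))"
        using mult_right_mono[of 1 "K + C3 + 1" "real (2 * m + 1) * tmax p (A ^ (B * m))"] K C3 by simp
    qed simp
    finally have "(tmax p (A ^ m))\<^sup>2 * (p0 ^ D)\<^sup>2 \<le> (K + C3 + 1) * (?g + real (2 * m + 1) * tmax p (A ^ (B * m)))"
      by (simp add: algebra_simps)
    then have "(tmax p (A ^ m))\<^sup>2 \<le> (K + C3 + 1) * (?g + real (2 * m + 1) * tmax p (A ^ (B * m))) / (p0 ^ D)\<^sup>2"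
      unfolding pos_le_divide_eq[OF pD(1)] .
    then show "(tmax p (A ^ m))\<^sup>2 \<le> C1 * (?g + real (2 * m + 1) * tmax p (A ^ (B * m)))"
      by (simp add: C1_def)
  qed
qed

text \<open>Along the scales \<open>A ^ (B ^ j * m)\<close> the inequality loses only a square root per step, whereas
  the claimed bound gains a power 8 per step. Since the tail at a fixed \<open>p\<close> is exponential, the
  bound holds at a very large scale and propagates down to \<open>m\<close> with constants independent of \<open>p\<close>.\<close>
lemma uniform_bound:
  assumes HK: "HK adj \<gamma> c" and c: "0 < c" and \<gamma>: "1 / 2 < \<gamma>" "\<gamma> \<le> 1" and p0: "0 < p0" "p0 \<le> 1"
  obtains A :: nat and T :: "nat \<Rightarrow> real" where "T \<longlonglongrightarrow> 0"
    and "\<And>p z m. p0 \<le> p \<Longrightarrow> p \<le> 1 \<Longrightarrow> 0 < z \<Longrightarrow> z < 1 \<Longrightarrow> (\<And>n. tmax p n \<le> 4 * z ^ n) \<Longrightarrow>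
      1 \<le> m \<Longrightarrow> tmax p (A ^ m) \<le> T m"
proof -
  define \<eta> where "\<eta> = 2 - 1 / \<gamma>"
  have \<eta>: "0 < \<eta>" "\<eta> \<le> 1" using \<gamma> by (auto simp: \<eta>_def field_simps)
  \<comment> \<open>The condition \<open>8 \<le> B powr \<eta>\<close> turns the rate
    \<open>a / 4\<close> at scale \<open>B * m\<close> into \<open>2 * a\<close> at scale
    \<open>m\<close>: one half of it absorbs the factor \<open>2 * m + 1\<close>, the other half
    matches the error term of rate \<open>a\<close>.\<close>
  obtain B :: nat where "8 powr (1 / \<eta>) \<le> B" using real_arch_simple by blast
  then have "(8 powr (1 / \<eta>)) powr \<eta> \<le> real B powr \<eta>" using \<eta> by (intro powr_mono2) auto
  then have B8: "8 \<le> real B powr \<eta>" using \<eta> by (simp add: powr_powr)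
  have B0: "B \<noteq> 0" "B \<noteq> 1" using B8 by (rule_tac [!] notI) simp_all
  then have B: "2 \<le> B" by simp
  obtain A :: nat and a C1 :: real where A: "2 \<le> A" and a: "0 < a" "a \<le> 1" and C1: "1 \<le> C1"
    and scale: "\<And>p m. p0 \<le> p \<Longrightarrow> p \<le> 1 \<Longrightarrow> 1 \<le> m \<Longrightarrow>
      (tmax p (A ^ m))\<^sup>2 \<le> C1 * (exp (- a * real m powr \<eta>) + real (2 * m + 1) * tmax p (A ^ (B * m)))"
    by (rule scale_inequality[OF HK c \<gamma> p0 \<eta>_def, of B]) (use B in auto)
  have "(\<lambda>m. (2 * real m + 1) * exp (- a * real m powr \<eta>)) \<longlonglongrightarrow> 0"
    using a \<eta> by real_asymp
  then have "Bseq (\<lambda>m. (2 * real m + 1) * exp (- a * real m powr \<eta>))"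
    by (intro convergent_imp_Bseq) (auto simp: convergent_def)
  then obtain C2 where C2: "0 < C2" "\<And>m. norm ((2 * real m + 1) * exp (- a * real m powr \<eta>)) \<le> C2"
    by (auto simp: Bseq_def)
  \<comment> \<open>This choice makes \<open>C1 * (Q + Q * C2) = Q\<^sup>2\<close>, so the constant
    reproduces itself after the square root.\<close>
  define Q where "Q = C1 * (1 + C2)"
  have Q: "1 \<le> Q" using mult_mono[of 1 C1 1 "1 + C2"] C1 C2 by (simp add: Q_def)
  define T where "T m = Q * exp (- (a / 4) * real m powr \<eta>)" for m
  have "T \<longlonglongrightarrow> 0" unfolding T_def using a \<eta> by real_asymp
  moreover have "tmax p (A ^ m) \<le> T m"
    if p: "p0 \<le> p" "p \<le> 1" and z: "0 < z" "z < 1" "\<And>n. tmax p n \<le> 4 * z ^ n" and m: "1 \<le> m" for p z m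
  proof -
    have down: "tmax p (A ^ m) \<le> T m" if m: "1 \<le> m" and IH: "tmax p (A ^ (B * m)) \<le> T (B * m)" for m
    proof -
      let ?g = "exp (- a * real m powr \<eta>)" and ?h = "exp (- (a / 4) * real m powr \<eta>)"
      have hg: "?h ^ 4 = ?g" by (simp add: exp_of_nat_mult[symmetric])
      have h1: "?h \<le> 1" using a by simp
      have "8 * real m powr \<eta> \<le> real (B * m) powr \<eta>"
        using B8 by (simp add: powr_mult mult_right_mono)
      then have "(a / 4) * (8 * real m powr \<eta>) \<le> (a / 4) * real (B * m) powr \<eta>"
        using a by (intro mult_left_mono) auto
      then have "T (B * m) \<le> Q * exp (- a * real m powr \<eta> + - a * real m powr \<eta>)"
        unfolding T_def using Q by (intro mult_left_mono) auto
      also have "\<dots> = Q * (?g * ?g)" by (simp only: exp_add)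
      finally have "real (2 * m + 1) * tmax p (A ^ (B * m)) \<le> real (2 * m + 1) * (Q * (?g * ?g))"
        using IH by (intro mult_left_mono) auto
      also have "\<dots> = (Q * ?g) * (real (2 * m + 1) * ?g)" by simp
      also have "\<dots> \<le> (Q * ?g) * C2"
        using C2(2)[of m] Q by (intro mult_left_mono) (auto simp: add.commute)
      finally have "C1 * (?g + real (2 * m + 1) * tmax p (A ^ (B * m))) \<le> C1 * (Q * ?g + (Q * ?g) * C2)"
        using C1 Q by (intro mult_left_mono add_mono) auto
      also have "\<dots> = Q\<^sup>2 * ?g" by (simp add: Q_def power2_eq_square algebra_simps)
      also have "\<dots> \<le> Q\<^sup>2 * ?h\<^sup>2"
        unfolding hg[symmetric] using h1 by (intro mult_left_mono power_decreasing) auto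
      also have "\<dots> = (T m)\<^sup>2" by (simp add: T_def power_mult_distrib)
      finally have "(tmax p (A ^ m))\<^sup>2 \<le> (T m)\<^sup>2"
        using scale[OF p m] by simp
      then show ?thesis by (rule power2_le_imp_le) (use Q in \<open>simp add: T_def\<close>)
    qed
    obtain M where M: "\<And>m. M \<le> m \<Longrightarrow> 4 * z ^ (A ^ m) \<le> exp (- real m)"
      using double_exp_decay[OF z(1,2) A] by (auto simp: eventually_sequentially)
    have large: "tmax p (A ^ m) \<le> T m" if m: "M \<le> m" "1 \<le> m" for m
    proof -
      have "(a / 4) * real m powr \<eta> \<le> 1 * real m powr 1"
        using a m \<eta> by (intro mult_mono powr_mono) auto
      then have "exp (- real m) \<le> 1 * exp (- (a / 4) * real m powr \<eta>)" by simp
      also have "\<dots> \<le> T m" unfolding T_def using Q by (intro mult_right_mono) auto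
      finally show ?thesis using M[OF m(1)] z(3)[of "A ^ m"] by simp
    qed
    have "tmax p (A ^ (B ^ j * m)) \<le> T (B ^ j * m) \<Longrightarrow> tmax p (A ^ m) \<le> T m" for j
    proof (induction j)
      case (Suc j)
      have "1 \<le> B ^ j * m" using B m by simp
      then have "tmax p (A ^ (B ^ j * m)) \<le> T (B ^ j * m)"
        by (rule down) (use Suc.prems in \<open>simp add: mult.assoc\<close>)
      then show ?case by (rule Suc.IH)
    qed simp
    moreover have "tmax p (A ^ (B ^ M * m)) \<le> T (B ^ M * m)"
    proof (rule large)
      have "M \<le> 2 ^ M" using less_exp[of M] by simp
      also have "\<dots> \<le> B ^ M" using B by (intro power_mono) auto
      also have "\<dots> \<le> B ^ M * m" using m by simp
      finally show "M \<le> B ^ M * m" .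
      show "1 \<le> B ^ M * m" using B m by simp
    qed
    ultimately show ?thesis by blast
  qed
  ultimately show ?thesis by (rule that)
qed

end

section \<open>The percolation measure\<close>

lemma pred_finite_coordinates:
  assumes "finite G" "\<And>e. e \<in> G \<Longrightarrow> Measurable.pred N (\<lambda>\<omega>. \<omega> e)"
  shows "Measurable.pred N (\<lambda>\<omega>. P {e \<in> G. \<omega> e})"
  using assms
proof (induction G arbitrary: P rule: finite_induct)
  case (insert g G)
  have [measurable]: "Measurable.pred N (\<lambda>\<omega>. \<omega> g)" using insert.prems by simp
  have [measurable]: "Measurable.pred N (\<lambda>\<omega>. Q {e \<in> G. \<omega> e})" for Q
    using insert.prems by (intro insert.IH) auto
  have "{e \<in> insert g G. \<omega> e} = (if \<omega> g then insert g {e \<in> G. \<omega> e} else {e \<in> G. \<omega> e})" for \<omega>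
    by auto
  then have "(\<lambda>\<omega>. P {e \<in> insert g G. \<omega> e}) =
      (\<lambda>\<omega>. (\<omega> g \<and> P (insert g {e \<in> G. \<omega> e})) \<or> (\<not> \<omega> g \<and> P {e \<in> G. \<omega> e}))"
    by auto
  also have "Measurable.pred N \<dots>" by measurable
  finally show ?case .
qed simp

text \<open>Deleting one edge breaks a cluster into pieces contained in at most three clusters, one
  of which is infinite. This makes the existence of an infinite cluster a tail event, although the
  infinite cluster of a given vertex may be lost.\<close>

lemma infinite_cl_remove_finite:
  assumes "finite D" "infinite (cl T v)" "\<And>d. d \<in> D \<Longrightarrow> \<exists>x y. d = {x, y}"
  shows "\<exists>w. infinite (cl (T - D) w)"
  using assms
proof (induction D rule: finite_induct)
  case (insert d D)
  then obtain w where w: "infinite (cl (T - D) w)" by blast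
  obtain x y where d: "d = {x, y}" using insert.prems by blast
  let ?U = "T - insert d D"
  have "cl (T - D) w \<subseteq> cl (insert {x, y} ?U) w" unfolding d by (rule cl_mono) auto
  also have "\<dots> \<subseteq> cl ?U w \<union> cl ?U x \<union> cl ?U y" by (rule cl_insert_edge_subset)
  finally have "infinite (cl ?U w \<union> cl ?U x \<union> cl ?U y)" using w finite_subset by blast
  then show ?case by blast
qed auto

lemma bexp_1: "finite F \<Longrightarrow> bexp 1 F f = f F"
  by (induction F arbitrary: f rule: finite_induct) (auto simp: bexp_insert)

lemma bexp_0: "finite F \<Longrightarrow> bexp 0 F f = f {}"
  by (induction F arbitrary: f rule: finite_induct) (auto simp: bexp_insert)

context perc_graph
begin

definition opens :: "('v set \<Rightarrow> bool) \<Rightarrow> 'v set set" where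
  "opens \<omega> = {e \<in> E. \<omega> e}"

lemma cluster_eq: "cluster adj \<omega> v = cl (opens \<omega>) v"
proof -
  have "(\<lambda>x y. adj x y \<and> \<omega> {x, y}) = (\<lambda>x y. {x, y} \<in> opens \<omega>)"
    by (auto simp: opens_def fun_eq_iff)
  then show ?thesis by (simp add: cluster_def cl_def)
qed

lemma countable_UNIV: "countable (UNIV :: 'v set)"
proof -
  fix o' :: 'v
  have "UNIV = (\<Union>n. ball n o')" using in_some_ball by blast
  then show ?thesis by (metis countable_UN countable_finite countableI_type finite_ball)
qed

lemma countable_E: "countable E"
proof -
  have "E \<subseteq> (\<lambda>(x, y). {x, y}) ` (UNIV \<times> UNIV)" by (auto elim!: edgeE)
  moreover have "countable ((UNIV :: 'v set) \<times> (UNIV :: 'v set))"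
    by (rule countable_SIGMA[OF countable_UNIV countable_UNIV])
  ultimately show ?thesis by (meson countable_image countable_subset)
qed

lemma infinite_E: "infinite E"
proof
  assume "finite E"
  then have "finite (\<Union>E)" by (auto elim!: edgeE)
  moreover have "UNIV \<subseteq> \<Union>E"
  proof
    fix v
    obtain w where "adj v w" by (metis all_not_in_conv mem_nbrs nbrs_nonempty)
    then have "{v, w} \<in> E" by simp
    then show "v \<in> \<Union>E" by blast
  qed
  ultimately show False using infinite_UNIV finite_subset by blast
qed

text \<open>Intersecting with \<open>bedges n v\<close> makes each condition local and each cluster
  finite, so that \<open>card\<close> never takes its default value 0 on an infinite set.\<close>

lemma infinite_cl_iff:
  assumes "T \<subseteq> E"
  shows "infinite (cl T v) \<longleftrightarrow> (\<forall>n. n \<le> card (cl (T \<inter> bedges n v) v))"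
proof
  assume inf: "infinite (cl T v)"
  show "\<forall>n. n \<le> card (cl (T \<inter> bedges n v) v)"
  proof (rule ccontr)
    assume "\<not> ?thesis"
    then obtain n where n: "card (cl (T \<inter> bedges n v) v) \<le> n" by (auto simp: not_le intro: less_imp_le)
    let ?S = "T \<inter> bedges n v"
    have sub: "cl ?S v \<subseteq> ball n v"
      by (rule cl_subset_ball) (use assms n in auto)
    have "cl T v \<subseteq> cl ?S v"
    proof (rule cl_subset)
      fix x y assume x: "x \<in> cl ?S v" "{x, y} \<in> T"
      then have "{x, y} \<in> ?S" using sub assms by (auto simp: bedges_def touching_def)
      then show "y \<in> cl ?S v" using x cl_step[of x ?S v y] by simp
    qed simp
    moreover have "finite (cl ?S v)" by simp
    ultimately show False using inf finite_subset by blast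
  qed
next
  assume all: "\<forall>n. n \<le> card (cl (T \<inter> bedges n v) v)"
  show "infinite (cl T v)"
  proof
    assume fin: "finite (cl T v)"
    let ?n = "Suc (card (cl T v))"
    have "?n \<le> card (cl (T \<inter> bedges ?n v) v)" using all by blast
    also have "\<dots> \<le> card (cl T v)" using fin by (intro card_mono cl_mono) auto
    finally show False by simp
  qed
qed

abbreviation PM :: "real \<Rightarrow> ('v set \<Rightarrow> bool) measure" where
  "PM p \<equiv> perc_measure adj p"

lemma prob_space_PM: "prob_space (PM p)"
  unfolding perc_measure_def by (intro prob_space_PiM measure_pmf.prob_space_axioms)

lemma space_PM: "space (PM p) = PiE E (\<lambda>_. UNIV)"
  by (simp add: perc_measure_def space_PiM)

lemma pred_coordinate: "e \<in> E \<Longrightarrow> Measurable.pred (PM p) (\<lambda>\<omega>. \<omega> e)"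
proof -
  assume "e \<in> E"
  then have "(\<lambda>\<omega>. \<omega> e) \<in> measurable (PM p) (measure_pmf (bernoulli_pmf p))"
    unfolding perc_measure_def by (rule measurable_component_singleton)
  then show ?thesis by (simp cong: measurable_cong_sets)
qed

lemma opens_Int: "F \<subseteq> E \<Longrightarrow> opens \<omega> \<inter> F = {e \<in> F. \<omega> e}"
  by (auto simp: opens_def)

lemma pred_opens_Int: "finite F \<Longrightarrow> F \<subseteq> E \<Longrightarrow> Measurable.pred (PM p) (\<lambda>\<omega>. P (opens \<omega> \<inter> F))"
  unfolding opens_Int by (intro pred_finite_coordinates pred_coordinate) auto

text \<open>The bridge from the product measure to \<open>bexp\<close>: the event is split according
  to the exact set of open edges in \<open>F\<close>.\<close>

lemma prob_cylinder:
  assumes p: "0 \<le> p" "p \<le> 1" and F: "finite F" "F \<subseteq> E"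
  shows "measure (PM p) {\<omega> \<in> space (PM p). P (opens \<omega> \<inter> F)} = bexp p F (\<lambda>S. of_bool (P S))"
proof -
  interpret product_prob_space "\<lambda>_. measure_pmf (bernoulli_pmf p)" E
    by (intro product_prob_spaceI measure_pmf.prob_space_axioms)
  interpret PM: prob_space "PM p" by (rule prob_space_PM)
  let ?C = "\<lambda>S. {\<omega> \<in> space (PM p). opens \<omega> \<inter> F = S}"
  have single: "measure (PM p) (?C S) = p ^ card S * (1 - p) ^ card (F - S)" if S: "S \<subseteq> F" for S
  proof -
    have "?C S = prod_emb E (\<lambda>_. measure_pmf (bernoulli_pmf p)) F (PiE F (\<lambda>e. {e \<in> S}))"
    proof -
      have "opens \<omega> \<inter> F = S \<longleftrightarrow> (\<forall>e\<in>F. \<omega> e = (e \<in> S))" for \<omega>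
        unfolding opens_Int[OF F(2)] using S by auto
      then show ?thesis by (auto simp: prod_emb_def space_PM PiE_iff extensional_def)
    qed
    then have "emeasure (PM p) (?C S) = (\<Prod>e\<in>F. emeasure (measure_pmf (bernoulli_pmf p)) {e \<in> S})"
      unfolding perc_measure_def using F by (simp add: emeasure_PiM_emb)
    also have "\<dots> = (\<Prod>e\<in>F. ennreal (if e \<in> S then p else 1 - p))"
      using p by (intro prod.cong refl) (auto simp: emeasure_pmf_single)
    also have "\<dots> = ennreal (\<Prod>e\<in>F. if e \<in> S then p else 1 - p)"
      using p by (intro prod_ennreal) auto
    also have "(\<Prod>e\<in>F. if e \<in> S then p else 1 - p) = p ^ card S * (1 - p) ^ card (F - S)"
    proof -
      have "F \<inter> {e. e \<in> S} = S" "F \<inter> - {e. e \<in> S} = F - S" using S by auto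
      then show ?thesis using F by (simp add: prod.If_cases)
    qed
    finally show ?thesis using p by (simp add: measure_def)
  qed
  have "{\<omega> \<in> space (PM p). P (opens \<omega> \<inter> F)} = (\<Union>S\<in>{S \<in> Pow F. P S}. ?C S)" by auto
  also have "measure (PM p) \<dots> = (\<Sum>S\<in>{S \<in> Pow F. P S}. measure (PM p) (?C S))"
  proof (rule PM.finite_measure_finite_Union)
    show "?C ` {S \<in> Pow F. P S} \<subseteq> sets (PM p)"
      using pred_opens_Int[OF F, where p = p] by (auto simp: pred_def)
  qed (use F in \<open>auto simp: disjoint_family_on_def\<close>)
  also have "\<dots> = (\<Sum>S\<in>Pow F. p ^ card S * (1 - p) ^ card (F - S) * of_bool (P S))"
    using F single by (intro sum.mono_neutral_cong_left) auto
  finally show ?thesis by (simp add: bexp_def)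
qed

section \<open>Infinite clusters as limits of local events, and the zero-one law\<close>

definition inf_event :: "real \<Rightarrow> 'v \<Rightarrow> ('v set \<Rightarrow> bool) set" where
  "inf_event p v = {\<omega> \<in> space (PM p). infinite (cl (opens \<omega>) v)}"

definition big_event :: "real \<Rightarrow> 'v \<Rightarrow> nat \<Rightarrow> ('v set \<Rightarrow> bool) set" where
  "big_event p v n = {\<omega> \<in> space (PM p). n \<le> card (cl (opens \<omega> \<inter> bedges n v) v)}"

lemma opens_subset: "opens \<omega> \<subseteq> E"
  by (auto simp: opens_def)

lemma inf_event_eq: "inf_event p v = (\<Inter>n. big_event p v n)"
  by (auto simp: inf_event_def big_event_def infinite_cl_iff[OF opens_subset])

lemma big_event_sets: "big_event p v n \<in> sets (PM p)"
  unfolding big_event_def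
  using pred_opens_Int[OF finite_bedges bedges_subset, where P = "\<lambda>S. n \<le> card (cl S v)"] by (simp add: pred_def)

lemma inf_event_sets: "inf_event p v \<in> sets (PM p)"
  unfolding inf_event_eq using big_event_sets by (intro sets.countable_INT) auto

lemma prob_big_event: "0 \<le> p \<Longrightarrow> p \<le> 1 \<Longrightarrow> measure (PM p) (big_event p v n) = theta p n v"
  unfolding big_event_def theta_eq_bedges big_def
  using prob_cylinder[OF _ _ finite_bedges bedges_subset, where P = "\<lambda>S. n \<le> card (cl S v)"] by simp

lemma big_event_decseq: "decseq (big_event p v)"
  unfolding decseq_def big_event_def
proof safe
  fix m n \<omega> assume mn: "m \<le> n" and n: "n \<le> card (cl (opens \<omega> \<inter> bedges n v) v)"
  let ?S = "opens \<omega> \<inter> bedges n v"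
  have "big m v (?S \<inter> bedges m v) = big m v ?S"
    by (rule suppD[OF supp_big]) (use opens_subset in auto)
  moreover have "big m v ?S = 1" using mn n by (simp add: big_def)
  moreover have "?S \<inter> bedges m v = opens \<omega> \<inter> bedges m v" using bedges_mono[OF mn] by auto
  ultimately show "m \<le> card (cl (opens \<omega> \<inter> bedges m v) v)" by (auto simp: big_def split: if_splits)
qed

lemma theta_tendsto:
  assumes "0 \<le> p" "p \<le> 1"
  shows "(\<lambda>n. theta p n v) \<longlonglongrightarrow> measure (PM p) (inf_event p v)"
proof -
  interpret prob_space "PM p" by (rule prob_space_PM)
  have "(\<lambda>n. measure (PM p) (big_event p v n)) \<longlonglongrightarrow> measure (PM p) (\<Inter>n. big_event p v n)"
    using big_event_sets big_event_decseq by (intro finite_Lim_measure_decseq) auto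
  then show ?thesis using assms by (simp add: inf_event_eq prob_big_event)
qed

lemma AE_no_infinite_cluster:
  assumes "\<And>v. measure (PM p) (inf_event p v) = 0"
  shows "AE \<omega> in PM p. \<not> has_inf_cluster adj \<omega>"
proof -
  interpret prob_space "PM p" by (rule prob_space_PM)
  have "AE \<omega> in PM p. \<forall>v\<in>UNIV. \<omega> \<notin> inf_event p v"
  proof (rule AE_ball_countable'[OF _ countable_UNIV])
    fix v
    show "AE \<omega> in PM p. \<omega> \<notin> inf_event p v"
      using assms[of v] inf_event_sets by (intro AE_not_in) (auto simp: null_sets_def emeasure_eq_measure)
  qed
  then show ?thesis
    using AE_space by eventually_elim (auto simp: has_inf_cluster_def cluster_eq inf_event_def)
qed

text \<open>The edges are enumerated by the naturals and their states are independent. By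
  \<open>infinite_cl_remove_finite\<close> the event is determined by the edges from any index on,
  so Kolmogorov's law applies.\<close>

lemma zero_one_law:
  defines "X p \<equiv> {\<omega> \<in> space (PM p). has_inf_cluster adj \<omega>}"
  shows "measure (PM p) (X p) = 0 \<or> measure (PM p) (X p) = 1"
proof -
  interpret prob_space "PM p" by (rule prob_space_PM)
  let ?e = "from_nat_into E"
  have bij: "bij_betw ?e UNIV E" using countable_E infinite_E by (rule bij_betw_from_nat_into)
  then have inj: "inj ?e" and e: "?e n \<in> E" for n by (auto simp: bij_betw_def)
  let ?N = "measure_pmf (bernoulli_pmf p)"
  define G where "G n = {(\<lambda>\<omega>. \<omega> (?e n)) -` B \<inter> space (PM p) | B. B \<in> sets ?N}" for n
  define \<A> where "\<A> n = sigma_sets (space (PM p)) (G n)" for n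
  have rv: "(\<lambda>\<omega>. \<omega> (?e n)) \<in> measurable (PM p) ?N" for n
    unfolding perc_measure_def by (rule measurable_component_singleton[OF e])
  have "indep_vars (\<lambda>_. ?N) (\<lambda>n \<omega>. \<omega> (?e n)) UNIV"
  proof (subst indep_vars_iff_distr_eq_PiM)
    have "distr (PM p) ?N (\<lambda>\<omega>. \<omega> (?e n)) = ?N" for n
      unfolding perc_measure_def by (rule distr_PiM_component[OF measure_pmf.prob_space_axioms e])
    moreover have "distr (PM p) (PiM UNIV (\<lambda>n. ?N)) (\<lambda>\<omega>. \<lambda>n\<in>UNIV. \<omega> (?e n)) = PiM UNIV (\<lambda>n. ?N)"
      unfolding perc_measure_def
      by (rule distr_PiM_reindex[OF measure_pmf.prob_space_axioms]) (use inj e in auto)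
    ultimately show "distr (PM p) (PiM UNIV (\<lambda>n. ?N)) (\<lambda>\<omega>. \<lambda>n\<in>UNIV. \<omega> (?e n))
        = PiM UNIV (\<lambda>n. distr (PM p) ?N (\<lambda>\<omega>. \<omega> (?e n)))" by simp
  qed (use rv in auto)
  then have indep: "indep_sets \<A> UNIV"
    unfolding indep_vars_def \<A>_def G_def by simp
  have sigma: "sigma_algebra (space (PM p)) (\<A> n)" for n
    unfolding \<A>_def by (rule sigma_algebra_sigma_sets) (auto simp: G_def)
  have "X p \<in> sigma_sets (space (PM p)) (\<Union> (\<A> ` {n..}))" for n
  proof -
    define \<Sigma> where "\<Sigma> = sigma (space (PM p)) (\<Union> (\<A> ` {n..}))"
    have sub: "\<Union> (\<A> ` {n..}) \<subseteq> Pow (space (PM p))"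
    proof -
      have "G k \<subseteq> Pow (space (PM p))" for k by (auto simp: G_def)
      from sigma_sets_into_sp[OF this] show ?thesis unfolding \<A>_def by blast
    qed
    have space: "space \<Sigma> = space (PM p)" and sets: "sets \<Sigma> = sigma_sets (space (PM p)) (\<Union> (\<A> ` {n..}))"
      using sub by (simp_all add: \<Sigma>_def)
    define D where "D = ?e ` {..<n}"
    have D: "finite D" "D \<subseteq> E" using e by (auto simp: D_def)
    have coord: "Measurable.pred \<Sigma> (\<lambda>\<omega>. \<omega> g)" if g: "g \<in> E - D" for g
    proof -
      obtain k where k: "g = ?e k" using g bij by (auto simp: bij_betw_def)
      then have "n \<le> k" using g by (auto simp: D_def not_less[symmetric])
      moreover have "{\<omega> \<in> space \<Sigma>. \<omega> g} \<in> G k"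
        unfolding G_def space k by (intro CollectI exI[of _ "{True}"]) auto
      ultimately show ?thesis
        unfolding pred_def sets \<A>_def by (intro sigma_sets.Basic) (auto intro!: sigma_sets.Basic)
    qed
    \<comment> \<open>The event is rewritten through finite sets of edges that avoid the first
      \<open>n\<close> ones, which exhibits its measurability for the tail.\<close>
    have iff: "has_inf_cluster adj \<omega> \<longleftrightarrow> (\<exists>v\<in>UNIV. \<forall>m\<in>UNIV. m \<le> card (cl {e \<in> bedges m v - D. \<omega> e} v))" for \<omega>
    proof -
      have "has_inf_cluster adj \<omega> \<longleftrightarrow> (\<exists>v. infinite (cl (opens \<omega>) v))"
        by (simp add: has_inf_cluster_def cluster_eq)
      also have "\<dots> \<longleftrightarrow> (\<exists>v. infinite (cl (opens \<omega> - D) v))"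
      proof
        assume "\<exists>v. infinite (cl (opens \<omega>) v)"
        then obtain v where v: "infinite (cl (opens \<omega>) v)" by blast
        show "\<exists>v. infinite (cl (opens \<omega> - D) v)"
          by (rule infinite_cl_remove_finite[OF D(1) v]) (use D edgeE in blast)
      next
        assume "\<exists>v. infinite (cl (opens \<omega> - D) v)"
        then show "\<exists>v. infinite (cl (opens \<omega>) v)"
          using cl_mono[of "opens \<omega> - D" "opens \<omega>"] finite_subset by blast
      qed
      also have "\<dots> \<longleftrightarrow> (\<exists>v. \<forall>m. m \<le> card (cl ((opens \<omega> - D) \<inter> bedges m v) v))"
        using infinite_cl_iff[of "opens \<omega> - D"] opens_subset[of \<omega>] by (metis Diff_subset order.trans)
      also have "\<dots> \<longleftrightarrow> (\<exists>v\<in>UNIV. \<forall>m\<in>UNIV. m \<le> card (cl {e \<in> bedges m v - D. \<omega> e} v))"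
      proof -
        have "(opens \<omega> - D) \<inter> bedges m v = {e \<in> bedges m v - D. \<omega> e}" for m v
          using bedges_subset by (auto simp: opens_def)
        then show ?thesis by simp
      qed
      finally show ?thesis .
    qed
    have "Measurable.pred \<Sigma> (\<lambda>\<omega>. \<exists>v\<in>UNIV. \<forall>m\<in>UNIV. m \<le> card (cl {e \<in> bedges m v - D. \<omega> e} v))"
    proof (intro measurable_pred_countable)
      fix v and m :: nat
      show "Measurable.pred \<Sigma> (\<lambda>\<omega>. m \<le> card (cl {e \<in> bedges m v - D. \<omega> e} v))"
        by (rule pred_finite_coordinates[where P = "\<lambda>S. m \<le> card (cl S v)"])
           (use coord bedges_subset in auto)
    qed (use countable_UNIV in auto)
    then show ?thesis unfolding X_def iff pred_def space sets .
  qed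
  then have "X p \<in> tail_events \<A>" by (simp add: tail_events_def)
  then show ?thesis using kolmogorov_0_1_law[OF sigma indep] by blast
qed

text \<open>Since \<open>p_crit\<close> is defined by almost sure existence, this dichotomy is what
  turns its failure below \<open>p_crit\<close> into almost sure absence.\<close>

lemma inf_event_null_or_AE:
  "(\<forall>v. measure (PM p) (inf_event p v) = 0) \<or> (AE \<omega> in PM p. has_inf_cluster adj \<omega>)"
proof (rule disjCI)
  interpret prob_space "PM p" by (rule prob_space_PM)
  let ?X = "{\<omega> \<in> space (PM p). has_inf_cluster adj \<omega>}"
  assume not: "\<not> (AE \<omega> in PM p. has_inf_cluster adj \<omega>)"
  have X: "?X = (\<Union>v\<in>UNIV. inf_event p v)"
    by (auto simp: has_inf_cluster_def cluster_eq inf_event_def)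
  then have sets: "?X \<in> events" using countable_UNIV inf_event_sets by auto
  then have "prob ?X \<noteq> 1" using not prob_Collect_eq_1[of "has_inf_cluster adj"] by simp
  then have "prob ?X = 0" using zero_one_law[of p] by blast
  moreover have "prob (inf_event p v) \<le> prob ?X" for v
    by (rule finite_measure_mono[OF _ sets]) (use X in blast)
  ultimately show "\<forall>v. prob (inf_event p v) = 0" by (metis measure_le_0_iff)
qed

text \<open>This makes the set in \<open>p_crit\<close> nonempty, so that its \<open>Inf\<close> is
  a genuine infimum.\<close>

lemma AE_infinite_cluster_1: "AE \<omega> in PM 1. has_inf_cluster adj \<omega>"
proof -
  have "infinite (cl E v)" for v
  proof -
    have "cl E v = UNIV"
    proof
      have "w \<in> cl E v" for w
        using connected by (simp add: connected_graph_def cl_def)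
      then show "UNIV \<subseteq> cl E v" by blast
    qed simp
    then show ?thesis using infinite_UNIV by simp
  qed
  then have "n \<le> card (cl (E \<inter> bedges n v) v)" for n v
    using infinite_cl_iff[of E v] by blast
  moreover have "E \<inter> bedges n v = bedges n v" for n v using bedges_subset by blast
  ultimately have "theta 1 n v = 1" for n v
    by (simp add: theta_eq_bedges bexp_1 big_def)
  then have "measure (PM 1) (inf_event 1 v) = 1" for v
    using theta_tendsto[of 1 v] by (simp add: LIMSEQ_const_iff)
  then show ?thesis using inf_event_null_or_AE[of 1] by auto
qed

section \<open>The critical parameter\<close>

lemma p_crit_bounds: "0 \<le> p_crit adj" "p_crit adj \<le> 1"
proof -
  let ?S = "{p \<in> {0..1}. AE \<omega> in PM p. has_inf_cluster adj \<omega>}"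
  have one: "1 \<in> ?S" using AE_infinite_cluster_1 by simp
  show "0 \<le> p_crit adj" unfolding p_crit_def using one by (intro cInf_greatest) auto
  show "p_crit adj \<le> 1" unfolding p_crit_def
    by (rule cInf_lower[OF one]) (auto intro!: bdd_belowI[of _ 0])
qed

lemma subcritical_theta:
  assumes "0 \<le> p" "p < p_crit adj"
  shows "(\<lambda>n. theta p n v) \<longlonglongrightarrow> 0"
proof -
  have p1: "p \<le> 1" using assms p_crit_bounds by simp
  have "\<not> (AE \<omega> in PM p. has_inf_cluster adj \<omega>)"
  proof
    assume "AE \<omega> in PM p. has_inf_cluster adj \<omega>"
    then have "p \<in> {p \<in> {0..1}. AE \<omega> in PM p. has_inf_cluster adj \<omega>}" using assms p1 by simp
    then have "p_crit adj \<le> p" unfolding p_crit_def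
      by (rule cInf_lower) (auto intro!: bdd_belowI[of _ 0])
    then show False using assms by simp
  qed
  then have "measure (PM p) (inf_event p v) = 0" using inf_event_null_or_AE by blast
  then show ?thesis using theta_tendsto[OF assms(1) p1, of v] by simp
qed

lemma critical_bound:
  assumes HK: "HK adj \<gamma> c" and c: "0 < c" and \<gamma>: "1 / 2 < \<gamma>" and pc: "0 < p_crit adj"
  shows "measure (PM (p_crit adj)) (inf_event (p_crit adj) v) = 0"
proof -
  let ?pc = "p_crit adj"
  \<comment> \<open>A positive lower bound on \<open>p\<close> keeps the opening cost
    \<open>1 / p\<close> bounded while \<open>p\<close> increases to \<open>p_crit\<close>.\<close>
  define p0 where "p0 = ?pc / 2"
  have p0: "0 < p0" "p0 \<le> 1" "p0 < ?pc" using pc p_crit_bounds by (auto simp: p0_def)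
  obtain A :: nat and T :: "nat \<Rightarrow> real" where T: "T \<longlonglongrightarrow> 0"
    and bound: "\<And>p z m. p0 \<le> p \<Longrightarrow> p \<le> 1 \<Longrightarrow> 0 < z \<Longrightarrow> z < 1 \<Longrightarrow> (\<And>n. tmax p n \<le> 4 * z ^ n) \<Longrightarrow>
      1 \<le> m \<Longrightarrow> tmax p (A ^ m) \<le> T m"
    by (rule uniform_bound[OF HK_min[OF HK c] c _ _ p0(1,2)]) (use \<gamma> in auto)
  have below: "theta p (A ^ m) v \<le> T m" if p: "p0 \<le> p" "p < ?pc" and m: "1 \<le> m" for p m
  proof -
    \<comment> \<open>Exponential decay at \<open>p\<close> requires vanishing tails at a larger
      parameter, so an intermediate one is inserted below \<open>p_crit\<close>.\<close>
    define p' where "p' = (p + ?pc) / 2"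
    have p': "p < p'" "p' < ?pc" "p' \<le> 1" "0 \<le> p" "0 \<le> p'" using p p0 p_crit_bounds by (auto simp: p'_def)
    obtain z where "0 < z" "z < 1" "\<And>n. tmax p n \<le> 4 * z ^ n"
      by (rule exponential_decay[OF p'(4,1,3) subcritical_theta[OF p'(5,2)]]) blast
    then have "tmax p (A ^ m) \<le> T m" using p p' m by (intro bound) auto
    then show ?thesis using theta_le_tmax[of p "A ^ m" v] by simp
  qed
  have at_pc: "theta ?pc (A ^ m) v \<le> T m" if m: "1 \<le> m" for m
  proof (rule LIMSEQ_le_const2)
    \<comment> \<open>At a fixed size the tail is a polynomial in \<open>p\<close>, so the bound
      below \<open>p_crit\<close> passes to the limit. The sequence starts at
      \<open>p_crit - p0 = p0\<close>, inside the range covered.\<close>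
    have "(\<lambda>n. ?pc - p0 / real (Suc n)) \<longlonglongrightarrow> ?pc - 0"
      by (intro tendsto_diff tendsto_const LIMSEQ_Suc lim_const_over_n)
    then have "(\<lambda>n. ?pc - p0 / real (Suc n)) \<longlonglongrightarrow> ?pc" by simp
    then show "(\<lambda>n. theta (?pc - p0 / real (Suc n)) (A ^ m) v) \<longlonglongrightarrow> theta ?pc (A ^ m) v"
      unfolding theta_eq_bedges by (rule isCont_tendsto_compose[OF bexp_continuous])
    have "theta (?pc - p0 / real (Suc n)) (A ^ m) v \<le> T m" for n
    proof (rule below[OF _ _ m])
      have "p0 / real (Suc n) \<le> p0 / 1" using p0 by (intro divide_left_mono) auto
      then show "p0 \<le> ?pc - p0 / real (Suc n)" by (simp add: p0_def)
      show "?pc - p0 / real (Suc n) < ?pc" using p0 by simp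
    qed
    then show "\<exists>N. \<forall>n\<ge>N. theta (?pc - p0 / real (Suc n)) (A ^ m) v \<le> T m" by blast
  qed
  interpret prob_space "PM ?pc" by (rule prob_space_PM)
  have "prob (inf_event ?pc v) \<le> T m" if m: "1 \<le> m" for m
  proof -
    have "prob (inf_event ?pc v) \<le> prob (big_event ?pc v (A ^ m))"
      by (intro finite_measure_mono big_event_sets) (auto simp: inf_event_eq)
    also have "\<dots> = theta ?pc (A ^ m) v" by (rule prob_big_event[OF p_crit_bounds])
    also have "\<dots> \<le> T m" by (rule at_pc[OF m])
    finally show ?thesis .
  qed
  then have "prob (inf_event ?pc v) \<le> 0" by (intro LIMSEQ_le_const[OF T]) blast
  then show ?thesis by (simp add: measure_le_0_iff)
qed

text \<open>The opening argument divides by \<open>p\<close>, so \<open>p_crit = 0\<close> is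
  separate: with all edges closed every cluster is a single vertex.\<close>

lemma critical_zero: "p_crit adj = 0 \<Longrightarrow> measure (PM (p_crit adj)) (inf_event (p_crit adj) v) = 0"
proof -
  assume pc: "p_crit adj = 0"
  have "theta 0 n v = 0" if "2 \<le> n" for n
  proof -
    have "cl {} v = {v}" using cl_subset[of v "{v}" "{}"] by auto
    then show ?thesis using that by (simp add: theta_eq_bedges bexp_0 big_def)
  qed
  then have "(\<lambda>n. theta 0 n v) \<longlonglongrightarrow> 0"
    by (intro tendsto_eventually) (auto simp: eventually_sequentially)
  then show ?thesis using theta_tendsto[of 0 v] pc LIMSEQ_unique by auto
qed

end

theorem theorem1p1:
  fixes adj :: "'v \<Rightarrow> 'v \<Rightarrow> bool" and \<gamma> c :: real
  assumes "sym_graph adj"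
    and "connected_graph adj"
    and "locally_finite adj"
    and "unimodular adj"
    and "quasi_transitive adj"
    and "c > 0" and "\<gamma> > 1/2"
    and "HK adj \<gamma> c"
  shows "AE \<omega> in perc_measure adj (p_crit adj). \<not> has_inf_cluster adj \<omega>"
proof (cases "finite (UNIV :: 'v set)")
  case True
  then have "\<not> has_inf_cluster adj \<omega>" for \<omega>
    unfolding has_inf_cluster_def using finite_subset[OF subset_UNIV] by blast
  then show ?thesis by simp
next
  case False
  interpret perc_graph adj
    by unfold_locales (use assms False in auto)
  show ?thesis
  proof (rule AE_no_infinite_cluster)
    fix v
    show "measure (PM (p_crit adj)) (inf_event (p_crit adj) v) = 0"
    proof (cases "p_crit adj = 0")
      case False
      then have "0 < p_crit adj" using p_crit_bounds by simp
      then show ?thesis by (rule critical_bound[OF assms(8,6,7)])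
    qed (rule critical_zero)
  qed
qed

end
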